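(* Let $k\geq 1$ be an integer and $d=6k+1$. Then the data consisting of $\widetilde\Sigma=\Sigma=S$, the degree $d$, and the three partitions of $d$ $$(2^{3k},1),\quad (3^{2k},1),\quad (6^{k},1)$$ form a candidate surface branched cover, and it is realizable if and only if $d$ can be expressed as $x^2+xy+y^2$ for some $x,y\in\mathbb{N}$.
   Context: $\mathbb{N}$ denotes the non-negative integers and $S$ the 2-sphere. A partition of $d$ is a finite unordered list (multiset) of positive integers with sum $d$; $\ell(\Pi)$ is the number of entries of $\Pi$; $(a^m,b,\ldots)$ means that $a$ is repeated $m$ times. For closed connected orientable surfaces $\widetilde\Sigma,\Sigma$, a branched cover $f:\widetilde\Sigma\to\Sigma$ is a map locally modelled on $(\mathbb{C},0)\to(\mathbb{C},0)$, $z\mapsto z^k$ with $k\geq 1$; $k$ is the local degree at the source point, and a point of $\Sigma$ having a preimage with local degree $>1$ is a branching point. The degree $d$ of $f$ is the degree of the genuine cover obtained by removing the branching points and their preimages; the local degrees at the preimages of a branching point form a partition of $d$. A candidate surface branched cover consists of closed connected orientable surfaces $\widetilde\Sigma,\Sigma$, integers $d\geq 2$ and $n\geq 1$, and an unordered collection (repetitions allowed) $\Pi_1,\ldots,\Pi_n$ of partitions of $d$ satisfying the Riemann-Hurwitz condition $\chi(\widetilde\Sigma)-\sum_i\ell(\Pi_i)=d\,(\chi(\Sigma)-n)$. It is realizable if there is a degree-$d$ branched cover $f:\widetilde\Sigma\to\Sigma$ with $n$ branching points whose associated partitions of local degrees are $\Pi_1,\ldots,\Pi_n$. *)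

theory Defs
  imports
    "HOL-Homology.Homology"
    "HOL-Complex_Analysis.Complex_Analysis"
    "HOL-Library.Multiset"
begin

section \<open>Closed connected orientable surfaces\<close>

definition surface_chart :: "'a::topological_space set \<Rightarrow> 'a set \<Rightarrow> ('a \<Rightarrow> complex) \<Rightarrow> bool" where
  "surface_chart S U \<phi> \<longleftrightarrow>
     openin (top_of_set S) U \<and> open (\<phi> ` U) \<and> homeomorphism U (\<phi> ` U) \<phi> (inv_into U \<phi>)"

text \<open>For a homeomorphism \<open>g\<close> between open subsets of the plane, the winding number below is
  the local degree of \<open>g\<close> at \<open>z\<close>; it is \<open>1\<close> or \<open>-1\<close> and does not depend on \<open>r\<close>.\<close>

definition orientation_preserving_on :: "complex set \<Rightarrow> (complex \<Rightarrow> complex) \<Rightarrow> bool" where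
  "orientation_preserving_on A g \<longleftrightarrow>
     (\<forall>z r. 0 < r \<and> cball z r \<subseteq> A \<longrightarrow> winding_number (g \<circ> circlepath z r) (g z) = 1)"

definition oriented_atlas :: "'a::topological_space set \<Rightarrow> ('a set \<times> ('a \<Rightarrow> complex)) set \<Rightarrow> bool" where
  "oriented_atlas S \<A> \<longleftrightarrow>
     (\<forall>(U, \<phi>)\<in>\<A>. surface_chart S U \<phi>) \<and>
     (\<Union>(U, \<phi>)\<in>\<A>. U) = S \<and>
     (\<forall>(U, \<phi>)\<in>\<A>. \<forall>(V, \<psi>)\<in>\<A>.
        orientation_preserving_on (\<phi> ` (U \<inter> V)) (\<psi> \<circ> inv_into U \<phi>))"

definition closed_connected_orientable_surface :: "'a::topological_space set \<Rightarrow> bool" where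
  "closed_connected_orientable_surface S \<longleftrightarrow>
     S \<noteq> {} \<and> compact S \<and> connected S \<and> Hausdorff_space (top_of_set S) \<and> (\<exists>\<A>. oriented_atlas S \<A>)"

section \<open>Euler characteristic\<close>

definition int_independent :: "('a, 'b) monoid_scheme \<Rightarrow> 'a set \<Rightarrow> bool" where
  "int_independent G B \<longleftrightarrow>
     (\<forall>c :: 'a \<Rightarrow> int. finprod G (\<lambda>b. b [^]\<^bsub>G\<^esub> c b) B = \<one>\<^bsub>G\<^esub> \<longrightarrow> (\<forall>b\<in>B. c b = 0))"

text \<open>Only meaningful for abelian groups of finite rank, such as the homology groups of a
  compact surface; on \<^typ>\<open>nat\<close> the supremum of an unbounded set is unspecified.\<close>

definition abelian_group_rank :: "('a, 'b) monoid_scheme \<Rightarrow> nat" where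
  "abelian_group_rank G = Sup {card B | B. finite B \<and> B \<subseteq> carrier G \<and> int_independent G B}"

definition betti_number :: "nat \<Rightarrow> 'a::topological_space set \<Rightarrow> nat" where
  "betti_number p S = abelian_group_rank (homology_group (int p) (top_of_set S))"

definition euler_char :: "'a::topological_space set \<Rightarrow> int" where
  "euler_char S = (\<Sum>p | betti_number p S \<noteq> 0. (-1) ^ p * int (betti_number p S))"

section \<open>Branched covers\<close>

definition has_local_degree ::
  "'a::topological_space set \<Rightarrow> 'b::topological_space set \<Rightarrow> ('a \<Rightarrow> 'b) \<Rightarrow> 'a \<Rightarrow> nat \<Rightarrow> bool" where
  "has_local_degree T S f x k \<longleftrightarrow> k \<ge> 1 \<and>
     (\<exists>U \<phi> V \<psi>. surface_chart T U \<phi> \<and> x \<in> U \<and> \<phi> x = 0 \<and>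
        surface_chart S V \<psi> \<and> f ` U \<subseteq> V \<and> \<psi> (f x) = 0 \<and>
        (\<forall>u\<in>U. \<psi> (f u) = \<phi> u ^ k))"

definition branched_cover ::
  "'a::topological_space set \<Rightarrow> 'b::topological_space set \<Rightarrow> ('a \<Rightarrow> 'b) \<Rightarrow> bool" where
  "branched_cover T S f \<longleftrightarrow>
     closed_connected_orientable_surface T \<and> closed_connected_orientable_surface S \<and>
     continuous_on T f \<and> f ` T \<subseteq> S \<and> (\<forall>x\<in>T. \<exists>k. has_local_degree T S f x k)"

text \<open>The local degree \<open>k\<close> at a point of a branched cover is unique, since \<open>f\<close> is \<open>k\<close>-to-one
  on small punctured neighbourhoods of that point.\<close>

definition local_degree ::
  "'a::topological_space set \<Rightarrow> 'b::topological_space set \<Rightarrow> ('a \<Rightarrow> 'b) \<Rightarrow> 'a \<Rightarrow> nat" where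
  "local_degree T S f x = (THE k. has_local_degree T S f x k)"

definition branching_points ::
  "'a::topological_space set \<Rightarrow> 'b::topological_space set \<Rightarrow> ('a \<Rightarrow> 'b) \<Rightarrow> 'b set" where
  "branching_points T S f = {y \<in> S. \<exists>x\<in>T. f x = y \<and> local_degree T S f x > 1}"

definition has_cover_degree ::
  "'a::topological_space set \<Rightarrow> 'b::topological_space set \<Rightarrow> ('a \<Rightarrow> 'b) \<Rightarrow> nat \<Rightarrow> bool" where
  "has_cover_degree T S f d \<longleftrightarrow>
     (let B = branching_points T S f in
        covering_space (T - f -` B) f (S - B) \<and>
        (\<forall>y\<in>S - B. finite {x \<in> T. f x = y} \<and> card {x \<in> T. f x = y} = d))"

definition local_degrees_over ::
  "'a::topological_space set \<Rightarrow> 'b::topological_space set \<Rightarrow> ('a \<Rightarrow> 'b) \<Rightarrow> 'b \<Rightarrow> nat multiset" where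
  "local_degrees_over T S f y = image_mset (local_degree T S f) (mset_set {x \<in> T. f x = y})"

section \<open>Candidate surface branched covers and realizability\<close>

definition partition_of :: "nat \<Rightarrow> nat multiset \<Rightarrow> bool" where
  "partition_of d P \<longleftrightarrow> 0 \<notin># P \<and> sum_mset P = d"

definition candidate_surface_branched_cover ::
  "'a::topological_space set \<Rightarrow> 'b::topological_space set \<Rightarrow> nat \<Rightarrow> nat multiset multiset \<Rightarrow> bool" where
  "candidate_surface_branched_cover T S d \<D> \<longleftrightarrow>
     closed_connected_orientable_surface T \<and> closed_connected_orientable_surface S \<and>
     d \<ge> 2 \<and> size \<D> \<ge> 1 \<and> (\<forall>P\<in>#\<D>. partition_of d P) \<and>
     euler_char T - (\<Sum>P\<in>#\<D>. int (size P)) = int d * (euler_char S - int (size \<D>))"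

definition realizable ::
  "'a::topological_space set \<Rightarrow> 'b::topological_space set \<Rightarrow> nat \<Rightarrow> nat multiset multiset \<Rightarrow> bool" where
  "realizable T S d \<D> \<longleftrightarrow>
     (\<exists>f. branched_cover T S f \<and> has_cover_degree T S f d \<and>
        finite (branching_points T S f) \<and> card (branching_points T S f) = size \<D> \<and>
        image_mset (local_degrees_over T S f) (mset_set (branching_points T S f)) = \<D>)"

abbreviation two_sphere :: "(real ^ 3) set" where
  "two_sphere \<equiv> sphere 0 1"

end

theory Submission
  imports Defs
begin

text \<open>Let \<open>\<zeta>\<close> be a primitive sixth root of unity and let \<open>G\<close> be the group of motions of the plane generated
  by multiplication with \<open>\<zeta>\<close> and the translations by the Eisenstein integers. The function
  \<open>\<Sum> (z - l) ^ -6\<close>, summed over the Eisenstein integers \<open>l\<close>, identifies the quotient of the plane by \<open>G\<close>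
  with the sphere; the quotient map \<open>F\<close> has local degree \<open>stab z\<close> at \<open>z\<close>, which exceeds \<open>1\<close> only on three
  orbits, where it is \<open>2\<close>, \<open>3\<close> and \<open>6\<close>.

  If \<open>d\<close> is the norm of an Eisenstein integer \<open>\<alpha>\<close>, then \<open>F z \<mapsto> F (\<alpha> * z)\<close> is a branched cover of degree
  \<open>d\<close>. Its local degree at \<open>F z\<close> is \<open>stab (\<alpha> * z) div stab z\<close>, and \<open>d\<close> being prime to \<open>6\<close> gives the three
  partitions.

  Conversely, move the branching points of a realization \<open>f\<close> to the three special values of \<open>F\<close>. The
  local degrees of \<open>f\<close> divide those of \<open>F\<close>, so \<open>F\<close> lifts locally, hence by simple connectedness of the
  plane globally, to a map \<open>L\<close> with \<open>f (L z) = F z\<close>, sending \<open>0\<close> to the unbranched point over the value of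
  order \<open>6\<close>. This forces \<open>L (\<zeta> * z) = L z\<close>, so the periods of \<open>L\<close> form an ideal of the Eisenstein integers.
  The ideal is principal, and its index is \<open>d\<close> because translates of \<open>L\<close> exhaust a generic fibre of \<open>f\<close>.\<close>

section \<open>The Euler characteristic of the sphere\<close>

text \<open>The exponent 6 is forced twice. Under z -> \<zeta> * z the sum of (z - l) ^ -n is
  multiplied by \<zeta> ^ -n, so invariance without vanishing needs 6 to divide n; and F separates
  orbits only if the pole order equals the order 6 of the stabiliser of 0.

  A realization is merely continuous with topological power charts, so the converse works with
  continuous lifts. The obstacle is at the branching points, where f is no covering: there a lift
  needs a continuous root of a change of chart, and the value at such a point does not determine the
  lift. Hence uniqueness is claimed only from base points outside the countable set of points with
  nontrivial stabiliser, and lifts are extended disc by disc.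

  The invariance of L under \<zeta> is where the unbranched point enters: f is injective near L 0,
  so L and its rotated copy, two lifts of F with the same value at 0, agree near 0. At a point of
  local degree 6 over F 0 they would differ by a local rotation.\<close>

lemma abelian_group_rank_trivial:
  assumes "trivial_group G"
  shows "abelian_group_rank G = 0"
proof -
  interpret group G using assms by (simp add: trivial_group_def)
  have car: "carrier G = {\<one>\<^bsub>G\<^esub>}" using assms by (simp add: trivial_group_def)
  have "B = {}" if B: "finite B" "B \<subseteq> carrier G" "int_independent G B" for B
  proof (rule ccontr)
    assume "B \<noteq> {}"
    then have B1: "B = {\<one>\<^bsub>G\<^esub>}" using B car by auto
    have cm: "comm_monoid G"
      by unfold_locales (use car in auto)
    have "finprod G (\<lambda>b. b [^]\<^bsub>G\<^esub> (1::int)) B = \<one>\<^bsub>G\<^esub>"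
      using comm_monoid.finprod_one_eqI[OF cm] B1 by (metis int_pow_one singletonD)
    then show False
      using B(3) B1 unfolding int_independent_def by (auto dest: spec[where x = "\<lambda>_. 1"])
  qed
  moreover have "int_independent G {}"
    by (simp add: int_independent_def)
  ultimately have "{card B | B. finite B \<and> B \<subseteq> carrier G \<and> int_independent G B} = {0}"
    by force
  then show ?thesis
    by (simp add: abelian_group_rank_def)
qed

text \<open>Two integers a and b always satisfy b * a - a * b = 0, which bounds the rank by 1, and a
  preimage of the integer 1 is independent.\<close>

lemma abelian_group_rank_integer_group:
  assumes "comm_group G" and "G \<cong> integer_group"
  shows "abelian_group_rank G = 1"
proof -
  interpret comm_group G by fact
  obtain h where h: "h \<in> iso G integer_group"
    using assms(2) by (auto simp: is_iso_def)
  then have hom: "h \<in> hom G integer_group" and bij: "bij_betw h (carrier G) UNIV"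
    by (auto simp: iso_def)
  interpret gh: group_hom G integer_group h
    using hom by (simp add: group_hom_def group_hom_axioms_def)
  have hpow: "h (b [^]\<^bsub>G\<^esub> n) = n * h b" if "b \<in> carrier G" for b and n :: int
    using gh.hom_int_pow[OF that, of n] by (simp add: mult.commute)
  have hsum: "h (finprod G f B) = (\<Sum>b\<in>B. h (f b))"
    if "finite B" "f \<in> B \<rightarrow> carrier G" for f :: "'a \<Rightarrow> 'a" and B
    using that by (induction B) (auto simp: Pi_iff)
  have h_one: "x = \<one>\<^bsub>G\<^esub>" if "x \<in> carrier G" "h x = 0" for x
    using that bij gh.hom_one by (metis bij_betw_imp_inj_on inj_onD one_closed one_integer_group)
  have lincomb: "finprod G (\<lambda>b. b [^]\<^bsub>G\<^esub> c b) B = \<one>\<^bsub>G\<^esub> \<longleftrightarrow> (\<Sum>b\<in>B. c b * h b) = 0"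
    if "finite B" "B \<subseteq> carrier G" for B and c :: "'a \<Rightarrow> int"
  proof -
    have car: "(\<lambda>b. b [^]\<^bsub>G\<^esub> c b) \<in> B \<rightarrow> carrier G"
      using that by auto
    have "h (finprod G (\<lambda>b. b [^]\<^bsub>G\<^esub> c b) B) = (\<Sum>b\<in>B. c b * h b)"
      unfolding hsum[OF that(1) car] using that(2) by (intro sum.cong) (auto simp: hpow)
    then show ?thesis
      using h_one[OF finprod_closed[OF car]] gh.hom_one by auto
  qed
  have le1: "card B \<le> 1" if B: "finite B" "B \<subseteq> carrier G" "int_independent G B" for B
  proof (rule ccontr)
    assume "\<not> card B \<le> 1"
    then obtain b1 b2 where b: "b1 \<in> B" "b2 \<in> B" "b1 \<noteq> b2"
      by (metis B(1) card_le_Suc0_iff_eq One_nat_def)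
    define c :: "'a \<Rightarrow> int" where "c b = (if b = b1 then h b2 else if b = b2 then - h b1 else 0)" for b
    have "(\<Sum>b\<in>B. c b * h b) = (\<Sum>b\<in>{b1,b2}. c b * h b)"
      by (rule sum.mono_neutral_right) (use B b in \<open>auto simp: c_def\<close>)
    also have "\<dots> = 0"
      using b by (simp add: c_def)
    finally have "\<forall>b\<in>B. c b = 0"
      using B lincomb[OF B(1,2)] unfolding int_independent_def by blast
    then have "h b2 = 0" "h b1 = 0"
      using b by (auto simp: c_def split: if_splits)
    then show False
      using h_one b B(2) by (metis subsetD)
  qed
  obtain g where g: "g \<in> carrier G" "h g = 1"
    using bij by (metis UNIV_I bij_betw_imp_surj_on imageE)
  have ind: "int_independent G {g}"
    unfolding int_independent_def
  proof (intro allI impI ballI)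
    fix c :: "'a \<Rightarrow> int" and b
    assume "finprod G (\<lambda>b. b [^]\<^bsub>G\<^esub> c b) {g} = \<one>\<^bsub>G\<^esub>" "b \<in> {g}"
    then show "c b = 0"
      using lincomb[of "{g}" c] g by auto
  qed
  have "1 \<in> {card B | B. finite B \<and> B \<subseteq> carrier G \<and> int_independent G B}"
    by (rule CollectI, rule exI[of _ "{g}"]) (use g ind in auto)
  then show ?thesis
    unfolding abelian_group_rank_def
    by (intro cSup_eq_maximum) (use le1 in auto)
qed

lemma two_sphere_homeomorphic_nsphere: "top_of_set two_sphere homeomorphic_space nsphere 2"
proof -
  have "card (Basis :: (real^3) set) = 3"
    by simp
  then obtain f :: "(nat \<Rightarrow> real) \<Rightarrow> real^3" and g
    where "homeomorphic_maps (nsphere (3 - 1)) (top_of_set (sphere 0 1 \<inter> span Basis)) f g"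
    by - (rule homeomorphic_maps_nsphere_euclidean_sphere[of "Basis :: (real^3) set" 3],
      auto simp: pairwise_def orthogonal_def inner_Basis independent_Basis)
  then show ?thesis
    using homeomorphic_space_def homeomorphic_space_sym by fastforce
qed

text \<open>Reduced and ordinary homology differ only in degree 0, which path-connectedness settles;
  in the other degrees the known reduced homology of \<open>nsphere 2\<close> carries over.\<close>

lemma betti_number_two_sphere: "betti_number p two_sphere = (if p = 0 \<or> p = 2 then 1 else 0)"
proof (cases "p = 0")
  case True
  have "path_connected two_sphere"
    by (rule path_connected_sphere) simp
  moreover have "two_sphere \<noteq> {}"
    by simp
  ultimately have "homology_group 0 (top_of_set two_sphere) \<cong> integer_group"
    by (intro isomorphic_integer_zeroth_homology_group) auto
  then show ?thesis
    using True by (simp add: betti_number_def abelian_group_rank_integer_group)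
next
  case False
  have eq: "reduced_homology_group (int p) (top_of_set two_sphere) = homology_group (int p) (top_of_set two_sphere)"
    using False by (intro un_reduced_homology_group) auto
  have iso: "homology_group (int p) (top_of_set two_sphere) \<cong> reduced_homology_group (int p) (nsphere 2)"
    using homeomorphic_space_imp_isomorphic_reduced_homology_groups[OF two_sphere_homeomorphic_nsphere, of "int p"] eq
    by simp
  show ?thesis
  proof (cases "p = 2")
    case True
    then have "reduced_homology_group (int p) (nsphere 2) \<cong> integer_group"
      using reduced_homology_group_nsphere(1)[of 2] by simp
    then show ?thesis
      using iso True iso_trans abelian_group_rank_integer_group abelian_homology_group
      by (metis betti_number_def)
  next
    case nz: False
    have "trivial_group (reduced_homology_group (int p) (nsphere 2))"
      by (rule reduced_homology_group_nsphere(2)) (use nz in auto)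
    then have "trivial_group (homology_group (int p) (top_of_set two_sphere))"
      using isomorphic_group_triviality[OF iso] by simp
    then show ?thesis
      using False nz by (simp add: betti_number_def abelian_group_rank_trivial)
  qed
qed

lemma euler_char_two_sphere: "euler_char two_sphere = 2"
proof -
  have "{p. betti_number p two_sphere \<noteq> 0} = {0, 2}"
    by (auto simp: betti_number_two_sphere)
  then show ?thesis
    by (simp add: euler_char_def betti_number_two_sphere)
qed

section \<open>Charts and local degrees\<close>

lemma surface_chart_homeomorphism:
  assumes "surface_chart S U \<phi>"
  shows "homeomorphism U (\<phi> ` U) \<phi> (inv_into U \<phi>)"
  using assms by (simp add: surface_chart_def)

lemma surface_chart_openin: "surface_chart S U \<phi> \<Longrightarrow> openin (top_of_set S) U"
  and surface_chart_open_image: "surface_chart S U \<phi> \<Longrightarrow> open (\<phi> ` U)"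
  and surface_chart_continuous: "surface_chart S U \<phi> \<Longrightarrow> continuous_on U \<phi>"
  and surface_chart_continuous_inv: "surface_chart S U \<phi> \<Longrightarrow> continuous_on (\<phi> ` U) (inv_into U \<phi>)"
  and surface_chart_subset: "surface_chart S U \<phi> \<Longrightarrow> U \<subseteq> S"
  by (auto simp: surface_chart_def homeomorphism_def dest: openin_imp_subset)

lemma surface_chart_inj: "surface_chart S U \<phi> \<Longrightarrow> inj_on \<phi> U"
  by (metis surface_chart_homeomorphism homeomorphism_apply1 inj_on_inverseI)

text \<open>\<open>surface_chart\<close> insists on \<open>inv_into\<close> as inverse; any
  continuous inverse agrees with it on the image.\<close>

lemma surface_chartI:
  assumes "openin (top_of_set S) U" "homeomorphism U W \<phi> \<phi>'" "open W"
  shows "surface_chart S U \<phi>"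
proof -
  have W: "\<phi> ` U = W" and inj: "inj_on \<phi> U"
    using assms(2) by (auto simp: homeomorphism_def intro: inj_on_inverseI)
  have eq: "inv_into U \<phi> w = \<phi>' w" if "w \<in> W" for w
    using that assms(2) inj by (metis homeomorphism_def image_eqI inv_into_f_f)
  have "homeomorphism U W \<phi> (inv_into U \<phi>)"
    using assms(2) eq homeomorphism_cong by (metis (no_types, lifting))
  then show ?thesis
    using assms W by (simp add: surface_chart_def)
qed

lemma surface_chart_openin_preimage:
  assumes "surface_chart S U \<phi>" "open W"
  shows "openin (top_of_set S) (U \<inter> \<phi> -` W)"
  using continuous_openin_preimage_gen[OF surface_chart_continuous[OF assms(1)] assms(2)]
    openin_trans surface_chart_openin[OF assms(1)] by blast

lemma surface_chart_open_image_openin: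
  assumes "surface_chart S U \<phi>" "openin (top_of_set S) W" "W \<subseteq> U"
  shows "open (\<phi> ` W)"
proof -
  have "openin (top_of_set U) W"
    by (rule openin_subset_trans[OF assms(2,3) surface_chart_subset[OF assms(1)]])
  then have "openin (top_of_set (\<phi> ` U)) (\<phi> ` W)"
    using homeomorphism_imp_open_map[OF surface_chart_homeomorphism[OF assms(1)]] by blast
  then show ?thesis
    using openin_open_eq surface_chart_open_image[OF assms(1)] by blast
qed

lemma power_image_ball:
  fixes w :: complex
  assumes "k \<ge> 1" "norm w < e ^ k" "e > 0"
  obtains v where "norm v < e" "v ^ k = w"
proof -
  have k: "k > 0" using assms by simp
  obtain v where v: "v ^ k = w"
    using k exists_complex_root[of k w] by auto
  moreover have "norm v < e"
  proof (rule ccontr)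
    assume "\<not> norm v < e"
    then have "e ^ k \<le> norm v ^ k"
      using assms(3) by (intro power_mono) auto
    then show False
      using v assms(2) by (metis norm_power not_le)
  qed
  ultimately show ?thesis
    using that by blast
qed

text \<open>Lower bound on the fibres near x, read off from the k-th power in the charts. The point
  of \<open>N\<close> other than \<open>f x\<close> keeps the counting clause from being
  vacuous.\<close>

lemma has_local_degree_nhd:
  assumes "has_local_degree T S f x k" "openin (top_of_set T) W" "x \<in> W"
  obtains N where "openin (top_of_set S) N" "f x \<in> N" "\<exists>y\<in>N. y \<noteq> f x"
    "\<And>y. y \<in> N \<Longrightarrow> y \<in> f ` W"
    "\<And>y. y \<in> N \<Longrightarrow> y \<noteq> f x \<Longrightarrow> \<exists>X\<subseteq>W. finite X \<and> card X = k \<and> (\<forall>x'\<in>X. f x' = y)"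
proof -
  obtain U \<phi> V \<psi> where k: "k \<ge> 1" and U: "surface_chart T U \<phi>" "x \<in> U" "\<phi> x = 0"
    and V: "surface_chart S V \<psi>" "f ` U \<subseteq> V" "\<psi> (f x) = 0"
    and f: "\<And>u. u \<in> U \<Longrightarrow> \<psi> (f u) = \<phi> u ^ k"
    using assms(1) unfolding has_local_degree_def by blast
  have "open (\<phi> ` (U \<inter> W))"
    using U(1) assms(2) surface_chart_openin
    by (intro surface_chart_open_image_openin[OF U(1)]) (auto intro: openin_Int)
  moreover have "0 \<in> \<phi> ` (U \<inter> W)"
    using U assms(3) by force
  ultimately obtain e where e: "e > 0" "ball 0 e \<subseteq> \<phi> ` (U \<inter> W)"
    using openE by blast
  \<comment> \<open>Over a disc of radius \<open>e ^ k\<close> all k-th roots have norm below e, so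
    the whole local fibre lies in W.\<close>
  define N where "N = V \<inter> \<psi> -` ball 0 (e ^ k)"
  have N: "openin (top_of_set S) N"
    unfolding N_def by (intro surface_chart_openin_preimage V) auto
  have fxN: "f x \<in> N"
    using U V e by (auto simp: N_def)
  have sol: "\<exists>u\<in>U \<inter> W. \<phi> u = v \<and> f u = y" if "y \<in> N" "norm v < e" "v ^ k = \<psi> y" for y v
  proof -
    have "v \<in> ball 0 e" using that by simp
    then obtain u where u: "u \<in> U \<inter> W" "\<phi> u = v" using e by blast
    then have "\<psi> (f u) = \<psi> y"
      using f that by auto
    moreover have "f u \<in> V" "y \<in> V" using u V that by (auto simp: N_def)
    ultimately have "f u = y"
      using surface_chart_inj[OF V(1)] by (meson inj_onD)
    then show ?thesis using u by blast
  qed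
  have smallroot: "norm v < e" if "v ^ k = \<psi> y" "y \<in> N" for v y
  proof (rule ccontr)
    assume "\<not> norm v < e"
    then have "e ^ k \<le> norm v ^ k"
      using e(1) by (intro power_mono) auto
    then show False
      using that by (auto simp: N_def norm_power[symmetric])
  qed
  show ?thesis
  proof
    show "openin (top_of_set S) N" "f x \<in> N" by fact+
    show "\<exists>y\<in>N. y \<noteq> f x"
    proof -
      have "of_real (e/2) \<in> ball (0::complex) e" using e by simp
      then obtain u where u: "u \<in> U \<inter> W" "\<phi> u = of_real (e/2)" using e(2) by (metis imageE subsetD)
      have "norm (\<psi> (f u)) = (e/2)^k"
        using u f e by (simp add: norm_power del: of_real_divide)
      moreover have "(e/2)^k < e^k"
        using e k by (intro power_strict_mono) auto
      ultimately have "f u \<in> N"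
        using u V by (auto simp: N_def)
      moreover have "\<psi> (f u) \<noteq> 0"
        using u f[of u] e(1) by (auto simp del: of_real_divide)
      ultimately show ?thesis using V by metis
    qed
    show "y \<in> f ` W" if "y \<in> N" for y
    proof -
      have "norm (\<psi> y) < e ^ k" using that by (simp add: N_def)
      then obtain v where v: "norm v < e" "v ^ k = \<psi> y"
        by (rule power_image_ball[OF k _ e(1)])
      then show ?thesis
        using sol[OF that v] by blast
    qed
    show "\<exists>X\<subseteq>W. finite X \<and> card X = k \<and> (\<forall>x'\<in>X. f x' = y)" if y: "y \<in> N" "y \<noteq> f x" for y
    proof -
      define R where "R = {v. v ^ k = \<psi> y}"
      have "\<psi> y \<noteq> \<psi> (f x)"
        using y U(2) V surface_chart_inj[OF V(1)] by (metis IntE N_def image_subset_iff inj_onD)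
      then have R: "finite R" "card R = k"
        using V k by (auto simp: R_def card_nth_roots finite_nth_roots)
      have "\<forall>v\<in>R. \<exists>u\<in>U \<inter> W. \<phi> u = v \<and> f u = y"
        using sol y smallroot by (auto simp: R_def)
      then obtain g where g: "\<And>v. v \<in> R \<Longrightarrow> g v \<in> U \<inter> W \<and> \<phi> (g v) = v \<and> f (g v) = y"
        by metis
      have "inj_on g R"
        using g by (metis inj_onI)
      then show ?thesis
        using R g by (intro exI[of _ "g ` R"]) (auto simp: card_image)
    qed
  qed
qed

text \<open>A complex number has at most k roots of order k, and 0 has only one. Together with
  \<open>has_local_degree_nhd\<close> this pins down k.\<close>

lemma has_local_degree_le:
  assumes "has_local_degree T S f x k"
  obtains U where "openin (top_of_set T) U" "x \<in> U" "\<And>x'. x' \<in> U \<Longrightarrow> f x' = f x \<Longrightarrow> x' = x"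
    "\<And>X y. X \<subseteq> U \<Longrightarrow> (\<And>x'. x' \<in> X \<Longrightarrow> f x' = y) \<Longrightarrow> finite X \<and> card X \<le> k"
proof -
  obtain U \<phi> V \<psi> where k: "k \<ge> 1" and U: "surface_chart T U \<phi>" "x \<in> U" "\<phi> x = 0"
    and V: "surface_chart S V \<psi>" "f ` U \<subseteq> V" "\<psi> (f x) = 0"
    and f: "\<And>u. u \<in> U \<Longrightarrow> \<psi> (f u) = \<phi> u ^ k"
    using assms(1) unfolding has_local_degree_def by blast
  note inj = surface_chart_inj[OF U(1)]
  show ?thesis
  proof
    show "openin (top_of_set T) U" "x \<in> U"
      using U surface_chart_openin by auto
    show "x' = x" if "x' \<in> U" "f x' = f x" for x'
    proof -
      have "\<phi> x' = 0"
        using f[OF that(1)] that(2) V k by simp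
      then show ?thesis using inj U that by (metis inj_onD)
    qed
    show "finite X \<and> card X \<le> k" if X: "X \<subseteq> U" "\<And>x'. x' \<in> X \<Longrightarrow> f x' = y" for X y
    proof -
      have sub: "\<phi> ` X \<subseteq> {v. v ^ k = \<psi> y}"
        using X f by force
      have fin: "finite {v. v ^ k = \<psi> y}"
        using k by (intro finite_nth_roots) auto
      have "card {v. v ^ k = \<psi> y} \<le> k"
      proof (cases "\<psi> y = 0")
        case True
        then have "{v. v ^ k = \<psi> y} = {0}" using k by auto
        then show ?thesis using k by simp
      next
        case False
        then show ?thesis using k by (simp add: card_nth_roots)
      qed
      moreover have "inj_on \<phi> X" using inj X inj_on_subset by blast
      ultimately show ?thesis
        using sub fin by (metis card_image card_mono finite_imageD finite_subset le_trans)
    qed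
  qed
qed

text \<open>A neighbourhood whose fibres have at most k' points contains a fibre with at least k of
  them, so k \<le> k', and conversely by symmetry.\<close>

lemma has_local_degree_unique:
  assumes "has_local_degree T S f x k" "has_local_degree T S f x k'"
  shows "k = k'"
proof -
  have "k \<le> k'" if k: "has_local_degree T S f x k" and k': "has_local_degree T S f x k'" for k k'
  proof -
    obtain U where U: "openin (top_of_set T) U" "x \<in> U"
      "\<And>X y. X \<subseteq> U \<Longrightarrow> (\<And>x'. x' \<in> X \<Longrightarrow> f x' = y) \<Longrightarrow> finite X \<and> card X \<le> k'"
      using has_local_degree_le[OF k'] by metis
    obtain N where "\<exists>y\<in>N. y \<noteq> f x"
      "\<And>y. y \<in> N \<Longrightarrow> y \<noteq> f x \<Longrightarrow> \<exists>X\<subseteq>U. finite X \<and> card X = k \<and> (\<forall>x'\<in>X. f x' = y)"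
      using has_local_degree_nhd[OF k U(1,2)] by metis
    then show ?thesis
      using U(3) by metis
  qed
  then show ?thesis
    using assms by (meson le_antisym)
qed

lemma local_degree_eqI: "has_local_degree T S f x k \<Longrightarrow> local_degree T S f x = k"
  unfolding local_degree_def using has_local_degree_unique by blast

lemma has_local_degree_imp_open_map:
  assumes "\<And>x. x \<in> T \<Longrightarrow> \<exists>k. has_local_degree T S f x k" "openin (top_of_set T) W"
  shows "openin (top_of_set S) (f ` W)"
proof (subst openin_subopen, intro ballI)
  fix y assume "y \<in> f ` W"
  then obtain x where x: "x \<in> W" "y = f x" by blast
  then obtain k where k: "has_local_degree T S f x k"
    using assms openin_imp_subset by blast
  obtain N where "openin (top_of_set S) N" "f x \<in> N" "N \<subseteq> f ` W"
    using has_local_degree_nhd[OF k assms(2) x(1)] by (metis subsetI)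
  then show "\<exists>T. openin (top_of_set S) T \<and> y \<in> T \<and> T \<subseteq> f ` W"
    using x by blast
qed

text \<open>The fibre is closed in a compact space, and its points are isolated because a k-th power
  vanishes only at 0.\<close>

lemma branched_cover_finite_fibre:
  fixes T :: "'a::metric_space set" and S :: "'b::metric_space set"
  assumes bc: "branched_cover T S f"
  shows "finite {x \<in> T. f x = y}"
proof -
  have T: "compact T" and cont: "continuous_on T f"
    and loc: "\<And>x. x \<in> T \<Longrightarrow> \<exists>k. has_local_degree T S f x k"
    using bc by (auto simp: branched_cover_def closed_connected_orientable_surface_def)
  let ?X = "{x \<in> T. f x = y}"
  have "closedin (top_of_set T) ?X"
    by (rule continuous_closedin_preimage_constant[OF cont])
  then have "compact ?X"
    using T closedin_compact by blast
  moreover have "\<not> x islimpt ?X" if "x \<in> ?X" for x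
  proof
    assume lim: "x islimpt ?X"
    obtain k where k: "has_local_degree T S f x k" using loc \<open>x \<in> ?X\<close> by blast
    obtain U where U: "openin (top_of_set T) U" "x \<in> U"
      "\<And>x'. x' \<in> U \<Longrightarrow> f x' = f x \<Longrightarrow> x' = x"
      using has_local_degree_le[OF k] by metis
    then obtain W where W: "open W" "U = T \<inter> W"
      by (auto simp: openin_open)
    obtain x' where "x' \<in> ?X" "x' \<in> W" "x' \<noteq> x"
      using lim U W unfolding islimpt_def by blast
    then show False
      using U W that by auto
  qed
  ultimately have "finite (?X \<inter> ?X)"
    by (intro finite_not_islimpt_in_compact) auto
  then show ?thesis by simp
qed

lemma has_local_degree_1_off_branching:
  assumes "branched_cover T S f" "x \<in> T" "f x \<notin> branching_points T S f"
  shows "has_local_degree T S f x 1"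
proof -
  obtain k where k: "has_local_degree T S f x k" and "f x \<in> S"
    using assms by (auto simp: branched_cover_def)
  then have "\<not> k > 1"
    using assms by (auto simp: branching_points_def local_degree_eqI)
  moreover have "k \<ge> 1" using k by (simp add: has_local_degree_def)
  ultimately have "k = 1" by simp
  then show ?thesis using k by simp
qed

lemma has_local_degree_1_inj:
  assumes "has_local_degree T S f x 1"
  obtains U where "openin (top_of_set T) U" "x \<in> U" "inj_on f U"
proof -
  obtain U where U: "openin (top_of_set T) U" "x \<in> U"
    "\<And>X y. X \<subseteq> U \<Longrightarrow> (\<And>x'. x' \<in> X \<Longrightarrow> f x' = y) \<Longrightarrow> finite X \<and> card X \<le> 1"
    using has_local_degree_le[OF assms] by metis
  have "inj_on f U"
  proof (rule inj_onI, rule ccontr)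
    fix a b assume ab: "a \<in> U" "b \<in> U" "f a = f b" "a \<noteq> b"
    then have "card {a, b} \<le> 1"
      using U(3)[of "{a, b}" "f a"] by auto
    then show False using ab by simp
  qed
  then show ?thesis using that U by blast
qed

lemma finite_set_separated:
  fixes X :: "'a::metric_space set"
  assumes "finite X"
  obtains \<epsilon> where "\<epsilon> > 0" "\<And>x x'. x \<in> X \<Longrightarrow> x' \<in> X \<Longrightarrow> x \<noteq> x' \<Longrightarrow> ball x \<epsilon> \<inter> ball x' \<epsilon> = {}"
proof -
  \<comment> \<open>The entry 1 keeps D nonempty when X has at most one point.\<close>
  define D where "D = insert 1 ((\<lambda>(x, x'). dist x x') ` {(x, x') \<in> X \<times> X. x \<noteq> x'})"
  have D: "finite D" "D \<noteq> {}" "\<And>d. d \<in> D \<Longrightarrow> d > 0"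
    using assms by (auto simp: D_def intro: finite_subset[of _ "X \<times> X"])
  show ?thesis
  proof
    show "Min D / 2 > 0" using D by simp
    fix x x' assume "x \<in> X" "x' \<in> X" "x \<noteq> x'"
    then have "Min D \<le> dist x x'"
      using D by (intro Min_le) (auto simp: D_def)
    then show "ball x (Min D / 2) \<inter> ball x' (Min D / 2) = {}"
      by (intro disjoint_ballI) auto
  qed
qed

text \<open>Off the branching points f is injective near each point of a finite fibre. Compactness
  of T shrinks the base so that no further sheets appear over it.\<close>

lemma branched_cover_covering_space:
  fixes T :: "'a::metric_space set" and S :: "'b::metric_space set"
  assumes bc: "branched_cover T S f" and surj: "f ` T = S"
    and finB: "finite (branching_points T S f)"
  defines "B \<equiv> branching_points T S f"
  shows "covering_space (T - f -` B) f (S - B)"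
proof -
  have T: "compact T" and cont: "continuous_on T f"
    and loc: "\<And>x. x \<in> T \<Longrightarrow> \<exists>k. has_local_degree T S f x k"
    using bc by (auto simp: branched_cover_def closed_connected_orientable_surface_def)
  note opn = has_local_degree_imp_open_map[OF loc]
  have "closed B" using finB by (simp add: B_def finite_imp_closed)
  have "\<exists>N. y \<in> N \<and> openin (top_of_set (S - B)) N \<and>
          (\<exists>v. \<Union>v = (T - f -` B) \<inter> f -` N \<and> (\<forall>u\<in>v. openin (top_of_set (T - f -` B)) u) \<and>
            disjoint v \<and> (\<forall>u\<in>v. \<exists>q. homeomorphism u N f q))" if y: "y \<in> S - B" for y
  proof -
    define X where "X = {x \<in> T. f x = y}"
    have X: "finite X" "X \<noteq> {}"
      using branched_cover_finite_fibre[OF bc] y surj by (auto simp: X_def)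
    obtain \<epsilon> where \<epsilon>: "\<epsilon> > 0" "\<And>x x'. x \<in> X \<Longrightarrow> x' \<in> X \<Longrightarrow> x \<noteq> x' \<Longrightarrow> ball x \<epsilon> \<inter> ball x' \<epsilon> = {}"
      using finite_set_separated[OF X(1)] by blast
    have "\<exists>U. openin (top_of_set T) U \<and> x \<in> U \<and> inj_on f U" if "x \<in> X" for x
      using that y has_local_degree_1_inj[OF has_local_degree_1_off_branching[OF bc, of x]]
      by (auto simp: X_def B_def)
    then obtain U0 where U0: "\<And>x. x \<in> X \<Longrightarrow> openin (top_of_set T) (U0 x) \<and> x \<in> U0 x \<and> inj_on f (U0 x)"
      by metis
    define U where "U x = U0 x \<inter> ball x \<epsilon>" for x
    have U: "openin (top_of_set T) (U x)" "x \<in> U x" "inj_on f (U x)" "U x \<subseteq> T" if "x \<in> X" for x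
      using U0[OF that] \<epsilon>(1) openin_imp_subset
      by (auto simp: U_def intro: openin_Int_open inj_on_subset)
    \<comment> \<open>The first factor makes every sheet map onto \<open>N\<close>, the second
      removes the values taken outside the chosen neighbourhoods; the balls of radius \<epsilon>
      keep the sheets apart.\<close>
    define N where "N = (\<Inter>x\<in>X. f ` U x) \<inter> (S - f ` (T - (\<Union>x\<in>X. U x))) \<inter> (S - B)"
    have "openin (top_of_set S) (\<Inter>x\<in>X. f ` U x)"
      using X U by (intro openin_INT2) (auto intro: opn)
    moreover have "openin (top_of_set S) (S - f ` (T - (\<Union>x\<in>X. U x)))"
    proof -
      have "closedin (top_of_set T) (T - (\<Union>x\<in>X. U x))"
        using U by (intro closedin_diff) auto
      then have "compact (T - (\<Union>x\<in>X. U x))"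
        using T closedin_compact by blast
      then have "compact (f ` (T - (\<Union>x\<in>X. U x)))"
        using cont by (meson Diff_subset compact_continuous_image continuous_on_subset)
      then show ?thesis
        by (simp add: compact_imp_closed openin_diff closedin_closed_Int openin_open_Int Diff_eq open_Compl)
    qed
    moreover have "openin (top_of_set S) (S - B)"
      using \<open>closed B\<close> by (simp add: openin_open_Int Diff_eq open_Compl)
    ultimately have Nop: "openin (top_of_set S) N"
      unfolding N_def by (intro openin_Int)
    have "y \<in> N"
      using U y by (auto simp: N_def X_def)
    define v where "v = (\<lambda>x. U x \<inter> f -` N) ` X"
    have Uv: "openin (top_of_set T) (U x \<inter> f -` N)" if "x \<in> X" for x
    proof -
      have "openin (top_of_set T) (T \<inter> f -` N)"
        using cont Nop bc by (metis branched_cover_def continuous_on_open_gen image_subset_iff_funcset)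
      then have "openin (top_of_set T) (U x \<inter> (T \<inter> f -` N))"
        using U(1)[OF that] by (rule openin_Int[rotated])
      moreover have "U x \<inter> (T \<inter> f -` N) = U x \<inter> f -` N"
        using U(4)[OF that] by auto
      ultimately show ?thesis by simp
    qed
    show ?thesis
    proof (rule exI[of _ N], intro exI[of _ v] conjI ballI)
      show "y \<in> N" by fact
      show "openin (top_of_set (S - B)) N"
        by (rule openin_subset_trans[OF Nop]) (auto simp: N_def)
      show "\<Union>v = (T - f -` B) \<inter> f -` N"
        using U(4) by (auto simp: v_def N_def)
      show "openin (top_of_set (T - f -` B)) u" if "u \<in> v" for u
      proof -
        obtain x where x: "x \<in> X" and u: "u = U x \<inter> f -` N" using \<open>u \<in> v\<close> by (auto simp: v_def)
        show ?thesis
          unfolding u by (rule openin_subset_trans[OF Uv[OF x]]) (use U(4)[OF x] in \<open>auto simp: N_def\<close>)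
      qed
      show "disjoint v"
        using \<epsilon>(2) by (fastforce simp: v_def U_def pairwise_def disjnt_def)
      show "\<exists>q. homeomorphism u N f q" if "u \<in> v" for u
      proof -
        obtain x where x: "x \<in> X" and u: "u = U x \<inter> f -` N" using \<open>u \<in> v\<close> by (auto simp: v_def)
        show ?thesis
        proof -
          have "continuous_on u f"
            using cont U(4)[OF x] u continuous_on_subset by blast
          moreover have fu: "f ` u = N"
          proof -
            have "f ` u = f ` U x \<inter> N"
              unfolding u by blast
            moreover have "N \<subseteq> f ` U x"
              using x by (auto simp: N_def)
            ultimately show ?thesis
              by blast
          qed
          moreover have "inj_on f u"
            using U(3)[OF x] u inj_on_subset by blast
          moreover have "openin (top_of_set N) (f ` W)" if W: "openin (top_of_set u) W" for W
          proof -
            have "openin (top_of_set S) (f ` W)"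
              using W Uv[OF x] u openin_trans opn by blast
            then show ?thesis
              by (rule openin_subset_trans)
                (use fu openin_imp_subset[OF W] openin_imp_subset[OF Nop] in auto)
          qed
          ultimately show ?thesis
            using homeomorphism_injective_open_map by blast
        qed
      qed
    qed
  qed
  moreover have "continuous_on (T - f -` B) f"
    using cont continuous_on_subset by blast
  moreover have "f ` (T - f -` B) = S - B"
    using surj by blast
  ultimately show ?thesis
    unfolding covering_space_def by blast
qed

section \<open>The sphere as an oriented surface\<close>

lemma punctured_sphere_homeomorphism:
  assumes "b \<in> two_sphere"
  obtains \<sigma> \<sigma>' where "homeomorphism (UNIV :: complex set) (two_sphere - {b}) \<sigma> \<sigma>'"
proof -
  let ?H = "{x :: real^3. axis 1 1 \<bullet> x = 0}"
  have ax: "(axis 1 1 :: real^3) \<noteq> 0"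
    by (simp add: axis_eq_0_iff)
  have "two_sphere - {b} homeomorphic ?H"
    using assms by (intro homeomorphic_punctured_sphere_hyperplane ax) auto
  moreover have "?H homeomorphic (UNIV :: complex set)"
  proof (rule homeomorphic_affine_sets)
    show "affine ?H" by (rule affine_hyperplane)
    show "aff_dim ?H = aff_dim (UNIV :: complex set)"
      using aff_dim_hyperplane[OF ax, of 0] by (simp add: aff_dim_UNIV)
  qed simp
  ultimately have "(UNIV :: complex set) homeomorphic (two_sphere - {b})"
    using homeomorphic_trans homeomorphic_sym by blast
  then show ?thesis
    using that homeomorphic_def by blast
qed

text \<open>Affine maps of the plane carry any two distinct points to any two others. This is what
  allows all three branching points to be prescribed.\<close>

lemma punctured_sphere_homeomorphism_through:
  assumes "b \<in> two_sphere" "p \<in> two_sphere" "q \<in> two_sphere" "b \<noteq> p" "b \<noteq> q" "p \<noteq> q" "u \<noteq> v"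
  obtains \<sigma> \<sigma>' where "homeomorphism (UNIV :: complex set) (two_sphere - {b}) \<sigma> \<sigma>'"
    "\<sigma> u = p" "\<sigma> v = q"
proof -
  obtain \<sigma> \<sigma>' where hom: "homeomorphism (UNIV :: complex set) (two_sphere - {b}) \<sigma> \<sigma>'"
    using punctured_sphere_homeomorphism[OF assms(1)] by blast
  define c where "c = (\<sigma>' q - \<sigma>' p) / (v - u)"
  have "\<sigma> (\<sigma>' p) = p" "\<sigma> (\<sigma>' q) = q"
    using hom assms by (auto simp: homeomorphism_def)
  then have "\<sigma>' p \<noteq> \<sigma>' q" using assms by metis
  then have c: "c \<noteq> 0" using assms by (simp add: c_def)
  define A where "A w = \<sigma>' p + c * (w - u)" for w
  have "homeomorphism UNIV UNIV A (\<lambda>w. u + (w - \<sigma>' p) / c)"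
    using c unfolding A_def by (intro homeomorphismI) (auto intro!: continuous_intros)
  then have "homeomorphism UNIV (two_sphere - {b}) (\<sigma> \<circ> A) ((\<lambda>w. u + (w - \<sigma>' p) / c) \<circ> \<sigma>')"
    using hom homeomorphism_compose by blast
  moreover have "(\<sigma> \<circ> A) u = p" "(\<sigma> \<circ> A) v = q"
    using \<open>\<sigma> (\<sigma>' p) = p\<close> \<open>\<sigma> (\<sigma>' q) = q\<close> assms(7) by (auto simp: A_def c_def)
  ultimately show ?thesis
    using that by blast
qed

context
  fixes b :: "real^3" and \<sigma> :: "complex \<Rightarrow> real^3" and \<sigma>' :: "real^3 \<Rightarrow> complex"
  assumes b: "b \<in> two_sphere" and hom: "homeomorphism UNIV (two_sphere - {b}) \<sigma> \<sigma>'"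
begin

lemma sigma_simps: "\<sigma>' (\<sigma> w) = w" "\<sigma> w \<in> two_sphere" "\<sigma> w \<noteq> b"
  "s \<in> two_sphere \<Longrightarrow> s \<noteq> b \<Longrightarrow> \<sigma> (\<sigma>' s) = s"
  using hom unfolding homeomorphism_def by blast+

lemma sigma_continuous: "continuous_on UNIV \<sigma>" "continuous_on (two_sphere - {b}) \<sigma>'"
  using hom unfolding homeomorphism_def by blast+

text \<open>Outside N the sphere is compact and avoids b, so \<sigma>' is bounded there.\<close>

lemma sigma_near_infinity:
  assumes "open N" "b \<in> N"
  obtains R where "R > 0" "\<And>w. norm w > R \<Longrightarrow> \<sigma> w \<in> N"
proof -
  have "compact (two_sphere - N)"
    using assms by (simp add: compact_diff)
  then have "compact (\<sigma>' ` (two_sphere - N))"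
    using assms by (intro compact_continuous_image continuous_on_subset[OF sigma_continuous(2)]) auto
  then have "bounded (\<sigma>' ` (two_sphere - N))"
    by (rule compact_imp_bounded)
  then obtain R where R: "R > 0" "\<And>x. x \<in> \<sigma>' ` (two_sphere - N) \<Longrightarrow> norm x \<le> R"
    unfolding bounded_pos by metis
  have "\<sigma> w \<in> N" if "norm w > R" for w
  proof (rule ccontr)
    assume "\<sigma> w \<notin> N"
    then have "\<sigma>' (\<sigma> w) \<in> \<sigma>' ` (two_sphere - N)"
      using sigma_simps by blast
    then show False using R(2) that sigma_simps(1) by force
  qed
  then show ?thesis using that R by blast
qed

text \<open>The coordinate 1/w at infinity of the Riemann sphere, with b as infinity.\<close>

definition chart_at_puncture :: "real^3 \<Rightarrow> complex" where
  "chart_at_puncture s = (if s = b then 0 else inverse (\<sigma>' s))"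

lemma surface_chart_finite: "surface_chart two_sphere (two_sphere - {b}) \<sigma>'"
  using homeomorphism_symD[OF hom] by (intro surface_chartI) (auto simp: openin_delete)

lemma surface_chart_at_puncture: "surface_chart two_sphere (two_sphere - {\<sigma> 0}) chart_at_puncture"
proof (rule surface_chartI)
  \<comment> \<open>The inverse chart. Its continuity at 0 is the behaviour of \<sigma> near
    infinity.\<close>
  define \<tau> where "\<tau> w = (if w = 0 then b else \<sigma> (inverse w))" for w
  have cont\<tau>: "continuous_on UNIV \<tau>"
    unfolding continuous_on_eq_continuous_within
  proof
    fix w :: complex
    show "isCont \<tau> w"
    proof (cases "w = 0")
      case False
      have "isCont (\<lambda>x. inverse x) w" using False by (intro continuous_intros) auto
      moreover have "isCont \<sigma> (inverse w)"
        using sigma_continuous(1) by (simp add: continuous_on_eq_continuous_at)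
      ultimately have "isCont (\<lambda>w. \<sigma> (inverse w)) w"
        by (rule isCont_o2)
      moreover have "\<forall>\<^sub>F x in nhds w. x \<in> - {0}"
        using False by (intro eventually_nhds_in_open) auto
      then have "\<forall>\<^sub>F x in nhds w. \<tau> x = \<sigma> (inverse x)"
        by eventually_elim (auto simp: \<tau>_def)
      ultimately show ?thesis
        using isCont_cong by force
    next
      case True
      have "(\<tau> \<longlongrightarrow> b) (at 0)"
      proof (rule topological_tendstoI)
        fix N assume "open N" "b \<in> N"
        then obtain R where R: "R > 0" "\<And>w. norm w > R \<Longrightarrow> \<sigma> w \<in> N"
          using sigma_near_infinity by blast
        have "\<tau> x \<in> N" if "x \<noteq> 0" "dist x 0 < inverse R" for x
        proof -
          have "norm (inverse x) > R"
            using that R(1) by (metis dist_0_norm dist_commute inverse_inverse_eq less_imp_inverse_less norm_inverse zero_less_norm_iff)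
          then show ?thesis using R that by (simp add: \<tau>_def)
        qed
        then show "\<forall>\<^sub>F x in at 0. \<tau> x \<in> N"
          unfolding eventually_at using R(1) by (intro exI[of _ "inverse R"]) auto
      qed
      then show ?thesis
        using True by (simp add: isCont_def \<tau>_def)
    qed
  qed
  have contc: "continuous_on (two_sphere - {\<sigma> 0}) chart_at_puncture"
    unfolding continuous_on_eq_continuous_within
  proof
    fix s assume s: "s \<in> two_sphere - {\<sigma> 0}"
    show "continuous (at s within two_sphere - {\<sigma> 0}) chart_at_puncture"
    proof (cases "s = b")
      case False
      have nz: "\<sigma>' s \<noteq> 0" if "s \<in> two_sphere - {\<sigma> 0} - {b}" for s
        using that sigma_simps(4)[of s] by auto
      have "continuous_on (two_sphere - {\<sigma> 0} - {b}) (\<lambda>s. inverse (\<sigma>' s))"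
        using nz by (intro continuous_intros continuous_on_subset[OF sigma_continuous(2)]) auto
      then have "continuous_on (two_sphere - {\<sigma> 0} - {b}) chart_at_puncture"
        by (rule continuous_on_eq) (auto simp: chart_at_puncture_def)
      then have "continuous (at s within two_sphere - {\<sigma> 0} - {b}) chart_at_puncture"
        using s False by (simp add: continuous_on_eq_continuous_within)
      moreover have "at s within two_sphere - {\<sigma> 0} - {b} = at s within two_sphere - {\<sigma> 0}"
        by (rule at_within_nhd[of _ "- {b}"]) (use False in auto)
      ultimately show ?thesis by simp
    next
      case True
      have "(chart_at_puncture \<longlongrightarrow> 0) (at b within two_sphere - {\<sigma> 0})"
      proof (rule tendstoI)
        fix e :: real assume e: "e > 0"
        have cpt: "compact (\<sigma> ` cball 0 (inverse e))"
          by (intro compact_continuous_image continuous_on_subset[OF sigma_continuous(1)]) auto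
        then have "open (- \<sigma> ` cball 0 (inverse e))"
          using compact_imp_closed by blast
        moreover have "b \<in> - \<sigma> ` cball 0 (inverse e)"
          using sigma_simps(3) by force
        ultimately have "\<forall>\<^sub>F s in at b within two_sphere - {\<sigma> 0}. s \<in> - \<sigma> ` cball 0 (inverse e)"
          using eventually_at_topological by blast
        moreover have "\<forall>\<^sub>F s in at b within two_sphere - {\<sigma> 0}. s \<in> two_sphere - {\<sigma> 0} \<and> s \<noteq> b"
          by (simp add: eventually_at_filter)
        ultimately show "\<forall>\<^sub>F s in at b within two_sphere - {\<sigma> 0}. dist (chart_at_puncture s) 0 < e"
        proof eventually_elim
          case (elim s)
          then have "\<sigma> (\<sigma>' s) = s" using sigma_simps(4) by blast
          then have "\<sigma>' s \<notin> cball 0 (inverse e)" using elim by (metis ComplD imageI)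
          then have "inverse e < norm (\<sigma>' s)" by simp
          then have "norm (inverse (\<sigma>' s)) < e"
            using e by (metis inverse_inverse_eq less_imp_inverse_less norm_inverse positive_imp_inverse_positive)
          then show ?case using elim by (simp add: chart_at_puncture_def)
        qed
      qed
      then show ?thesis
        using True by (simp add: continuous_within chart_at_puncture_def)
    qed
  qed
  show "homeomorphism (two_sphere - {\<sigma> 0}) UNIV chart_at_puncture \<tau>"
  proof (rule homeomorphismI)
    show "\<tau> ` UNIV \<subseteq> two_sphere - {\<sigma> 0}"
      using sigma_simps b by (auto simp: \<tau>_def) (metis inverse_zero_imp_zero sigma_simps(1))
    show "\<tau> (chart_at_puncture s) = s" if "s \<in> two_sphere - {\<sigma> 0}" for s
      using that sigma_simps(4)[of s] by (auto simp: \<tau>_def chart_at_puncture_def)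
    show "chart_at_puncture (\<tau> w) = w" for w
      using sigma_simps by (auto simp: \<tau>_def chart_at_puncture_def)
  qed (use contc cont\<tau> in auto)
  show "openin (top_of_set two_sphere) (two_sphere - {\<sigma> 0})"
    by (simp add: openin_delete)
qed simp

end

lemma orientation_preserving_on_id:
  assumes "\<And>z. z \<in> A \<Longrightarrow> g z = z"
  shows "orientation_preserving_on A g"
  unfolding orientation_preserving_on_def
proof (intro allI impI)
  fix z :: complex and r :: real assume *: "0 < r \<and> cball z r \<subseteq> A"
  have "circlepath z r x \<in> cball z r" for x
    using * by (simp add: circlepath dist_norm norm_mult)
  then have "g \<circ> circlepath z r = circlepath z r"
    using * assms by (metis comp_apply ext subsetD)
  moreover have "g z = z"
    using * assms by (simp add: subset_eq)
  ultimately show "winding_number (g \<circ> circlepath z r) (g z) = 1"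
    using * by (simp add: winding_number_circlepath_centre)
qed

text \<open>To first order the image circle is 1/z - r e / z ^ 2, the loop \<open>q\<close>. The
  error is the displacement from 1/z times r e / z, hence smaller than the displacement because r <
  |z|, and both loops wind equally often around 1/z.\<close>

lemma orientation_preserving_on_inverse:
  assumes "0 \<notin> A" "\<And>z. z \<in> A \<Longrightarrow> g z = inverse z"
  shows "orientation_preserving_on A g"
  unfolding orientation_preserving_on_def
proof (intro allI impI)
  fix z :: complex and r :: real assume *: "0 < r \<and> cball z r \<subseteq> A"
  define e where "e x = exp (2 * of_real pi * \<i> * of_real x)" for x
  have ne: "norm (e x) = 1" for x by (simp add: e_def)
  have circ: "circlepath z r x = z + r * e x" for x by (simp add: circlepath e_def)
  have inA: "circlepath z r x \<in> A" for x
    using * ne by (intro subsetD[OF conjunct2[OF *]]) (simp add: circ dist_norm norm_mult)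
  have zA: "z \<in> A" using * by (simp add: subset_eq)
  have rz: "r < norm z"
  proof (rule ccontr)
    assume "\<not> r < norm z"
    then have "0 \<in> cball z r" by (simp add: dist_norm)
    then show False using * assms(1) by blast
  qed
  have z0: "z \<noteq> 0" and nz: "z + r * e x \<noteq> 0" for x
    using zA inA[of x] assms(1) circ by auto
  define k where "k = - of_real r / z ^ 2"
  have k0: "k \<noteq> 0" using * z0 by (simp add: k_def)
  define q where "q x = inverse z + k * e x" for x :: real
  have gz: "g z = inverse z" and gc: "(g \<circ> circlepath z r) x = inverse (z + r * e x)" for x
    using assms(2) zA inA circ by auto
  have diff: "q x - inverse z = (inverse (z + r * e x) - inverse z) * ((z + r * e x) / z)" for x
  proof -
    have "(inverse (z + r * e x) - inverse z) * ((z + r * e x) / z) = 1 / z - (z + r * e x) / z\<^sup>2"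
      using nz[of x] by (simp add: left_diff_distrib power2_eq_square divide_simps)
    also have "\<dots> = k * e x"
      using z0 by (simp add: k_def field_simps power2_eq_square)
    finally show ?thesis by (simp add: q_def)
  qed
  have conte: "continuous_on UNIV e"
    unfolding e_def by (intro continuous_intros)
  have pathg: "path (g \<circ> circlepath z r)"
    unfolding path_def using nz continuous_on_subset[OF conte]
    by (subst continuous_on_cong[OF refl gc]) (auto intro!: continuous_intros)
  have pathq: "path q"
    unfolding path_def q_def by (intro continuous_intros continuous_on_subset[OF conte]) auto
  have e01: "e 0 = 1" "e 1 = 1" by (auto simp: e_def)
  have "winding_number q (inverse z) = winding_number (g \<circ> circlepath z r) (inverse z)"
  proof (rule winding_number_nearby_loops_eq[OF pathg pathq])
    show "pathfinish (g \<circ> circlepath z r) = pathstart (g \<circ> circlepath z r)"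
      unfolding pathfinish_def pathstart_def gc e01 ..
    show "pathfinish q = pathstart q"
      by (simp add: pathfinish_def pathstart_def q_def e01)
    fix t :: real
    let ?d = "inverse (z + r * e t) - inverse z"
    have "?d \<noteq> 0"
    proof
      assume "?d = 0"
      then have "of_real r * e t = 0" by simp
      then have "norm (of_real r * e t) = 0" by simp
      then show False using * ne[of t] by (simp add: norm_mult)
    qed
    have "q t - inverse (z + r * e t) = ?d * (r * e t / z)"
    proof -
      have "q t - inverse (z + r * e t) = ?d * ((z + r * e t) / z) - ?d"
        using diff[of t] by (simp add: algebra_simps)
      also have "\<dots> = ?d * ((z + r * e t) / z - 1)"
        by (simp add: right_diff_distrib)
      also have "(z + r * e t) / z - 1 = r * e t / z"
        using z0 by (simp add: field_simps)
      finally show ?thesis .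
    qed
    then have "norm (q t - inverse (z + r * e t)) = norm ?d * (r / norm z)"
      using * ne by (simp add: norm_mult norm_divide)
    also have "\<dots> < norm ?d * 1"
      using rz \<open>?d \<noteq> 0\<close> z0 by (intro mult_strict_left_mono) (simp_all add: divide_less_eq)
    finally show "norm (q t - (g \<circ> circlepath z r) t) < norm ((g \<circ> circlepath z r) t - inverse z)"
      using gc by simp
  qed
  moreover have "winding_number q (inverse z) = 1"
  proof -
    \<comment> \<open>A logarithm of q - 1/z that increases linearly by 2 pi \<i>, so the winding
      number is 1.\<close>
    let ?p = "\<lambda>x. Ln k + 2 * of_real pi * \<i> * of_real x"
    have "(\<lambda>w. q w - inverse z) = exp \<circ> ?p"
      using k0 by (auto simp: q_def e_def exp_add fun_eq_iff)
    moreover have "path ?p" unfolding path_def by (intro continuous_intros)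
    ultimately show ?thesis
      using winding_number_compose_exp[of ?p] by (simp add: winding_number_offset[of q] pathfinish_def pathstart_def)
  qed
  ultimately show "winding_number (g \<circ> circlepath z r) (g z) = 1"
    using gz by simp
qed

text \<open>The atlas of the Riemann sphere is used: two charts, w and 1/w, whose transition maps
  are inversions away from 0.\<close>

lemma closed_connected_orientable_surface_two_sphere:
  "closed_connected_orientable_surface two_sphere"
proof -
  have b: "axis 1 1 \<in> two_sphere"
    by simp
  define b :: "real^3" where "b = axis 1 1"
  have b: "b \<in> two_sphere"
    using b by (simp add: b_def)
  obtain \<sigma> \<sigma>' where hom: "homeomorphism (UNIV :: complex set) (two_sphere - {b}) \<sigma> \<sigma>'"
    using punctured_sphere_homeomorphism[OF b] by blast
  note sig = sigma_simps[OF b hom]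
  let ?\<chi> = "chart_at_puncture b \<sigma>'"
  let ?U = "two_sphere - {b}" and ?V = "two_sphere - {\<sigma> 0}"
  have id: "orientation_preserving_on (\<phi> ` (U \<inter> U)) (\<phi> \<circ> inv_into U \<phi>)" for U and \<phi> :: "real^3 \<Rightarrow> complex"
    by (rule orientation_preserving_on_id) (auto simp: f_inv_into_f)
  have nz: "\<sigma>' s \<noteq> 0" if "s \<in> ?U \<inter> ?V" for s
    using that sig(4)[of s] by auto
  have 1: "orientation_preserving_on (\<sigma>' ` (?U \<inter> ?V)) (?\<chi> \<circ> inv_into ?U \<sigma>')"
  proof (rule orientation_preserving_on_inverse)
    show "0 \<notin> \<sigma>' ` (?U \<inter> ?V)" using nz by (metis imageE)
    fix z assume "z \<in> \<sigma>' ` (?U \<inter> ?V)"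
    then have "z \<in> \<sigma>' ` ?U" by blast
    then have "inv_into ?U \<sigma>' z \<in> ?U" "\<sigma>' (inv_into ?U \<sigma>' z) = z"
      by (rule inv_into_into, rule f_inv_into_f)
    then show "(?\<chi> \<circ> inv_into ?U \<sigma>') z = inverse z"
      by (simp add: chart_at_puncture_def[OF b hom])
  qed
  have 2: "orientation_preserving_on (?\<chi> ` (?V \<inter> ?U)) (\<sigma>' \<circ> inv_into ?V ?\<chi>)"
  proof (rule orientation_preserving_on_inverse)
    show nz': "0 \<notin> ?\<chi> ` (?V \<inter> ?U)"
    proof
      assume "0 \<in> ?\<chi> ` (?V \<inter> ?U)"
      then obtain s where s: "0 = ?\<chi> s" "s \<in> ?V \<inter> ?U" by (rule imageE)
      then have "s \<in> ?U \<inter> ?V" by blast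
      from nz[OF this] s show False by (auto simp: chart_at_puncture_def[OF b hom])
    qed
    fix z assume z: "z \<in> ?\<chi> ` (?V \<inter> ?U)"
    then have "z \<in> ?\<chi> ` ?V" by blast
    then have i: "?\<chi> (inv_into ?V ?\<chi> z) = z"
      by (rule f_inv_into_f)
    then have "inv_into ?V ?\<chi> z \<noteq> b"
      using z nz' by (auto simp: chart_at_puncture_def[OF b hom])
    then have "inverse (\<sigma>' (inv_into ?V ?\<chi> z)) = z"
      using i by (simp add: chart_at_puncture_def[OF b hom])
    then show "(\<sigma>' \<circ> inv_into ?V ?\<chi>) z = inverse z"
      by (metis inverse_inverse_eq comp_apply)
  qed
  define \<A> where "\<A> = {(?U, \<sigma>'), (?V, ?\<chi>)}"
  have charts: "surface_chart two_sphere U \<phi>" if "(U, \<phi>) \<in> \<A>" for U \<phi>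
  proof -
    have "U = ?U \<and> \<phi> = \<sigma>' \<or> U = ?V \<and> \<phi> = ?\<chi>"
      using that unfolding \<A>_def by blast
    then show ?thesis
      using surface_chart_finite[OF b hom] surface_chart_at_puncture[OF b hom] by metis
  qed
  have transitions: "orientation_preserving_on (\<phi> ` (U \<inter> V)) (\<psi> \<circ> inv_into U \<phi>)"
    if "(U, \<phi>) \<in> \<A>" "(V, \<psi>) \<in> \<A>" for U \<phi> V \<psi>
  proof -
    have "U = ?U \<and> \<phi> = \<sigma>' \<or> U = ?V \<and> \<phi> = ?\<chi>" "V = ?U \<and> \<psi> = \<sigma>' \<or> V = ?V \<and> \<psi> = ?\<chi>"
      using that unfolding \<A>_def by blast+
    then show ?thesis
      using id 1 2 by metis
  qed
  have "oriented_atlas two_sphere \<A>"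
    unfolding oriented_atlas_def case_prod_beta
  proof (intro conjI ballI)
    have "?U \<union> ?V = two_sphere" using sig(3)[of 0] by blast
    then show "(\<Union>p\<in>\<A>. fst p) = two_sphere"
      unfolding \<A>_def by (simp only: UN_insert UN_empty fst_conv Un_empty_right)
  qed (auto intro: charts transitions simp: prod.collapse)
  moreover have "connected two_sphere"
    by (rule connected_sphere) simp
  ultimately show ?thesis
    unfolding closed_connected_orientable_surface_def
    using b by (auto simp: Hausdorff_space_subtopology)
qed

section \<open>Eisenstein integers\<close>

definition \<zeta> :: complex where "\<zeta> = Complex (1/2) (sqrt 3 / 2)"

definition eisenstein :: "complex set" where
  "eisenstein = {of_int m + of_int n * \<zeta> | m n. True}"

lemma zeta_sq: "\<zeta> ^ 2 = \<zeta> - 1"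
  by (simp add: \<zeta>_def complex_eq_iff power2_eq_square)

lemma zeta_pow3: "\<zeta> ^ 3 = -1"
proof -
  have "\<zeta> ^ 3 = \<zeta> * \<zeta>^2" by (simp add: power3_eq_cube power2_eq_square)
  also have "\<dots> = \<zeta>^2 - \<zeta>" by (simp add: zeta_sq power2_eq_square[symmetric] right_diff_distrib)
  finally show ?thesis by (simp add: zeta_sq)
qed

lemma zeta_pow6: "\<zeta> ^ 6 = 1"
proof -
  have "\<zeta> ^ 6 = (\<zeta> ^ 3) ^ 2" by (simp add: power_mult[symmetric])
  then show ?thesis by (simp add: zeta_pow3)
qed

lemma zeta_nz [simp]: "\<zeta> \<noteq> 0"
  by (simp add: \<zeta>_def complex_eq_iff)

lemma norm_zeta [simp]: "norm \<zeta> = 1"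
  by (simp add: \<zeta>_def cmod_def power2_eq_square)

lemma cnj_zeta: "cnj \<zeta> = 1 - \<zeta>"
  by (simp add: \<zeta>_def complex_eq_iff)

lemma eisenstein_of_int [simp]: "of_int m \<in> eisenstein"
  unfolding eisenstein_def by (rule CollectI, rule exI[of _ m], rule exI[of _ 0]) simp

lemma eisenstein_0 [simp]: "0 \<in> eisenstein" and eisenstein_1 [simp]: "1 \<in> eisenstein"
  using eisenstein_of_int[of 0] eisenstein_of_int[of 1] by auto

lemma eisenstein_of_nat [simp]: "of_nat m \<in> eisenstein"
  using eisenstein_of_int[of "int m"] by simp

lemma eisenstein_zeta [simp]: "\<zeta> \<in> eisenstein"
  unfolding eisenstein_def by (rule CollectI, rule exI[of _ 0], rule exI[of _ 1]) simp

lemma eisenstein_add [simp]: "a \<in> eisenstein \<Longrightarrow> b \<in> eisenstein \<Longrightarrow> a + b \<in> eisenstein"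
proof -
  assume "a \<in> eisenstein" "b \<in> eisenstein"
  then obtain m n m' n' where "a = of_int m + of_int n * \<zeta>" "b = of_int m' + of_int n' * \<zeta>"
    unfolding eisenstein_def by blast
  then have "a + b = of_int (m + m') + of_int (n + n') * \<zeta>" by (simp add: algebra_simps)
  then show ?thesis unfolding eisenstein_def by blast
qed

lemma eisenstein_minus [simp]: "a \<in> eisenstein \<Longrightarrow> - a \<in> eisenstein"
proof -
  assume "a \<in> eisenstein"
  then obtain m n where "a = of_int m + of_int n * \<zeta>"
    unfolding eisenstein_def by blast
  then have "- a = of_int (- m) + of_int (- n) * \<zeta>" by (simp add: algebra_simps)
  then show ?thesis unfolding eisenstein_def by blast
qed

lemma eisenstein_diff [simp]: "a \<in> eisenstein \<Longrightarrow> b \<in> eisenstein \<Longrightarrow> a - b \<in> eisenstein"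
  using eisenstein_add[of a "- b"] by simp

lemma eisenstein_mult [simp]: "a \<in> eisenstein \<Longrightarrow> b \<in> eisenstein \<Longrightarrow> a * b \<in> eisenstein"
proof -
  assume "a \<in> eisenstein" "b \<in> eisenstein"
  then obtain m n m' n' where ab: "a = of_int m + of_int n * \<zeta>" "b = of_int m' + of_int n' * \<zeta>"
    unfolding eisenstein_def by blast
  have "a * b = of_int m * of_int m' + (of_int m * of_int n' + of_int n * of_int m') * \<zeta>
       + of_int n * of_int n' * \<zeta>^2"
    unfolding ab by (simp add: algebra_simps power2_eq_square)
  also have "\<dots> = of_int (m * m' - n * n') + of_int (m * n' + n * m' + n * n') * \<zeta>"
    unfolding zeta_sq by (simp add: algebra_simps)
  finally show ?thesis unfolding eisenstein_def by blast
qed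

lemma eisenstein_power [simp]: "a \<in> eisenstein \<Longrightarrow> a ^ k \<in> eisenstein"
  by (induction k) auto

lemma eisenstein_cnj [simp]: "a \<in> eisenstein \<Longrightarrow> cnj a \<in> eisenstein"
proof -
  assume "a \<in> eisenstein"
  then obtain m n where "a = of_int m + of_int n * \<zeta>"
    unfolding eisenstein_def by blast
  then have "cnj a = of_int m + of_int n * (1 - \<zeta>)" by (simp add: cnj_zeta)
  then show ?thesis by simp
qed

lemma norm_sq_eisenstein:
  "(norm (of_int m + of_int n * \<zeta>))\<^sup>2 = of_int (m\<^sup>2 + m * n + n\<^sup>2)"
proof -
  have "Re (of_int m + of_int n * \<zeta>) = m + n / 2" "Im (of_int m + of_int n * \<zeta>) = n * sqrt 3 / 2"
    by (simp_all add: \<zeta>_def)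
  then have "(norm (of_int m + of_int n * \<zeta>))\<^sup>2 = (m + n / 2)\<^sup>2 + n\<^sup>2 * 3 / 4"
    by (simp only: cmod_power2 power_mult_distrib power_divide) simp
  then show ?thesis
    by (simp add: power2_eq_square field_simps)
qed

text \<open>The squared norm is a positive integer.\<close>

lemma eisenstein_norm_ge_1:
  assumes "a \<in> eisenstein" "a \<noteq> 0"
  shows "norm a \<ge> 1"
proof -
  obtain m n where a: "a = of_int m + of_int n * \<zeta>"
    using assms unfolding eisenstein_def by blast
  have "(norm a)\<^sup>2 > 0" using assms by simp
  then have "m\<^sup>2 + m * n + n\<^sup>2 > 0"
    unfolding a norm_sq_eisenstein by (simp only: of_int_0_less_iff)
  then have "(norm a)\<^sup>2 \<ge> of_int 1"
    unfolding a norm_sq_eisenstein by (subst of_int_le_iff) linarith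
  then show ?thesis
    by (simp add: power2_nonneg_ge_1_iff)
qed

lemma eisenstein_inter_unit_interval: "a \<in> eisenstein \<Longrightarrow> norm a < 1 \<Longrightarrow> a = 0"
  using eisenstein_norm_ge_1 by force

text \<open>Rounding leaves errors u and v of at most 1/2, so the squared distance is at most 1/4 +
  3/16. A bound below 1 is what division with remainder requires.\<close>

lemma nearest_eisenstein: obtains l where "l \<in> eisenstein" "norm (z - l) < 1"
proof -
  define n where "n = round (2 * Im z / sqrt 3)"
  define m where "m = round (Re z - of_int n / 2)"
  define l where "l = of_int m + of_int n * \<zeta>"
  have "l \<in> eisenstein" unfolding l_def eisenstein_def by blast
  define u where "u = Re z - of_int n / 2 - of_int m"
  define v where "v = 2 * Im z / sqrt 3 - of_int n"
  have u: "\<bar>u\<bar> \<le> 1/2" and v: "\<bar>v\<bar> \<le> 1/2"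
    using of_int_round_abs_le[of "Re z - of_int n / 2"] of_int_round_abs_le[of "2 * Im z / sqrt 3"]
    by (auto simp: u_def v_def m_def[symmetric] n_def[symmetric] abs_minus_commute)
  have "Re (z - l) = u" by (simp add: l_def u_def \<zeta>_def)
  moreover have "Im (z - l) = v * sqrt 3 / 2"
    by (simp add: l_def v_def \<zeta>_def field_simps)
  ultimately have "(norm (z - l))\<^sup>2 = u\<^sup>2 + v\<^sup>2 * 3 / 4"
    by (simp only: cmod_power2 power_mult_distrib power_divide) simp
  moreover have "u\<^sup>2 \<le> (1/2)\<^sup>2" "v\<^sup>2 \<le> (1/2)\<^sup>2"
    using u v by (auto intro: abs_le_square_iff[THEN iffD1])
  ultimately have "(norm (z - l))\<^sup>2 < 1\<^sup>2"
    by (simp add: power2_eq_square)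
  then have "norm (z - l) < 1"
    by (rule power2_less_imp_less) simp
  then show ?thesis using that \<open>l \<in> eisenstein\<close> by blast
qed

text \<open>Division with remainder: the remainder on division by a nonzero element of least norm is
  again in I and has smaller norm, so it is 0.\<close>

lemma eisenstein_ideal_principal:
  assumes sub: "I \<subseteq> eisenstein" and "0 \<in> I"
    and add: "\<And>a b. a \<in> I \<Longrightarrow> b \<in> I \<Longrightarrow> a - b \<in> I"
    and zeta: "\<And>a. a \<in> I \<Longrightarrow> \<zeta> * a \<in> I"
  obtains \<alpha> where "\<alpha> \<in> eisenstein" "I = (*) \<alpha> ` eisenstein"
proof -
  have neg: "- a \<in> I" if "a \<in> I" for a
    using add[OF \<open>0 \<in> I\<close> that] by simp
  have plus: "a + b \<in> I" if "a \<in> I" "b \<in> I" for a b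
    using add[OF that(1) neg[OF that(2)]] by simp
  have nat: "of_nat n * a \<in> I" if "a \<in> I" for n a
    using that \<open>0 \<in> I\<close> by (induction n) (auto simp: ring_distribs intro: plus)
  have int: "of_int n * a \<in> I" if "a \<in> I" for n a
    using nat[OF that, of "nat n"] neg[OF nat[OF that, of "nat (- n)"]]
    by (cases "n \<ge> 0") auto
  have mult: "l * a \<in> I" if l': "l \<in> eisenstein" and a: "a \<in> I" for l a
  proof -
    obtain m n where l: "l = of_int m + of_int n * \<zeta>"
      using l' unfolding eisenstein_def by blast
    have "l * a = of_int m * a + of_int n * (\<zeta> * a)" by (simp add: l algebra_simps)
    then show ?thesis using a plus int zeta by simp
  qed
  show ?thesis
  proof (cases "I = {0}")
    case True
    moreover have "eisenstein \<noteq> {}" using eisenstein_0 by blast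
    ultimately have "I = (*) 0 ` eisenstein" by (simp add: image_constant_conv)
    then show ?thesis using that eisenstein_0 by blast
  next
    case False
    \<comment> \<open>The squared norm as a natural number, so that a least element exists.\<close>
    define nn where "nn a = nat \<lfloor>(norm (a::complex))\<^sup>2\<rfloor>" for a
    have nn: "of_nat (nn a) = (norm a)\<^sup>2" if a: "a \<in> eisenstein" for a
    proof -
      obtain m n where "a = of_int m + of_int n * \<zeta>"
        using a unfolding eisenstein_def by blast
      then have "(norm a)\<^sup>2 = of_int (m\<^sup>2 + m * n + n\<^sup>2)" using norm_sq_eisenstein by simp
      then have "(norm a)\<^sup>2 = of_int \<lfloor>(norm a)\<^sup>2\<rfloor>" by (metis floor_of_int)
      then show ?thesis unfolding nn_def by (metis of_nat_nat zero_le_floor zero_le_power2 of_int_of_nat_eq)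
    qed
    obtain \<beta> where "\<beta> \<in> I" "\<beta> \<noteq> 0" using False \<open>0 \<in> I\<close> by blast
    then obtain \<alpha> where \<alpha>: "\<alpha> \<in> I" "\<alpha> \<noteq> 0" and min: "\<And>a. a \<in> I \<Longrightarrow> a \<noteq> 0 \<Longrightarrow> nn \<alpha> \<le> nn a"
      using ex_has_least_nat[of "\<lambda>a. a \<in> I \<and> a \<noteq> 0" \<beta> nn] by auto
    have "a \<in> (*) \<alpha> ` eisenstein" if a: "a \<in> I" for a
    proof -
      obtain l where l: "l \<in> eisenstein" "norm (a / \<alpha> - l) < 1" by (rule nearest_eisenstein)
      define r where "r = a - l * \<alpha>"
      have rI: "r \<in> I" unfolding r_def using a \<alpha> l by (intro add mult)
      have "r = (a / \<alpha> - l) * \<alpha>"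
        using \<alpha> by (simp add: r_def left_diff_distrib)
      then have "norm r = norm (a / \<alpha> - l) * norm \<alpha>"
        by (simp add: norm_mult)
      also have "\<dots> < norm \<alpha>" using l \<alpha> by simp
      finally have "(norm r)\<^sup>2 < (norm \<alpha>)\<^sup>2" by (simp add: power_strict_mono)
      then have "nn r < nn \<alpha>"
        using nn[of r] nn[of \<alpha>] rI \<alpha> sub by (metis of_nat_less_iff subsetD)
      then have "r = 0" using min rI by force
      then show ?thesis using l by (auto simp: r_def mult.commute)
    qed
    moreover have "(*) \<alpha> ` eisenstein \<subseteq> I"
      using mult \<alpha> by (auto simp: mult.commute)
    ultimately show ?thesis using that[of \<alpha>] \<alpha> sub by blast
  qed
qed

text \<open>The form is the squared norm of m + n * \<zeta>. Negation makes m nonnegative;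
  conjugation, possibly followed by a unit, then makes both coordinates nonnegative.\<close>

lemma norm_form_nat:
  fixes m n :: int
  obtains x y :: nat where "m\<^sup>2 + m * n + n\<^sup>2 = int (x\<^sup>2 + x * y + y\<^sup>2)"
proof -
  have *: "\<exists>x y::nat. m\<^sup>2 + m * n + n\<^sup>2 = int (x\<^sup>2 + x * y + y\<^sup>2)" if "m \<ge> 0" for m n :: int
  proof -
    obtain a b where ab: "a \<ge> 0" "b \<ge> 0" "m\<^sup>2 + m * n + n\<^sup>2 = a\<^sup>2 + a * b + b\<^sup>2"
    proof -
      consider "n \<ge> 0" | "n < 0" "m + n \<ge> 0" | "m + n < 0" by linarith
      then show ?thesis
      proof cases
        case 1
        then show ?thesis using that[of m n] \<open>m \<ge> 0\<close> by simp
      next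
        case 2
        then show ?thesis by (intro that[of "m + n" "- n"]) (auto simp: power2_eq_square algebra_simps)
      next
        case 3
        then show ?thesis using \<open>m \<ge> 0\<close>
          by (intro that[of m "- m - n"]) (auto simp: power2_eq_square algebra_simps)
      qed
    qed
    obtain x y :: nat where "a = int x" "b = int y"
      using ab by (metis zero_le_imp_eq_int)
    then show ?thesis using ab by (intro exI[of _ x] exI[of _ y]) simp
  qed
  show ?thesis
    using *[of m n] *[of "- m" "- n"] that by (cases "m \<ge> 0") auto
qed

lemma eisenstein_rep_unique:
  assumes "of_int m + of_int n * \<zeta> = of_int m' + of_int n' * \<zeta>"
  shows "m = m'" "n = n'"
proof -
  have "Im (of_int m + of_int n * \<zeta>) = Im (of_int m' + of_int n' * \<zeta>)"
    "Re (of_int m + of_int n * \<zeta>) = Re (of_int m' + of_int n' * \<zeta>)"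
    using assms by simp_all
  then show "m = m'" "n = n'" by (auto simp: \<zeta>_def)
qed

section \<open>Residues modulo an Eisenstein integer and the index of its ideal\<close>

definition residue_system :: "complex \<Rightarrow> complex set \<Rightarrow> bool" where
  "residue_system \<alpha> R \<longleftrightarrow> R \<subseteq> eisenstein \<and> finite R \<and>
     (\<forall>l\<in>eisenstein. \<exists>!r. r \<in> R \<and> l - r \<in> (*) \<alpha> ` eisenstein)"

lemma residue_systemD:
  assumes "residue_system \<alpha> R"
  shows "R \<subseteq> eisenstein" "finite R"
    "l \<in> eisenstein \<Longrightarrow> \<exists>!r. r \<in> R \<and> l - r \<in> (*) \<alpha> ` eisenstein"
  using assms unfolding residue_system_def by blast+

lemma eisenstein_multiples_diff:
  assumes "a \<in> (*) \<alpha> ` eisenstein" "b \<in> (*) \<alpha> ` eisenstein"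
  shows "a - b \<in> (*) \<alpha> ` eisenstein"
proof -
  obtain x y where "x \<in> eisenstein" "y \<in> eisenstein" "a = \<alpha> * x" "b = \<alpha> * y"
    using assms by blast
  then show ?thesis by (intro image_eqI[of _ _ "x - y"]) (auto simp: right_diff_distrib)
qed

lemma eisenstein_multiples_cong:
  assumes "a - b \<in> (*) \<alpha> ` eisenstein" "b - c \<in> (*) \<alpha> ` eisenstein"
  shows "a - c \<in> (*) \<alpha> ` eisenstein"
proof -
  obtain x y where "x \<in> eisenstein" "y \<in> eisenstein" "a - b = \<alpha> * x" "b - c = \<alpha> * y"
    using assms by blast
  then show ?thesis by (intro image_eqI[of _ _ "x + y"]) (auto simp: algebra_simps)
qed

lemma eisenstein_multiples_sym:
  assumes "a - b \<in> (*) \<alpha> ` eisenstein"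
  shows "b - a \<in> (*) \<alpha> ` eisenstein"
proof -
  obtain x where "x \<in> eisenstein" "a - b = \<alpha> * x"
    using assms by blast
  then show ?thesis by (intro image_eqI[of _ _ "- x"]) (auto simp: algebra_simps)
qed

lemma residue_system_of_nat:
  assumes "n > 0"
  obtains R where "residue_system (of_nat n) R" "card R = n ^ 2"
proof -
  define h where "h p = of_int (fst p) + of_int (snd p) * \<zeta>" for p :: "int \<times> int"
  define Q where "Q = {0..<int n} \<times> {0..<int n}"
  have inj: "inj h"
    by (rule injI) (auto simp: h_def dest: eisenstein_rep_unique intro: prod_eqI)
  have hE: "h p \<in> eisenstein" for p
    unfolding h_def eisenstein_def by blast
  have cong: "h p - h q \<in> (*) (of_nat n) ` eisenstein \<longleftrightarrow>
      int n dvd fst p - fst q \<and> int n dvd snd p - snd q" for p q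
  proof
    assume "h p - h q \<in> (*) (of_nat n) ` eisenstein"
    then obtain a b where "h p - h q = of_nat n * (of_int a + of_int b * \<zeta>)"
      unfolding eisenstein_def by blast
    then have "of_int (fst p - fst q) + of_int (snd p - snd q) * \<zeta>
        = of_int (int n * a) + of_int (int n * b) * \<zeta>"
      by (simp add: h_def algebra_simps)
    then show "int n dvd fst p - fst q \<and> int n dvd snd p - snd q"
      using eisenstein_rep_unique by (metis dvd_triv_left)
  next
    assume "int n dvd fst p - fst q \<and> int n dvd snd p - snd q"
    then obtain a b where ab: "fst p - fst q = int n * a" "snd p - snd q = int n * b"
      by (auto elim!: dvdE)
    have "h p - h q = of_int (fst p - fst q) + of_int (snd p - snd q) * \<zeta>"
      by (simp add: h_def algebra_simps)
    also have "\<dots> = of_nat n * h (a, b)"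
      unfolding ab by (simp add: h_def algebra_simps)
    finally show "h p - h q \<in> (*) (of_nat n) ` eisenstein" using hE by blast
  qed
  have "\<exists>!r. r \<in> h ` Q \<and> l - r \<in> (*) (of_nat n) ` eisenstein" if l: "l \<in> eisenstein" for l
  proof -
    obtain a b where "l = h (a, b)"
      using l unfolding eisenstein_def h_def by auto
    show ?thesis
    proof (rule ex1I[of _ "h (a mod int n, b mod int n)"])
      show "h (a mod int n, b mod int n) \<in> h ` Q \<and> l - h (a mod int n, b mod int n) \<in> (*) (of_nat n) ` eisenstein"
        using assms unfolding \<open>l = h (a, b)\<close> cong by (auto simp: Q_def)
      fix r assume r: "r \<in> h ` Q \<and> l - r \<in> (*) (of_nat n) ` eisenstein"
      then obtain q where q: "q \<in> Q" "r = h q" by blast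
      then have "h (a, b) - h q \<in> (*) (of_nat n) ` eisenstein"
        using r \<open>l = h (a, b)\<close> by simp
      then have "int n dvd a - fst q" "int n dvd b - snd q"
        unfolding cong by simp_all
      then have "a mod int n = fst q mod int n" "b mod int n = snd q mod int n"
        by (auto simp: mod_eq_dvd_iff)
      then have "q = (a mod int n, b mod int n)"
        using q by (auto simp: Q_def intro: prod_eqI)
      then show "r = h (a mod int n, b mod int n)" using q by simp
    qed
  qed
  then have "residue_system (of_nat n) (h ` Q)"
    unfolding residue_system_def using hE by (auto simp: Q_def)
  moreover have "card (h ` Q) = n ^ 2"
    using inj by (simp add: card_image inj_on_subset[OF inj] Q_def power2_eq_square)
  ultimately show ?thesis using that by blast
qed

text \<open>The index of an ideal generated by \<open>\<alpha>\<close> is multiplicative in \<open>\<alpha>\<close> and invariant under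
  conjugation; as \<open>\<alpha> * cnj \<alpha>\<close> is a positive integer \<open>N\<close> of index \<open>N ^ 2\<close>, the index of \<open>\<alpha>\<close> is
  \<open>N\<close>.\<close>

lemma residue_system_mult:
  assumes "residue_system \<alpha> R" "residue_system \<beta> S"
    and \<alpha>: "\<alpha> \<in> eisenstein" "\<alpha> \<noteq> 0" and \<beta>: "\<beta> \<in> eisenstein"
  obtains Q where "residue_system (\<alpha> * \<beta>) Q" "card Q = card R * card S"
proof -
  \<comment> \<open>Two-digit expansion in base \<alpha>: a residue modulo \<alpha>, then one modulo
    \<beta>.\<close>
  define h where "h p = fst p + \<alpha> * snd p" for p :: "complex \<times> complex"
  note R = residue_systemD[OF assms(1)] and S = residue_systemD[OF assms(2)]
  have eq: "p = q" if p: "p \<in> R \<times> S" and q: "q \<in> R \<times> S" and "h p - h q \<in> (*) (\<alpha> * \<beta>) ` eisenstein"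
    for p q
  proof -
    obtain l where l: "l \<in> eisenstein" "h p - h q = \<alpha> * \<beta> * l" using \<open>h p - h q \<in> _\<close> by blast
    have d: "fst p - fst q = \<alpha> * (\<beta> * l - (snd p - snd q))"
      using l by (simp add: h_def algebra_simps)
    have pq: "fst p \<in> R" "fst q \<in> R" "snd p \<in> S" "snd q \<in> S" using p q by auto
    have pq': "fst p \<in> eisenstein" "snd p \<in> eisenstein" "snd q \<in> eisenstein"
      using pq R(1) S(1) by auto
    have "fst p - fst q \<in> (*) \<alpha> ` eisenstein"
      unfolding d using pq' l \<beta> by (intro imageI) simp
    moreover have "fst p - fst p \<in> (*) \<alpha> ` eisenstein"
      by (intro image_eqI[of _ _ 0]) auto
    ultimately have 1: "fst p = fst q"
      using R(3)[of "fst p"] pq pq' by metis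
    then have "snd p - snd q = \<beta> * l"
      using d \<alpha> by simp
    then have "snd p - snd q \<in> (*) \<beta> ` eisenstein"
      using l by auto
    moreover have "snd p - snd p \<in> (*) \<beta> ` eisenstein"
      by (intro image_eqI[of _ _ 0]) auto
    ultimately have "snd p = snd q"
      using S(3)[of "snd p"] pq pq' by metis
    then show ?thesis using 1 by (simp add: prod_eq_iff)
  qed
  have ex: "\<exists>p\<in>R \<times> S. l - h p \<in> (*) (\<alpha> * \<beta>) ` eisenstein" if l: "l \<in> eisenstein" for l
  proof -
    obtain r where r: "r \<in> R" "l - r \<in> (*) \<alpha> ` eisenstein" using R(3)[OF l] by blast
    then obtain m where m: "m \<in> eisenstein" "l - r = \<alpha> * m" by blast
    obtain s where s: "s \<in> S" "m - s \<in> (*) \<beta> ` eisenstein" using S(3)[OF m(1)] by blast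
    then obtain t where t: "t \<in> eisenstein" "m - s = \<beta> * t" by blast
    have "l = r + \<alpha> * m" "m = s + \<beta> * t" using m t by (auto simp: algebra_simps)
    then have "l - h (r, s) = \<alpha> * \<beta> * t"
      by (simp add: h_def algebra_simps)
    then show ?thesis using r s t by (intro bexI[of _ "(r, s)"]) auto
  qed
  have inj: "inj_on h (R \<times> S)"
  proof (rule inj_onI)
    fix p q assume "p \<in> R \<times> S" "q \<in> R \<times> S" "h p = h q"
    moreover from this have "h p - h q \<in> (*) (\<alpha> * \<beta>) ` eisenstein"
      by (intro image_eqI[of _ _ 0]) auto
    ultimately show "p = q" using eq by blast
  qed
  have "residue_system (\<alpha> * \<beta>) (h ` (R \<times> S))"
    unfolding residue_system_def
  proof (intro conjI ballI)
    show "h ` (R \<times> S) \<subseteq> eisenstein"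
      using R(1) S(1) \<alpha>(1) by (auto simp: h_def subset_eq)
    show "finite (h ` (R \<times> S))" using R S by simp
    fix l assume l: "l \<in> eisenstein"
    obtain p where p: "p \<in> R \<times> S" "l - h p \<in> (*) (\<alpha> * \<beta>) ` eisenstein"
      using ex[OF l] by blast
    show "\<exists>!r. r \<in> h ` (R \<times> S) \<and> l - r \<in> (*) (\<alpha> * \<beta>) ` eisenstein"
    proof (rule ex1I[of _ "h p"])
      fix r assume "r \<in> h ` (R \<times> S) \<and> l - r \<in> (*) (\<alpha> * \<beta>) ` eisenstein"
      then obtain q where q: "q \<in> R \<times> S" "r = h q" "l - h q \<in> (*) (\<alpha> * \<beta>) ` eisenstein" by blast
      have "h q - h p \<in> (*) (\<alpha> * \<beta>) ` eisenstein"
        using eisenstein_multiples_cong[OF eisenstein_multiples_sym[OF q(3)] p(2)] .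
      then show "r = h p" using eq q p by blast
    qed (use p in blast)
  qed
  moreover have "card (h ` (R \<times> S)) = card R * card S"
    using inj by (simp add: card_image card_cartesian_product)
  ultimately show ?thesis using that by blast
qed

lemma residue_system_card_unique:
  assumes R: "residue_system \<alpha> R" and S: "residue_system \<alpha> S"
  shows "card R = card S"
proof -
  have le: "card R \<le> card S" if R: "residue_system \<alpha> R" and S: "residue_system \<alpha> S" for R S
  proof -
    have "\<forall>r\<in>R. \<exists>s. s \<in> S \<and> r - s \<in> (*) \<alpha> ` eisenstein"
    proof
      fix r assume "r \<in> R"
      then have "r \<in> eisenstein" using R by (auto simp: residue_system_def)
      then have "\<exists>!s. s \<in> S \<and> r - s \<in> (*) \<alpha> ` eisenstein"
        by (rule residue_systemD(3)[OF S])
      then show "\<exists>s. s \<in> S \<and> r - s \<in> (*) \<alpha> ` eisenstein" by (rule ex1_implies_ex)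
    qed
    then obtain f where f: "\<And>r. r \<in> R \<Longrightarrow> f r \<in> S \<and> r - f r \<in> (*) \<alpha> ` eisenstein"
      by metis
    have "inj_on f R"
    proof (rule inj_onI)
      fix r r' assume r: "r \<in> R" "r' \<in> R" "f r = f r'"
      have "r - r' \<in> (*) \<alpha> ` eisenstein"
        using f[OF r(1)] f[OF r(2)] r(3) eisenstein_multiples_cong eisenstein_multiples_sym by metis
      moreover have "r - r \<in> (*) \<alpha> ` eisenstein"
        by (intro image_eqI[of _ _ 0]) auto
      moreover have "\<exists>!s. s \<in> R \<and> r - s \<in> (*) \<alpha> ` eisenstein"
        using residue_systemD[OF R] r(1) by (metis (no_types) subsetD)
      ultimately show "r = r'" using r by (metis (no_types))
    qed
    then show ?thesis
      using f S by (metis card_inj_on_le image_subsetI residue_system_def)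
  qed
  show ?thesis using le[OF R S] le[OF S R] by simp
qed

lemma residue_system_cnj:
  assumes R: "residue_system \<alpha> R"
  shows "residue_system (cnj \<alpha>) (cnj ` R)"
proof -
  have c: "cnj a \<in> (*) (cnj \<alpha>) ` eisenstein" if "a \<in> (*) \<alpha> ` eisenstein" for a \<alpha>
    using that by (auto intro!: image_eqI)
  have c': "cnj a \<in> (*) \<alpha> ` eisenstein \<longleftrightarrow> a \<in> (*) (cnj \<alpha>) ` eisenstein" for a
    using c[of a "cnj \<alpha>"] c[of "cnj a" \<alpha>] by auto
  show ?thesis
    unfolding residue_system_def
  proof (intro conjI ballI)
    show "cnj ` R \<subseteq> eisenstein" "finite (cnj ` R)"
      using R by (auto simp: residue_system_def)
    fix l assume "l \<in> eisenstein"
    then have "\<exists>!r. r \<in> R \<and> cnj l - r \<in> (*) \<alpha> ` eisenstein"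
      by (intro residue_systemD(3)[OF R] eisenstein_cnj)
    then obtain r where r: "r \<in> R" "cnj l - r \<in> (*) \<alpha> ` eisenstein"
      and u: "\<And>r'. r' \<in> R \<Longrightarrow> cnj l - r' \<in> (*) \<alpha> ` eisenstein \<Longrightarrow> r' = r" by blast
    show "\<exists>!r. r \<in> cnj ` R \<and> l - r \<in> (*) (cnj \<alpha>) ` eisenstein"
    proof (rule ex1I[of _ "cnj r"])
      show "cnj r \<in> cnj ` R \<and> l - cnj r \<in> (*) (cnj \<alpha>) ` eisenstein"
        using r c'[of "l - cnj r"] by simp
      fix s assume s: "s \<in> cnj ` R \<and> l - s \<in> (*) (cnj \<alpha>) ` eisenstein"
      then have "cnj s \<in> R" by auto
      moreover have "cnj l - cnj s \<in> (*) \<alpha> ` eisenstein"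
        using s c'[of "l - s"] by simp
      ultimately have "cnj s = r" by (rule u)
      then show "s = cnj r" by auto
    qed
  qed
qed

lemma cmod_sq_eisenstein_nat:
  assumes "\<alpha> \<in> eisenstein"
  obtains N :: nat where "\<alpha> * cnj \<alpha> = of_nat N" "(norm \<alpha>)\<^sup>2 = real N"
proof -
  obtain m n where "\<alpha> = of_int m + of_int n * \<zeta>"
    using assms unfolding eisenstein_def by blast
  then have "(norm \<alpha>)\<^sup>2 = of_int (m\<^sup>2 + m * n + n\<^sup>2)" using norm_sq_eisenstein by simp
  moreover obtain x y :: nat where "m\<^sup>2 + m * n + n\<^sup>2 = int (x\<^sup>2 + x * y + y\<^sup>2)"
    using norm_form_nat by blast
  ultimately have "(norm \<alpha>)\<^sup>2 = real (x\<^sup>2 + x * y + y\<^sup>2)"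
    by (simp only: of_int_of_nat_eq)
  moreover from this have "\<alpha> * cnj \<alpha> = of_nat (x\<^sup>2 + x * y + y\<^sup>2)"
    by (simp only: complex_norm_square[symmetric] of_real_of_nat_eq)
  ultimately show ?thesis using that by blast
qed

text \<open>The multiples of the positive integer N = \<alpha> * cnj \<alpha> lie in the ideal of
  \<alpha>, so a finite system modulo N can be thinned out.\<close>

lemma residue_system_exists:
  assumes \<alpha>: "\<alpha> \<in> eisenstein" "\<alpha> \<noteq> 0"
  obtains R where "residue_system \<alpha> R"
proof -
  obtain N :: nat where N: "\<alpha> * cnj \<alpha> = of_nat N" using cmod_sq_eisenstein_nat[OF \<alpha>(1)] by blast
  then have "N > 0" using \<alpha>(2) by (metis complex_cnj_zero_iff mult_eq_0_iff neq0_conv of_nat_0)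
  then obtain R0 where R0: "residue_system (of_nat N) R0" using residue_system_of_nat by blast
  \<comment> \<open>The chosen element depends only on the class of l modulo \<alpha>, because the
    predicate does; so its values form one representative per class.\<close>
  define rep where "rep l = (SOME r. r \<in> R0 \<and> l - r \<in> (*) \<alpha> ` eisenstein)" for l
  have rep: "rep l \<in> R0 \<and> l - rep l \<in> (*) \<alpha> ` eisenstein" if l: "l \<in> eisenstein" for l
  proof -
    obtain r where r: "r \<in> R0" "l - r \<in> (*) (of_nat N) ` eisenstein"
      using ex1_implies_ex[OF residue_systemD(3)[OF R0 l]] by (elim exE conjE)
    then obtain m where "m \<in> eisenstein" "l - r = \<alpha> * (cnj \<alpha> * m)" using N by (auto simp: mult.assoc[symmetric])
    then have "l - r \<in> (*) \<alpha> ` eisenstein" using \<alpha> by (intro image_eqI[of _ _ "cnj \<alpha> * m"]) auto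
    then show ?thesis unfolding rep_def using r by (metis (mono_tags, lifting) someI_ex)
  qed
  have rep_eq: "rep l = rep m" if "l - m \<in> (*) \<alpha> ` eisenstein" for l m
  proof -
    have "l - r \<in> (*) \<alpha> ` eisenstein \<longleftrightarrow> m - r \<in> (*) \<alpha> ` eisenstein" for r
      using that eisenstein_multiples_cong eisenstein_multiples_sym by blast
    then show ?thesis by (simp add: rep_def)
  qed
  have R0E: "R0 \<subseteq> eisenstein" and fin: "finite R0" using R0 by (auto simp: residue_system_def)
  have "residue_system \<alpha> (rep ` eisenstein)"
    unfolding residue_system_def
  proof (intro conjI ballI)
    show "rep ` eisenstein \<subseteq> eisenstein" using rep R0E by blast
    show "finite (rep ` eisenstein)" using rep fin by (metis finite_subset image_subsetI)
    fix l assume l: "l \<in> eisenstein"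
    show "\<exists>!r. r \<in> rep ` eisenstein \<and> l - r \<in> (*) \<alpha> ` eisenstein"
    proof (rule ex1I[of _ "rep l"])
      show "rep l \<in> rep ` eisenstein \<and> l - rep l \<in> (*) \<alpha> ` eisenstein" using rep l by blast
      fix r assume "r \<in> rep ` eisenstein \<and> l - r \<in> (*) \<alpha> ` eisenstein"
      then obtain m where m: "m \<in> eisenstein" "r = rep m" "l - rep m \<in> (*) \<alpha> ` eisenstein" by blast
      have "l - m \<in> (*) \<alpha> ` eisenstein"
        using m rep[OF m(1)] eisenstein_multiples_cong eisenstein_multiples_sym by blast
      then show "r = rep l" using rep_eq m by metis
    qed
  qed
  then show ?thesis using that by blast
qed

lemma residue_system_card:
  assumes \<alpha>: "\<alpha> \<in> eisenstein" "\<alpha> \<noteq> 0" and R: "residue_system \<alpha> R"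
  shows "real (card R) = (norm \<alpha>)\<^sup>2"
proof -
  obtain N :: nat where N: "\<alpha> * cnj \<alpha> = of_nat N" "(norm \<alpha>)\<^sup>2 = real N"
    using cmod_sq_eisenstein_nat[OF \<alpha>(1)] by blast
  then have "N > 0" using \<alpha>(2) by (metis complex_cnj_zero_iff mult_eq_0_iff neq0_conv of_nat_0)
  then obtain R0 where R0: "residue_system (of_nat N) R0" "card R0 = N ^ 2" using residue_system_of_nat by blast
  obtain Q where "residue_system (\<alpha> * cnj \<alpha>) Q" "card Q = card R * card (cnj ` R)"
    using residue_system_mult[OF R residue_system_cnj[OF R] \<alpha> eisenstein_cnj[OF \<alpha>(1)]] by blast
  then have "N ^ 2 = card R * card (cnj ` R)"
    using residue_system_card_unique R0 N(1) by metis
  also have "card (cnj ` R) = card R"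
    by (intro card_image inj_onI) simp
  finally have "card R = N"
    by (simp add: power2_eq_square[symmetric] power_eq_iff_eq_base[of 2])
  then show ?thesis using N by simp
qed

text \<open>Both degree counts reduce to this: a generic fibre is parametrised by the lattice, and
  two parameters give the same point exactly when they are congruent modulo \<alpha>.\<close>

lemma card_eisenstein_quotient:
  assumes \<alpha>: "\<alpha> \<in> eisenstein" "\<alpha> \<noteq> 0" and X: "g ` eisenstein = X"
    and g: "\<And>l m. l \<in> eisenstein \<Longrightarrow> m \<in> eisenstein \<Longrightarrow> g l = g m \<longleftrightarrow> l - m \<in> (*) \<alpha> ` eisenstein"
  shows "finite X \<and> real (card X) = (norm \<alpha>)\<^sup>2"
proof -
  obtain R where R: "residue_system \<alpha> R" using residue_system_exists[OF \<alpha>] by blast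
  note RE = residue_systemD(1)[OF R] and fin = residue_systemD(2)[OF R] and ex1 = residue_systemD(3)[OF R]
  have "g ` R = X"
  proof -
    have "g l \<in> g ` R" if l: "l \<in> eisenstein" for l
    proof -
      obtain r where "r \<in> R" "l - r \<in> (*) \<alpha> ` eisenstein" using ex1[OF l] by blast
      then show ?thesis using g l RE by (metis imageI subsetD)
    qed
    then show ?thesis using X RE by blast
  qed
  moreover have "inj_on g R"
  proof (rule inj_onI)
    fix r s assume rs: "r \<in> R" "s \<in> R" "g r = g s"
    have "r - s \<in> (*) \<alpha> ` eisenstein" using g rs RE by blast
    moreover have "r - r \<in> (*) \<alpha> ` eisenstein"
      by (intro image_eqI[of _ _ 0]) auto
    moreover have "r \<in> eisenstein" using rs RE by blast
    ultimately show "r = s" using ex1[of r] rs by blast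
  qed
  ultimately show ?thesis
    using residue_system_card[OF \<alpha> R] fin by (metis card_image finite_imageI)
qed

lemma zeta_power_mod: "\<zeta> ^ j = \<zeta> ^ (j mod 6)"
proof -
  have "\<zeta> ^ j = \<zeta> ^ (6 * (j div 6) + j mod 6)" by simp
  also have "\<dots> = \<zeta> ^ (j mod 6)" unfolding power_add power_mult zeta_pow6 by simp
  finally show ?thesis .
qed

lemma eisenstein_minus_iff: "- a \<in> eisenstein \<longleftrightarrow> a \<in> eisenstein"
  using eisenstein_minus[of a] eisenstein_minus[of "- a"] by auto

lemma zeta_powers: "\<zeta> ^ 2 = \<zeta> - 1" "\<zeta> ^ 3 = -1" "\<zeta> ^ 4 = - \<zeta>" "\<zeta> ^ 5 = 1 - \<zeta>"
proof -
  show "\<zeta> ^ 2 = \<zeta> - 1" "\<zeta> ^ 3 = -1" by (fact zeta_sq zeta_pow3)+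
  have "\<zeta> ^ 4 = \<zeta> ^ 3 * \<zeta>" "\<zeta> ^ 5 = \<zeta> ^ 3 * \<zeta> ^ 2" by (simp_all add: power_add[symmetric] power_Suc2[symmetric] del: power_Suc)
  then show "\<zeta> ^ 4 = - \<zeta>" "\<zeta> ^ 5 = 1 - \<zeta>" by (simp_all add: zeta_pow3 zeta_sq)
qed

section \<open>The rotation group of the lattice\<close>

definition orbit_rel :: "complex \<Rightarrow> complex \<Rightarrow> bool" where
  "orbit_rel z w \<longleftrightarrow> (\<exists>j. \<exists>l\<in>eisenstein. w = \<zeta> ^ j * z + l)"

lemma orbit_relI: "l \<in> eisenstein \<Longrightarrow> orbit_rel z (\<zeta> ^ j * z + l)"
  by (auto simp: orbit_rel_def)

lemma orbit_rel_refl [simp]: "orbit_rel z z"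
  using orbit_relI[of 0 z 0] by simp

lemma orbit_rel_sym: "orbit_rel z w \<Longrightarrow> orbit_rel w z"
proof -
  assume "orbit_rel z w"
  then obtain j l where l: "l \<in> eisenstein" "w = \<zeta> ^ j * z + l" by (auto simp: orbit_rel_def)
  have "\<zeta> ^ (5 * j) * \<zeta> ^ j = (\<zeta> ^ 6) ^ j" by (simp add: power_add[symmetric] power_mult[symmetric])
  then have "z = \<zeta> ^ (5 * j) * w + (- (\<zeta> ^ (5 * j) * l))"
    using l by (simp add: algebra_simps zeta_pow6 mult.assoc[symmetric])
  then show ?thesis using l unfolding orbit_rel_def by (metis eisenstein_minus eisenstein_mult eisenstein_power eisenstein_zeta)
qed

lemma orbit_rel_trans: "orbit_rel z w \<Longrightarrow> orbit_rel w u \<Longrightarrow> orbit_rel z u"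
proof -
  assume "orbit_rel z w" "orbit_rel w u"
  then obtain j l i m where l: "l \<in> eisenstein" "w = \<zeta> ^ j * z + l"
    and m: "m \<in> eisenstein" "u = \<zeta> ^ i * w + m" by (auto simp: orbit_rel_def)
  have "u = \<zeta> ^ (i + j) * z + (\<zeta> ^ i * l + m)"
    unfolding l m by (simp add: algebra_simps power_add)
  then show ?thesis using l(1) m(1) orbit_relI[of "\<zeta> ^ i * l + m" z "i + j"] by simp
qed

lemma orbit_rel_mult:
  assumes "orbit_rel z w" "\<alpha> \<in> eisenstein"
  shows "orbit_rel (\<alpha> * z) (\<alpha> * w)"
proof -
  obtain j l where l: "l \<in> eisenstein" "w = \<zeta> ^ j * z + l" using assms by (auto simp: orbit_rel_def)
  then have "\<alpha> * w = \<zeta> ^ j * (\<alpha> * z) + \<alpha> * l" by (simp add: algebra_simps)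
  then show ?thesis using l assms orbit_relI[of "\<alpha> * l" "\<alpha> * z" j] by simp
qed

lemma orbit_rel_0: "orbit_rel 0 z \<longleftrightarrow> z \<in> eisenstein"
  by (auto simp: orbit_rel_def)

lemma orbit_rel_translate: "l \<in> eisenstein \<Longrightarrow> orbit_rel z (z + l)"
  using orbit_relI[of l z 0] by simp

lemma orbit_rel_rotate: "orbit_rel z (\<zeta> ^ j * z)"
  using orbit_relI[of 0 z j] by simp

lemma closed_eisenstein: "closed eisenstein"
proof (rule discrete_imp_closed[of 1])
  show "\<forall>x\<in>eisenstein. \<forall>y\<in>eisenstein. dist y x < 1 \<longrightarrow> y = x"
    using eisenstein_inter_unit_interval by (metis dist_norm eisenstein_diff right_minus_eq)
qed simp

text \<open>Only six rotation parts occur, and for each of them the lattice condition on w - \<zeta>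
  ^ j * z is closed.\<close>

lemma open_not_orbit_rel: "open {p. \<not> orbit_rel (fst p) (snd p)}"
proof -
  have "{p. \<not> orbit_rel (fst p) (snd p)} = (\<Inter>j\<in>{..<6::nat}. (\<lambda>p. snd p - \<zeta> ^ j * fst p) -` (- eisenstein))"
    (is "?L = ?R")
  proof -
    have "orbit_rel z w \<longleftrightarrow> (\<exists>j<6. w - \<zeta> ^ j * z \<in> eisenstein)" for z w
    proof
      assume "orbit_rel z w"
      then obtain j l where l: "l \<in> eisenstein" "w = \<zeta> ^ j * z + l" by (auto simp: orbit_rel_def)
      then have "w - \<zeta> ^ (j mod 6) * z \<in> eisenstein" by (simp add: zeta_power_mod[symmetric])
      then show "\<exists>j<6. w - \<zeta> ^ j * z \<in> eisenstein" by (intro exI[of _ "j mod 6"]) simp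
    next
      assume "\<exists>j<6. w - \<zeta> ^ j * z \<in> eisenstein"
      then obtain j where "w - \<zeta> ^ j * z \<in> eisenstein" by blast
      then show "orbit_rel z w" using orbit_relI[of "w - \<zeta> ^ j * z" z j] by simp
    qed
    then show ?thesis by auto
  qed
  moreover have "open ((\<lambda>p. snd p - \<zeta> ^ j * fst p) -` (- eisenstein))" for j
    using closed_eisenstein by (intro open_vimage continuous_intros) auto
  ultimately show ?thesis by (simp add: open_INT)
qed

lemma not_orbit_rel_nhds:
  assumes "\<not> orbit_rel z w"
  obtains r where "r > 0" "\<And>u v. u \<in> ball z r \<Longrightarrow> v \<in> ball w r \<Longrightarrow> \<not> orbit_rel u v"
proof -
  obtain A B where "open A" "open B" "(z, w) \<in> A \<times> B" and sub: "A \<times> B \<subseteq> {p. \<not> orbit_rel (fst p) (snd p)}"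
  proof (rule open_prod_elim[OF open_not_orbit_rel])
    show "(z, w) \<in> {p. \<not> orbit_rel (fst p) (snd p)}" using assms by simp
  qed blast
  then obtain e d where "e > 0" "ball z e \<subseteq> A" "d > 0" "ball w d \<subseteq> B"
    by (meson mem_Sigma_iff open_contains_ball)
  then show ?thesis
    using sub by (intro that[of "min e d"]) (auto simp: subset_eq)
qed

text \<open>\<open>stab z\<close> is the order of the stabiliser of \<open>z\<close> in the group generated by the translations by
  Eisenstein integers and the rotation by \<open>\<zeta>\<close>, and \<open>rot z\<close> is the linear part of a generator.\<close>

definition stab :: "complex \<Rightarrow> nat" where
  "stab z = (if z \<in> eisenstein then 6 else if 2 * z \<in> eisenstein then 2
             else if (1 + \<zeta>) * z \<in> eisenstein then 3 else 1)"

definition rot :: "complex \<Rightarrow> complex" where "rot z = \<zeta> ^ (6 div stab z)"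

lemma stab_cases: "stab z = 1 \<or> stab z = 2 \<or> stab z = 3 \<or> stab z = 6"
  by (auto simp: stab_def)

lemma stab_pos: "stab z > 0"
  using stab_cases[of z] by auto

lemma eisenstein_numeral [simp]: "numeral n \<in> eisenstein"
  using eisenstein_of_nat[of "numeral n"] by simp

lemma two_minus_zeta_mult: "(2 - \<zeta>) * ((1 + \<zeta>) * z) = 3 * z"
proof -
  have "(2 - \<zeta>) * (1 + \<zeta>) = 3" using zeta_sq by (simp add: algebra_simps power2_eq_square)
  then show ?thesis by (simp only: mult.assoc[symmetric])
qed

text \<open>2 and 1 + \<zeta> are coprime: (2 - \<zeta>) * (1 + \<zeta>) = 3, and 3 - 2 = 1.\<close>

lemma eisenstein_of_two_multiples:
  assumes "2 * z \<in> eisenstein" "(1 + \<zeta>) * z \<in> eisenstein"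
  shows "z \<in> eisenstein"
proof -
  have "(2 - \<zeta>) * ((1 + \<zeta>) * z) - 2 * z = z"
    by (simp add: two_minus_zeta_mult)
  then show ?thesis using assms by (metis eisenstein_diff eisenstein_mult eisenstein_numeral eisenstein_zeta)
qed

lemma stab_iff:
  shows "stab z = 6 \<longleftrightarrow> z \<in> eisenstein"
    and "stab z = 2 \<longleftrightarrow> z \<notin> eisenstein \<and> 2 * z \<in> eisenstein"
    and "stab z = 3 \<longleftrightarrow> z \<notin> eisenstein \<and> (1 + \<zeta>) * z \<in> eisenstein"
proof -
  have *: "(if P then 6 else if Q then 2 else if R then 3 else (1::nat)) = 6 \<longleftrightarrow> P"
    "(if P then 6 else if Q then 2 else if R then 3 else (1::nat)) = 2 \<longleftrightarrow> \<not> P \<and> Q"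
    "(if P then 6 else if Q then 2 else if R then 3 else (1::nat)) = 3 \<longleftrightarrow> \<not> P \<and> \<not> Q \<and> R" for P Q R
    by auto
  show "stab z = 6 \<longleftrightarrow> z \<in> eisenstein" "stab z = 2 \<longleftrightarrow> z \<notin> eisenstein \<and> 2 * z \<in> eisenstein"
    "stab z = 3 \<longleftrightarrow> z \<notin> eisenstein \<and> (1 + \<zeta>) * z \<in> eisenstein"
    unfolding stab_def * using eisenstein_of_two_multiples[of z] by blast+
qed

lemma stab_eqD:
  shows "stab z = 6 \<Longrightarrow> z \<in> eisenstein"
    and "stab z = 2 \<Longrightarrow> 2 * z \<in> eisenstein"
    and "stab z = 3 \<Longrightarrow> (1 + \<zeta>) * z \<in> eisenstein"
  unfolding stab_iff by blast+

lemma stab_eqI: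
  shows "z \<in> eisenstein \<Longrightarrow> stab z = 6"
    and "2 * z \<in> eisenstein \<Longrightarrow> stab z = 2 \<or> stab z = 6"
    and "(1 + \<zeta>) * z \<in> eisenstein \<Longrightarrow> stab z = 3 \<or> stab z = 6"
  unfolding stab_iff by blast+

lemma eisenstein_zeta_mult_iff [simp]: "\<zeta> * z \<in> eisenstein \<longleftrightarrow> z \<in> eisenstein"
proof
  assume "\<zeta> * z \<in> eisenstein"
  then have "\<zeta> ^ 5 * (\<zeta> * z) \<in> eisenstein" by simp
  moreover have "\<zeta> ^ 5 * (\<zeta> * z) = z" using zeta_pow6 by (simp add: mult.assoc[symmetric] power_Suc2[symmetric] del: power_Suc)
  ultimately show "z \<in> eisenstein" by simp
qed simp

text \<open>A rotation \<zeta> ^ j fixes z modulo the lattice iff (1 - \<zeta> ^ j) * z is in it. Up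
  to units 1 - \<zeta> ^ 2 is 1 + \<zeta>, and 1 - \<zeta> ^ 3 = 2; this is where the tests in
  \<open>stab\<close> come from.\<close>

lemma rot_eisenstein: "rot z * z - z \<in> eisenstein"
proof -
  have "(1 - \<zeta>) * (1 + \<zeta>) = 1 - \<zeta> ^ 2" by (simp add: algebra_simps power2_eq_square)
  then have "\<zeta> ^ 2 * z - z = - ((1 - \<zeta>) * (1 + \<zeta>)) * z" by (simp add: algebra_simps)
  also have "\<dots> = - (1 - \<zeta>) * ((1 + \<zeta>) * z)" by (simp only: mult.assoc mult_minus_left)
  finally have c2: "\<zeta> ^ 2 * z - z \<in> eisenstein" if "(1 + \<zeta>) * z \<in> eisenstein"
    using that by simp
  have c3: "\<zeta> ^ 3 * z - z \<in> eisenstein" if "2 * z \<in> eisenstein"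
    using eisenstein_minus[OF that] by (simp add: zeta_pow3)
  show ?thesis
    using stab_cases[of z] c2[OF stab_eqD(3)] c3[OF stab_eqD(2)] stab_eqD(1)[of z]
    by (elim disjE) (simp_all add: rot_def zeta_pow6)
qed

text \<open>For j = 1, ..., 5 the number 1 - \<zeta> ^ j is, up to units, 1, 1 + \<zeta>, 2, 1 +
  \<zeta>, 1. So each residue of j modulo 6 tells which orders \<open>stab z\<close> can
  have.\<close>

lemma stabilizer_generated:
  assumes "\<zeta> ^ j * z - z \<in> eisenstein"
  obtains i where "\<zeta> ^ j = rot z ^ i"
proof -
  have rep: "\<exists>i. \<zeta> ^ j = rot z ^ i" if dvd: "(6 div stab z) dvd j mod 6"
  proof -
    obtain i where "j mod 6 = 6 div stab z * i" using dvd by (rule dvdE)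
    then show ?thesis by (metis zeta_power_mod rot_def power_mult)
  qed
  have as: "\<zeta> ^ (j mod 6) * z - z \<in> eisenstein" using assms by (simp add: zeta_power_mod[symmetric])
  have "j mod 6 = 0 \<or> j mod 6 = 1 \<or> j mod 6 = 2 \<or> j mod 6 = 3 \<or> j mod 6 = 4 \<or> j mod 6 = 5" by arith
  then consider "j mod 6 = 0" | "j mod 6 = 1" | "j mod 6 = 2" | "j mod 6 = 3" | "j mod 6 = 4" | "j mod 6 = 5"
    by (elim disjE) simp_all
  then have "(6 div stab z) dvd j mod 6"
  proof cases
    case 2
    then have "\<zeta> * (\<zeta> * z - z) \<in> eisenstein" using as by simp
    also have "\<zeta> * (\<zeta> * z - z) = (\<zeta>\<^sup>2 - \<zeta>) * z" by (simp add: algebra_simps power2_eq_square)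
    also have "\<dots> = - z" by (simp add: zeta_sq)
    finally have "z \<in> eisenstein" by (simp only: eisenstein_minus_iff)
    then show ?thesis by (simp add: stab_def)
  next
    case 3
    then have "\<zeta> * (\<zeta>^2 * z - z) \<in> eisenstein" using as by simp
    also have "\<zeta> * (\<zeta>^2 * z - z) = (\<zeta>^3 - \<zeta>) * z"
      by (simp add: algebra_simps power2_eq_square power3_eq_cube)
    also have "\<dots> = - ((1 + \<zeta>) * z)" by (simp add: zeta_pow3 algebra_simps)
    finally have "(1 + \<zeta>) * z \<in> eisenstein" by (simp only: eisenstein_minus_iff)
    then have "stab z = 6 \<or> stab z = 3" by (rule stab_eqI(3)[THEN disj_commute[THEN iffD1]])
    then show ?thesis using 3 by auto
  next
    case 4
    then have "2 * z \<in> eisenstein" using as eisenstein_minus[of "-z-z"] by (simp add: zeta_pow3)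
    then show ?thesis using 4 stab_eqI(2)[of z] by auto
  next
    case 5
    then have "(1 + \<zeta>) * z \<in> eisenstein" using as eisenstein_minus[of "-(\<zeta> * z)-z"] by (simp add: zeta_powers algebra_simps)
    then have "stab z = 6 \<or> stab z = 3" by (rule stab_eqI(3)[THEN disj_commute[THEN iffD1]])
    then show ?thesis using 5 by auto
  next
    case 6
    then have "\<zeta> * z \<in> eisenstein" using as eisenstein_minus[of "-(\<zeta> * z)"] by (simp add: zeta_powers algebra_simps)
    then show ?thesis by (simp add: stab_def)
  qed simp
  then show ?thesis using rep that by blast
qed

lemma orbit_rel_eisenstein_mult:
  assumes "orbit_rel z w" "c \<in> eisenstein"
  shows "c * z \<in> eisenstein \<longleftrightarrow> c * w \<in> eisenstein"
proof -
  have "c * w \<in> eisenstein" if "orbit_rel z w" "c * z \<in> eisenstein" for z w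
  proof -
    have "orbit_rel (c * z) (c * w)" using that assms orbit_rel_mult by blast
    moreover have "orbit_rel 0 (c * z)" using that orbit_rel_0 by blast
    ultimately show ?thesis using orbit_rel_trans orbit_rel_0 by blast
  qed
  then show ?thesis using assms orbit_rel_sym by blast
qed

lemma stab_orbit_rel: "orbit_rel z w \<Longrightarrow> stab z = stab w"
  unfolding stab_def
  using orbit_rel_eisenstein_mult[of z w 1] orbit_rel_eisenstein_mult[of z w 2] orbit_rel_eisenstein_mult[of z w "1 + \<zeta>"]
  by simp

text \<open>The centroid of the lattice triangle 0, 1, 1 - \<zeta>, which a rotation of order 3
  fixes modulo the lattice.\<close>

definition third_point :: complex where "third_point = inverse (1 + \<zeta>)"

lemma one_plus_zeta_nz: "1 + \<zeta> \<noteq> 0"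
  by (simp add: \<zeta>_def complex_eq_iff)

lemma norm_one_plus_zeta: "norm (1 + \<zeta>) > 1"
proof -
  have "(norm (1 + \<zeta>))\<^sup>2 = 3" using norm_sq_eisenstein[of 1 1] by simp
  then show ?thesis by (metis one_less_numeral_iff one_power2 power2_less_imp_less norm_ge_zero semiring_norm(77))
qed

lemma half_notin_eisenstein: "1 / 2 \<notin> eisenstein"
  using eisenstein_norm_ge_1[of "1/2"] by (auto simp: norm_divide)

lemma third_point_notin_eisenstein: "third_point \<notin> eisenstein"
proof
  assume "third_point \<in> eisenstein"
  moreover have "third_point \<noteq> 0" using one_plus_zeta_nz by (simp add: third_point_def)
  ultimately have "norm third_point \<ge> 1" using eisenstein_norm_ge_1 by blast
  moreover have "norm third_point < 1"
    using less_imp_inverse_less[OF norm_one_plus_zeta] by (simp add: third_point_def norm_inverse)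
  ultimately show False by simp
qed

lemma third_point_mult: "(1 + \<zeta>) * third_point = 1"
  using one_plus_zeta_nz by (simp add: third_point_def)

lemma stab_0: "stab 0 = 6" and stab_half: "stab (1 / 2) = 2" and stab_third: "stab third_point = 3"
  using half_notin_eisenstein third_point_notin_eisenstein third_point_mult eisenstein_of_two_multiples[of third_point]
  by (auto simp: stab_def)

lemma stab_6_orbit: "stab z = 6 \<Longrightarrow> orbit_rel 0 z"
  by (auto simp: stab_def orbit_rel_0 split: if_splits)

text \<open>Half-lattice points fall into three nonzero classes modulo the lattice, represented by
  1/2, \<zeta>/2 and (1 + \<zeta>)/2, and rotation by \<zeta> permutes them.\<close>

lemma stab_2_orbit:
  assumes "stab z = 2"
  shows "orbit_rel (1 / 2) z"
proof -
  have z: "2 * z \<in> eisenstein" "z \<notin> eisenstein" using assms by (auto simp: stab_def split: if_splits)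
  then obtain m n where mn: "2 * z = of_int m + of_int n * \<zeta>" unfolding eisenstein_def by blast
  define a where "a = m mod 2"
  define b where "b = n mod 2"
  have "(of_int m :: complex) = of_int (2 * (m div 2) + a)" "(of_int n :: complex) = of_int (2 * (n div 2) + b)"
    by (simp_all add: a_def b_def)
  then have zz: "z = (of_int a + of_int b * \<zeta>) / 2 + (of_int (m div 2) + of_int (n div 2) * \<zeta>)"
    using mn by (simp add: field_simps)
  have l: "of_int (m div 2) + of_int (n div 2) * \<zeta> \<in> eisenstein" by simp
  then have nz: "\<not> (a = 0 \<and> b = 0)" using zz z(2) by auto
  have "a \<in> {0, 1}" "b \<in> {0, 1}" by (auto simp: a_def b_def)
  then consider "a = 1" "b = 0" | "a = 0" "b = 1" | "a = 1" "b = 1" using nz by auto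
  then show ?thesis
  proof cases
    case 1
    then show ?thesis using orbit_rel_translate[OF l, of "1/2"] zz by simp
  next
    case 2
    then show ?thesis using orbit_relI[OF l, of "1/2" 1] zz by simp
  next
    case 3
    \<comment> \<open>The extra 1 compensates \<zeta> ^ 2 / 2 = (1 + \<zeta>) / 2 - 1.\<close>
    have "of_int (m div 2) + of_int (n div 2) * \<zeta> + 1 \<in> eisenstein" by simp
    from orbit_relI[OF this, of "1/2" 2] 3 show ?thesis
      unfolding zz zeta_sq by (simp add: field_simps)
  qed
qed

text \<open>Since \<zeta> = -1 modulo 1 + \<zeta>, the class of m + n * \<zeta> is that of m - n
  modulo 3. The classes 1 and 2 are exchanged by \<zeta> ^ 3 = -1.\<close>

lemma stab_3_orbit:
  assumes "stab z = 3"
  shows "orbit_rel third_point z"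
proof -
  have z: "(1 + \<zeta>) * z \<in> eisenstein" "z \<notin> eisenstein" using assms by (auto simp: stab_def split: if_splits)
  then obtain m n where mn: "(1 + \<zeta>) * z = of_int m + of_int n * \<zeta>" unfolding eisenstein_def by blast
  define a where "a = (m - n) mod 3"
  define q where "q = (m - n) div 3"
  have "m - n = 3 * q + a" by (simp add: a_def q_def)
  then have "m = n + 3 * q + a" by simp
  have e: "(1 + \<zeta>) * (of_int q * (2 - \<zeta>)) = 3 * of_int q"
    using two_minus_zeta_mult[of "of_int q"] by (simp only: ac_simps)
  define P where "P = of_int n + of_int q * (2 - \<zeta>)"
  have eq: "(1 + \<zeta>) * z = (1 + \<zeta>) * P + of_int a"
    unfolding mn \<open>m = _\<close> P_def distrib_left[of "1 + \<zeta>"] e by (simp add: algebra_simps)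
  have cancel: "third_point * ((1 + \<zeta>) * w) = w" for w
    using third_point_mult by (simp add: mult.assoc[symmetric] mult.commute)
  have "third_point * ((1 + \<zeta>) * z) = third_point * ((1 + \<zeta>) * P + of_int a)"
    unfolding eq ..
  also have "\<dots> = third_point * ((1 + \<zeta>) * P) + third_point * of_int a"
    by (rule distrib_left)
  finally have zz: "z = of_int a * third_point + (of_int n + of_int q * (2 - \<zeta>))"
    unfolding cancel by (simp add: P_def)
  have l: "of_int n + of_int q * (2 - \<zeta>) \<in> eisenstein" by simp
  have "a = 0 \<or> a = 1 \<or> a = 2" unfolding a_def by presburger
  moreover have "a \<noteq> 0" using zz z(2) l by auto
  ultimately consider "a = 1" | "a = 2" by blast
  then show ?thesis
  proof cases
    case 1
    then show ?thesis using orbit_rel_translate[OF l, of third_point] zz by simp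
  next
    case 2
    have "3 * third_point = 2 - \<zeta>"
      unfolding two_minus_zeta_mult[symmetric] third_point_mult by simp
    then have "of_int a * third_point = \<zeta> ^ 3 * third_point + (2 - \<zeta>)"
      using 2 by (simp add: zeta_pow3)
    then have "z = \<zeta> ^ 3 * third_point + ((2 - \<zeta>) + (of_int n + of_int q * (2 - \<zeta>)))"
      using zz by simp
    then show ?thesis using orbit_relI[of "(2 - \<zeta>) + (of_int n + of_int q * (2 - \<zeta>))" third_point 3] by simp
  qed
qed

lemma stab_dvd_mult:
  assumes "\<alpha> \<in> eisenstein"
  shows "stab z dvd stab (\<alpha> * z)"
proof -
  have m: "c * (\<alpha> * z) \<in> eisenstein" if "c * z \<in> eisenstein" for c
    using eisenstein_mult[OF assms that] by (simp add: mult.left_commute)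
  have 1: "\<alpha> * z \<in> eisenstein" if "z \<in> eisenstein"
    using that assms by (rule eisenstein_mult[rotated])
  have 2: "2 * (\<alpha> * z) \<in> eisenstein" if "2 * z \<in> eisenstein"
    using that by (rule m)
  have 3: "(1 + \<zeta>) * (\<alpha> * z) \<in> eisenstein" if "(1 + \<zeta>) * z \<in> eisenstein"
    using that by (rule m)
  show ?thesis
    using stab_cases[of z]
  proof (elim disjE)
    assume "stab z = 2"
    then show ?thesis using stab_eqI(2)[OF 2[OF stab_eqD(2)]] by auto
  next
    assume "stab z = 3"
    then show ?thesis using stab_eqI(3)[OF 3[OF stab_eqD(3)]] by auto
  next
    assume "stab z = 6"
    then show ?thesis using stab_eqI(1)[OF 1[OF stab_eqD(1)]] by auto
  qed auto
qed

text \<open>A Bezout identity: multiplying \<alpha> * z by \<open>cnj \<alpha>\<close> gives (6 * k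
  + 1) * z, and subtracting k times 6 * z leaves z.\<close>

lemma eisenstein_cancel_coprime:
  assumes "\<alpha> \<in> eisenstein" "(norm \<alpha>)\<^sup>2 = real (6 * k + 1)" "\<alpha> * z \<in> eisenstein" "6 * z \<in> eisenstein"
  shows "z \<in> eisenstein"
proof -
  have "cnj \<alpha> * \<alpha> = of_nat (6 * k + 1)"
    using assms(2) by (metis complex_norm_square mult.commute of_real_of_nat_eq)
  then have "cnj \<alpha> * (\<alpha> * z) = of_nat k * (6 * z) + z"
    by (simp add: mult.assoc[symmetric]) (simp add: algebra_simps)
  then have "z = cnj \<alpha> * (\<alpha> * z) - of_nat k * (6 * z)" by simp
  then show ?thesis using assms by (metis eisenstein_cnj eisenstein_diff eisenstein_mult eisenstein_of_nat)
qed

lemma stab_mult_special: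
  assumes \<alpha>: "\<alpha> \<in> eisenstein" "(norm \<alpha>)\<^sup>2 = real (6 * k + 1)"
  shows "stab (\<alpha> * (1 / 2)) = 2" "stab (\<alpha> * third_point) = 3"
proof -
  have "\<alpha> * (1 / 2) \<notin> eisenstein"
    using eisenstein_cancel_coprime[OF \<alpha>, of "1/2"] half_notin_eisenstein by auto
  then show "stab (\<alpha> * (1 / 2)) = 2" using \<alpha>(1) by (simp add: stab_def)
  have "6 * third_point = 2 * ((2 - \<zeta>) * ((1 + \<zeta>) * third_point))"
    by (simp add: two_minus_zeta_mult)
  then have "6 * third_point \<in> eisenstein" by (simp only: third_point_mult) simp
  then have "\<alpha> * third_point \<notin> eisenstein"
    using eisenstein_cancel_coprime[OF \<alpha>, of third_point] third_point_notin_eisenstein by auto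
  moreover have "(1 + \<zeta>) * (\<alpha> * third_point) \<in> eisenstein"
    using third_point_mult \<alpha>(1) by (metis mult.left_commute mult.right_neutral)
  ultimately show "stab (\<alpha> * third_point) = 3"
    using eisenstein_of_two_multiples[of "\<alpha> * third_point"] by (auto simp: stab_def)
qed

lemma countable_eisenstein: "countable eisenstein"
proof -
  have "eisenstein = range (\<lambda>(m, n). of_int m + of_int n * \<zeta>)"
    by (auto simp: eisenstein_def)
  then show ?thesis by (metis countable_image countableI_type)
qed

lemma countable_stab_ne_1: "countable {z. stab z \<noteq> 1}"
proof (rule countable_subset)
  show "{z. stab z \<noteq> 1} \<subseteq> (\<lambda>z. z / 6) ` eisenstein"
  proof
    fix z assume "z \<in> {z. stab z \<noteq> 1}"
    then have "6 * z \<in> eisenstein"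
    proof -
      have "6 * z = 3 * (2 * z)" by simp
      moreover have "6 * z = 2 * ((2 - \<zeta>) * ((1 + \<zeta>) * z))"
        by (simp add: two_minus_zeta_mult)
      moreover have "z \<in> eisenstein \<or> 2 * z \<in> eisenstein \<or> (1 + \<zeta>) * z \<in> eisenstein"
        using \<open>z \<in> _\<close> by (auto simp: stab_def split: if_splits)
      ultimately show ?thesis
        by (metis eisenstein_mult eisenstein_numeral eisenstein_diff eisenstein_zeta)
    qed
    then show "z \<in> (\<lambda>z. z / 6) ` eisenstein" by (intro image_eqI[of _ _ "6 * z"]) auto
  qed
qed (simp add: countable_eisenstein)

section \<open>An invariant lattice sum\<close>

text \<open>At a zero of order n, f - f \<xi> is the n-th power of (w - \<xi>) * g w with g
  zero-free. That base has derivative g \<xi> at \<xi>, hence is injective nearby.\<close>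

lemma holomorphic_power_normal_form:
  assumes holf: "f holomorphic_on S" and S: "open S" "connected S" "\<xi> \<in> S" and nc: "\<not> f constant_on S"
  obtains n r h where "n \<ge> 1" "r > 0" "ball \<xi> r \<subseteq> S" "h holomorphic_on ball \<xi> r" "inj_on h (ball \<xi> r)"
    "h \<xi> = 0" "\<And>w. w \<in> ball \<xi> r \<Longrightarrow> f w - f \<xi> = h w ^ n"
proof -
  have "\<exists>n>0. (deriv ^^ n) f \<xi> \<noteq> 0"
  proof (rule ccontr)
    assume "\<not> ?thesis"
    then have "f w = f \<xi>" if "w \<in> S" for w
      using holomorphic_fun_eq_const_on_connected[OF holf S(1,2) _ S(3) that] by blast
    then show False using nc by (auto simp: constant_on_def)
  qed
  then obtain n0 where n0: "n0 > 0 \<and> (deriv ^^ n0) f \<xi> \<noteq> 0" by blast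
  define n where "n = (LEAST n. n > 0 \<and> (deriv ^^ n) f \<xi> \<noteq> 0)"
  have n: "n > 0 \<and> (deriv ^^ n) f \<xi> \<noteq> 0"
    unfolding n_def using n0 by (rule LeastI)
  have nmin: "(deriv ^^ k) f \<xi> = 0" if "0 < k" "k < n" for k
    using not_less_Least[of k "\<lambda>n. n > 0 \<and> (deriv ^^ n) f \<xi> \<noteq> 0"] that unfolding n_def by blast
  obtain g r where r: "0 < r" and holg: "g holomorphic_on ball \<xi> r"
    and fd: "\<And>w. w \<in> ball \<xi> r \<Longrightarrow> f w - f \<xi> = ((w - \<xi>) * g w) ^ n"
    and gnz: "\<And>w. w \<in> ball \<xi> r \<Longrightarrow> g w \<noteq> 0"
    by (rule holomorphic_factor_order_of_zero_strong[OF holf S(1,3) conjunct1[OF n] conjunct2[OF n]])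
      (assumption | rule nmin | rule that)+
  define h where "h w = (w - \<xi>) * g w" for w
  have holh: "h holomorphic_on ball \<xi> r"
    unfolding h_def by (intro holomorphic_intros holg)
  have dg: "(g has_field_derivative deriv g \<xi>) (at \<xi>)"
    using holomorphic_derivI[OF holg open_ball] r by simp
  have "(h has_field_derivative (1 * g \<xi> + (\<xi> - \<xi>) * deriv g \<xi>)) (at \<xi>)"
    unfolding h_def by (rule derivative_eq_intros dg refl | simp)+
  then have "deriv h \<xi> \<noteq> 0"
    using gnz[of \<xi>] r by (simp add: DERIV_imp_deriv)
  then obtain r1 where r1: "r1 > 0" "ball \<xi> r1 \<subseteq> ball \<xi> r" "inj_on h (ball \<xi> r1)"
    using has_complex_derivative_locally_injective[OF holh _ open_ball] r by (metis centre_in_ball)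
  obtain r2 where r2: "r2 > 0" "ball \<xi> r2 \<subseteq> S" using S by (meson open_contains_ball)
  show ?thesis
  proof
    have sub: "ball \<xi> (min r1 r2) \<subseteq> ball \<xi> r1" "ball \<xi> (min r1 r2) \<subseteq> ball \<xi> r2" by auto
    show "n \<ge> 1" "min r1 r2 > 0" "h \<xi> = 0" using n r1 r2 by (auto simp: h_def)
    show "ball \<xi> (min r1 r2) \<subseteq> S" using sub r2 by blast
    show "h holomorphic_on ball \<xi> (min r1 r2)"
      using holh sub r1 by (meson holomorphic_on_subset order_trans)
    show "inj_on h (ball \<xi> (min r1 r2))" using r1 sub inj_on_subset by blast
    show "f w - f \<xi> = h w ^ n" if "w \<in> ball \<xi> (min r1 r2)" for w
      using fd[of w] that sub r1 by (auto simp: h_def)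
  qed
qed

lemma surface_chart_injective_continuous:
  fixes h :: "complex \<Rightarrow> complex"
  assumes "open A" "continuous_on A h" "inj_on h A"
  shows "surface_chart UNIV A h"
proof -
  obtain g where "homeomorphism A (h ` A) h g"
    using invariance_of_domain_homeomorphism[OF assms(1,2) _ assms(3)] by auto
  moreover have "open (h ` A)"
    by (rule invariance_of_domain[OF assms(2,1,3)])
  ultimately show ?thesis
    using assms(1) by (intro surface_chartI) auto
qed

lemma surface_chart_translate:
  assumes "surface_chart S V \<psi>"
  shows "surface_chart S V (\<lambda>s. \<psi> s - c)"
proof -
  have "homeomorphism (\<psi> ` V) ((\<lambda>w. w - c) ` \<psi> ` V) (\<lambda>w. w - c) (\<lambda>w. w + c)"
    by (auto simp: homeomorphism_def image_image intro!: continuous_intros)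
  then have "homeomorphism V ((\<lambda>w. w - c) ` \<psi> ` V) ((\<lambda>w. w - c) \<circ> \<psi>) (inv_into V \<psi> \<circ> (\<lambda>w. w + c))"
    using homeomorphism_compose[OF surface_chart_homeomorphism[OF assms]] by blast
  moreover have "open ((\<lambda>w. w - c) ` \<psi> ` V)"
    using open_translation_subtract surface_chart_open_image[OF assms] by blast
  ultimately show ?thesis
    using surface_chartI[OF surface_chart_openin[OF assms]] by (simp add: o_def)
qed

section \<open>Convergence of the sum and its pole\<close>

lemma summable_on_int_inverse_1_plus_sq: "(\<lambda>m::int. 1 / (1 + (real_of_int m)\<^sup>2)) summable_on UNIV"
proof -
  have nat: "summable (\<lambda>n. norm (1 / (1 + (real n)\<^sup>2)))"
  proof (rule summable_comparison_test_ev)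
    show "summable (\<lambda>n. inverse (real n ^ 2))"
      by (rule inverse_power_summable) simp
    show "\<forall>\<^sub>F n in sequentially. norm (norm (1 / (1 + (real n)\<^sup>2))) \<le> inverse (real n ^ 2)"
      using eventually_gt_at_top[of 0]
      by eventually_elim (auto simp: inverse_eq_divide intro!: divide_left_mono mult_pos_pos add_pos_nonneg)
  qed
  have "(\<lambda>n. 1 / (1 + (real n)\<^sup>2)) summable_on UNIV"
    using norm_summable_imp_summable_on[OF nat] .
  then have 1: "(\<lambda>m::int. 1 / (1 + (real_of_int m)\<^sup>2)) summable_on range int"
    "(\<lambda>m::int. 1 / (1 + (real_of_int m)\<^sup>2)) summable_on range (\<lambda>n. - int n)"
    by (subst summable_on_reindex; force simp: inj_on_def o_def)+
  have "(\<lambda>m::int. 1 / (1 + (real_of_int m)\<^sup>2)) summable_on (range (\<lambda>n. - int n) - range int)"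
    using 1(2) by (rule summable_on_subset_banach) auto
  then have "(\<lambda>m::int. 1 / (1 + (real_of_int m)\<^sup>2)) summable_on (range int \<union> (range (\<lambda>n. - int n) - range int))"
    using 1(1) by (intro summable_on_Un_disjoint) auto
  moreover have "range int \<union> (range (\<lambda>n. - int n) - range int) = UNIV"
  proof -
    have "m \<in> range int \<or> m \<in> range (\<lambda>n. - int n)" for m :: int
      by (cases m rule: int_cases2) auto
    then show ?thesis by blast
  qed
  ultimately show ?thesis by simp
qed

text \<open>The product form lets the double sum split into two single ones. With s = m ^ 2 + n ^ 2
  the norm form is at least s / 2 and the two factors multiply to at most 4 * s ^ 3, whence 32 = 8 *
  4. At m = n = 0 the left side is 0 because \<open>inverse 0 = 0\<close>.\<close>

lemma eisenstein_inverse_norm_bound: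
  fixes m n :: int
  shows "inverse (norm (of_int m + of_int n * \<zeta>)) ^ 6 \<le> 32 * (1 / (1 + (real_of_int m)\<^sup>2) * (1 / (1 + (real_of_int n)\<^sup>2)))"
proof (cases "m = 0 \<and> n = 0")
  case True
  then show ?thesis by simp
next
  case False
  define s where "s = (real_of_int m)\<^sup>2 + (real_of_int n)\<^sup>2"
  define q where "q = (norm (of_int m + of_int n * \<zeta>))\<^sup>2"
  have "m\<^sup>2 + n\<^sup>2 \<ge> 1"
    using False by (metis add_pos_nonneg add_nonneg_pos int_one_le_iff_zero_less zero_le_power2 zero_less_power2)
  then have s1: "s \<ge> 1" unfolding s_def by (metis (mono_tags) of_int_add of_int_le_iff of_int_1 of_int_power)
  have q: "q = (real_of_int m)\<^sup>2 + real_of_int m * real_of_int n + (real_of_int n)\<^sup>2"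
    unfolding q_def norm_sq_eisenstein by simp
  have "0 \<le> (real_of_int m + real_of_int n)\<^sup>2" by simp
  then have qs: "q \<ge> s / 2" unfolding q s_def by (simp add: power2_eq_square algebra_simps)
  have "(s / 2) ^ 3 \<le> q ^ 3" using qs s1 by (intro power_mono) auto
  moreover have "(1 + (real_of_int m)\<^sup>2) * (1 + (real_of_int n)\<^sup>2) \<le> 4 * s ^ 3"
  proof -
    have "(1 + (real_of_int m)\<^sup>2) * (1 + (real_of_int n)\<^sup>2) \<le> (1 + s) * (1 + s)"
      by (intro mult_mono) (auto simp: s_def)
    also have "\<dots> \<le> (2 * s) * (2 * s)" using s1 by (intro mult_mono) auto
    also have "\<dots> \<le> 4 * s ^ 3" using s1 by (simp add: power3_eq_cube mult_le_cancel_left)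
    finally show ?thesis .
  qed
  ultimately have le: "(1 + (real_of_int m)\<^sup>2) * (1 + (real_of_int n)\<^sup>2) \<le> 32 * q ^ 3"
    by (simp add: power_divide)
  have qpos: "q > 0" using qs s1 by linarith
  have "inverse (norm (of_int m + of_int n * \<zeta>)) ^ 6 = 1 / q ^ 3"
    by (simp add: q_def power_mult[symmetric] power_inverse divide_inverse)
  also have "\<dots> \<le> 32 / ((1 + (real_of_int m)\<^sup>2) * (1 + (real_of_int n)\<^sup>2))"
  proof -
    have "0 < (1 + (real_of_int m)\<^sup>2) * (1 + (real_of_int n)\<^sup>2)"
      by (intro mult_pos_pos add_pos_nonneg) auto
    then show ?thesis using le qpos by (simp add: field_simps)
  qed
  finally show ?thesis by simp
qed

lemma eisenstein_summable: "(\<lambda>l. inverse (norm l) ^ 6) summable_on eisenstein"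
proof -
  define h where "h p = of_int (fst p) + of_int (snd p) * \<zeta>" for p :: "int \<times> int"
  have bij: "bij_betw h UNIV eisenstein"
    unfolding bij_betw_def
  proof
    show "inj h" by (rule injI) (auto simp: h_def dest: eisenstein_rep_unique intro: prod_eqI)
    show "range h = eisenstein" unfolding h_def eisenstein_def by (force simp: image_def)
  qed
  define fq where "fq m = 1 / (1 + (real_of_int m)\<^sup>2)" for m :: int
  have fq: "fq summable_on UNIV"
    unfolding fq_def[abs_def] by (rule summable_on_int_inverse_1_plus_sq)
  have nonneg: "fq m \<ge> 0" for m by (simp add: fq_def add_nonneg_nonneg)
  have "(\<lambda>p. norm (fq (fst p) * fq (snd p))) summable_on (UNIV \<times> UNIV)"
    unfolding Infinite_Sum.abs_summable_on_Sigma_iff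
  proof (intro conjI ballI)
    fix m :: int
    show "(\<lambda>n. norm (fq (fst (m, n)) * fq (snd (m, n)))) summable_on UNIV"
      using summable_on_cmult_right[OF fq, of "fq m"] nonneg
      by (simp add: abs_mult)
    have "(\<lambda>m. fq m * infsum fq UNIV) summable_on UNIV"
      by (rule summable_on_cmult_left[OF fq])
    moreover have "norm (infsum (\<lambda>n. norm (fq (fst (m, n)) * fq (snd (m, n)))) UNIV) = fq m * infsum fq UNIV" for m
      using nonneg by (simp add: abs_mult infsum_cmult_right' infsum_nonneg)
    ultimately show "(\<lambda>m. norm (infsum (\<lambda>n. norm (fq (fst (m, n)) * fq (snd (m, n)))) UNIV)) summable_on UNIV"
      by simp
  qed
  then have "(\<lambda>p. fq (fst p) * fq (snd p)) summable_on UNIV"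
    using abs_summable_summable by fastforce
  then have "(\<lambda>p. 32 * (fq (fst p) * fq (snd p))) summable_on UNIV"
    by (rule summable_on_cmult_right)
  then have "(\<lambda>p. inverse (norm (h p)) ^ 6) summable_on UNIV"
    by (rule summable_on_comparison_test) (auto simp: h_def fq_def intro: eisenstein_inverse_norm_bound simp del: times_divide_times_eq mult_1 mult_1_right times_divide_eq_right times_divide_eq_left)
  then show ?thesis
    using summable_on_reindex_bij_betw[OF bij, of "\<lambda>l. inverse (norm l) ^ 6"] by simp
qed

text \<open>The term \<open>l = z\<close> contributes \<open>0\<close> here, so the values at the poles are irrelevant finite numbers.\<close>

definition eisenstein_sum :: "complex \<Rightarrow> complex" where
  "eisenstein_sum z = (\<Sum>\<^sub>\<infinity>l\<in>eisenstein. inverse (z - l) ^ 6)"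

lemma eisenstein_sum_translate:
  assumes "l \<in> eisenstein"
  shows "eisenstein_sum (z + l) = eisenstein_sum z"
proof -
  have bij: "bij_betw (\<lambda>m. m + l) eisenstein eisenstein"
    by (rule bij_betwI[of _ _ _ "\<lambda>m. m - l"]) (use assms in auto)
  have "eisenstein_sum (z + l) = (\<Sum>\<^sub>\<infinity>m\<in>eisenstein. inverse (z + l - (m + l)) ^ 6)"
    unfolding eisenstein_sum_def by (rule infsum_reindex_bij_betw[OF bij, symmetric])
  then show ?thesis by (simp add: eisenstein_sum_def)
qed

lemma eisenstein_sum_rotate: "eisenstein_sum (\<zeta> * z) = eisenstein_sum z"
proof -
  have z5: "\<zeta> * (\<zeta> ^ 5 * m) = m" for m
    using zeta_pow6 by (simp add: mult.assoc[symmetric] power_Suc[symmetric] del: power_Suc)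
  have bij: "bij_betw (\<lambda>m. \<zeta> * m) eisenstein eisenstein"
  proof (rule bij_betwI[of _ _ _ "\<lambda>m. \<zeta> ^ 5 * m"])
    show "\<zeta> ^ 5 * (\<zeta> * m) = m" for m using z5[of m] by (simp only: mult.left_commute)
  qed (use z5 in auto)
  have "eisenstein_sum (\<zeta> * z) = (\<Sum>\<^sub>\<infinity>m\<in>eisenstein. inverse (\<zeta> * z - \<zeta> * m) ^ 6)"
    unfolding eisenstein_sum_def by (rule infsum_reindex_bij_betw[OF bij, symmetric])
  also have "(\<lambda>m. inverse (\<zeta> * z - \<zeta> * m) ^ 6) = (\<lambda>m. inverse (z - m) ^ 6)"
    unfolding right_diff_distrib[symmetric] inverse_mult_distrib power_mult_distrib power_inverse[of \<zeta>, symmetric]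
    by (simp add: zeta_pow6 power_inverse)
  finally show ?thesis by (simp add: eisenstein_sum_def)
qed

lemma eisenstein_sum_orbit_rel: "orbit_rel z w \<Longrightarrow> eisenstein_sum w = eisenstein_sum z"
proof -
  have "eisenstein_sum (\<zeta> ^ j * z) = eisenstein_sum z" for j
    by (induction j) (simp_all add: eisenstein_sum_rotate mult.assoc)
  then show "orbit_rel z w \<Longrightarrow> eisenstein_sum w = eisenstein_sum z"
    by (auto simp: orbit_rel_def eisenstein_sum_translate)
qed

text \<open>A lattice point of norm at least 2 * R keeps distance at least half its norm from the
  disc, which gives a Weierstrass majorant with constant 64 = 2 ^ 6.\<close>

lemma lattice_sum_holomorphic:
  fixes z :: complex
  assumes A: "A \<subseteq> eisenstein" and R: "R > 0" and far: "\<And>l. l \<in> A \<Longrightarrow> norm l \<ge> 2 * R"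
  shows "(\<lambda>z. \<Sum>\<^sub>\<infinity>l\<in>A. inverse (z - l) ^ 6) holomorphic_on ball 0 R"
    and "z \<in> ball 0 R \<Longrightarrow> (\<lambda>l. inverse (z - l) ^ 6) summable_on A"
proof -
  define M where "M l = 64 * inverse (norm (l::complex)) ^ 6" for l
  have M: "M summable_on A"
    unfolding M_def using eisenstein_summable A
    by (intro summable_on_cmult_right) (rule summable_on_subset_banach)
  have bound: "norm (inverse (z - l) ^ 6) \<le> M l" if z: "z \<in> cball 0 R" and l: "l \<in> A" for z l
  proof -
    have "norm l \<le> norm (z - l) + norm z"
      by (metis norm_minus_commute norm_triangle_sub add.commute)
    then have "norm l / 2 \<le> norm (z - l)" "norm l > 0"
      using z far[OF l] R by auto
    then have "inverse (norm (z - l)) \<le> inverse (norm l / 2)"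
      by (intro le_imp_inverse_le) auto
    then have "inverse (norm (z - l)) ^ 6 \<le> inverse (norm l / 2) ^ 6"
      by (intro power_mono) auto
    also have "\<dots> = M l"
      by (simp add: M_def power_mult_distrib power_divide inverse_eq_divide)
    finally show ?thesis by (simp add: norm_power norm_inverse)
  qed
  have unif: "uniform_limit (cball 0 R) (\<lambda>X z. \<Sum>l\<in>X. inverse (z - l) ^ 6)
      (\<lambda>z. \<Sum>\<^sub>\<infinity>l\<in>A. inverse (z - l) ^ 6) (finite_subsets_at_top A)"
    by (rule Weierstrass_m_test_general[OF bound M])
  have hol: "(\<lambda>z. \<Sum>l\<in>X. inverse (z - l) ^ 6) holomorphic_on cball 0 R" if "X \<subseteq> A" for X
  proof (intro holomorphic_intros)
    fix z l :: complex assume "z \<in> cball 0 R" "l \<in> X"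
    then show "z - l \<noteq> 0" using far[of l] that R by auto
  qed
  show "(\<lambda>z::complex. \<Sum>\<^sub>\<infinity>l\<in>A. inverse (z - l) ^ 6) holomorphic_on ball 0 R"
  proof (rule holomorphic_uniform_limit[OF _ unif])
    show "\<forall>\<^sub>F X in finite_subsets_at_top A. continuous_on (cball (0::complex) R) (\<lambda>z::complex. \<Sum>l\<in>X. inverse (z - l) ^ 6) \<and>
        (\<lambda>z::complex. \<Sum>l\<in>X. inverse (z - l) ^ 6) holomorphic_on ball (0::complex) R"
      using hol by (intro eventually_finite_subsets_at_top_weakI)
        (meson ball_subset_cball holomorphic_on_imp_continuous_on holomorphic_on_subset)
  qed auto
  show "(\<lambda>l. inverse (z - l) ^ 6) summable_on A" if "z \<in> ball 0 R"
  proof -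
    have "(\<lambda>l. norm (inverse (z - l) ^ 6)) summable_on A"
      using M by (rule summable_on_comparison_test) (use bound[of z] that in auto)
    then show ?thesis by (rule abs_summable_summable)
  qed
qed

lemma finite_eisenstein_bounded: "finite {l \<in> eisenstein. norm l < R}"
proof -
  have "finite (cball 0 R \<inter> eisenstein)"
  proof (rule finite_not_islimpt_in_compact)
    show "\<not> z islimpt eisenstein" for z
      by (rule discrete_imp_not_islimpt[of 1])
        (metis dist_norm eisenstein_diff eisenstein_inter_unit_interval right_minus_eq zero_less_one)+
  qed simp
  then show ?thesis by (rule finite_subset[rotated]) auto
qed

text \<open>The finite part contains every pole in the disc, so the remaining tail is holomorphic
  there.\<close>

lemma eisenstein_sum_split:
  assumes "R > 0" "z \<in> ball 0 R"
  defines "L \<equiv> {l \<in> eisenstein. norm l < 2 * R}"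
  shows "eisenstein_sum z = (\<Sum>l\<in>L. inverse (z - l) ^ 6) + (\<Sum>\<^sub>\<infinity>l\<in>eisenstein - L. inverse (z - l) ^ 6)"
proof -
  have L: "finite L" unfolding L_def by (rule finite_eisenstein_bounded)
  have "(\<lambda>l. inverse (z - l) ^ 6) summable_on (eisenstein - L)"
    by (rule lattice_sum_holomorphic(2)[OF _ assms(1) _ assms(2)]) (auto simp: L_def)
  moreover have "eisenstein = L \<union> (eisenstein - L)" by (auto simp: L_def)
  ultimately have "eisenstein_sum z = infsum (\<lambda>l. inverse (z - l) ^ 6) L + infsum (\<lambda>l. inverse (z - l) ^ 6) (eisenstein - L)"
    unfolding eisenstein_sum_def using L by (subst infsum_Un_disjoint[symmetric]) auto
  then show ?thesis using L by simp
qed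

lemma eisenstein_sum_holomorphic: "eisenstein_sum holomorphic_on - eisenstein"
proof -
  have "eisenstein_sum field_differentiable at z" if z: "z \<in> - eisenstein" for z
  proof -
    define R where "R = norm z + 1"
    define L where "L = {l \<in> eisenstein. norm l < 2 * R}"
    have R: "R > 0" "z \<in> ball 0 R" by (auto simp: R_def add_nonneg_pos)
    have "(\<lambda>z. (\<Sum>l\<in>L. inverse (z - l) ^ 6) + (\<Sum>\<^sub>\<infinity>l\<in>eisenstein - L. inverse (z - l) ^ 6))
        holomorphic_on (ball 0 R - eisenstein)"
    proof (rule holomorphic_on_add)
      show "(\<lambda>z. \<Sum>l\<in>L. inverse (z - l) ^ 6) holomorphic_on (ball 0 R - eisenstein)"
        by (intro holomorphic_intros) (auto simp: L_def)
      have "(\<lambda>z. \<Sum>\<^sub>\<infinity>l\<in>eisenstein - L. inverse (z - l) ^ 6) holomorphic_on ball 0 R"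
        by (rule lattice_sum_holomorphic(1)) (use R in \<open>auto simp: L_def\<close>)
      then show "(\<lambda>z. \<Sum>\<^sub>\<infinity>l\<in>eisenstein - L. inverse (z - l) ^ 6) holomorphic_on (ball 0 R - eisenstein)"
        by (rule holomorphic_on_subset) auto
    qed
    then have "eisenstein_sum holomorphic_on (ball 0 R - eisenstein)"
      by (rule holomorphic_transform) (use eisenstein_sum_split[OF R(1)] in \<open>auto simp: L_def\<close>)
    moreover have "open (ball 0 R - eisenstein)"
      using closed_eisenstein by (simp add: open_Diff)
    ultimately show ?thesis
      using z R holomorphic_on_imp_differentiable_at by blast
  qed
  then show ?thesis
    by (simp add: holomorphic_on_def field_differentiable_at_within)
qed

lemma eisenstein_sum_pole_part:
  obtains g where "g holomorphic_on ball 0 (1 / 2)"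
    "\<And>z. z \<in> ball 0 (1 / 2) \<Longrightarrow> eisenstein_sum z = inverse z ^ 6 + g z"
proof
  let ?g = "\<lambda>z. \<Sum>\<^sub>\<infinity>l\<in>eisenstein - {0}. inverse (z - l) ^ 6"
  \<comment> \<open>Nonzero lattice points have norm at least 1, hence the radius 1/2.\<close>
  have far: "norm l \<ge> 2 * (1 / 2)" if "l \<in> eisenstein - {0}" for l
    using that eisenstein_norm_ge_1 by auto
  show "?g holomorphic_on ball 0 (1 / 2)"
    by (rule lattice_sum_holomorphic(1)) (use far in auto)
  show "eisenstein_sum z = inverse z ^ 6 + ?g z" if z: "z \<in> ball 0 (1 / 2)" for z
  proof -
    have "(\<lambda>l. inverse (z - l) ^ 6) summable_on eisenstein - {0}"
      by (rule lattice_sum_holomorphic(2)[OF _ _ far z]) auto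
    moreover have "eisenstein = {0} \<union> (eisenstein - {0})" by auto
    ultimately have "eisenstein_sum z = infsum (\<lambda>l. inverse (z - l) ^ 6) {0} + ?g z"
      unfolding eisenstein_sum_def by (subst infsum_Un_disjoint[symmetric]) auto
    then show ?thesis by simp
  qed
qed

text \<open>Near 0 the sum is u z / z ^ 6 with u 0 = 1, so its reciprocal is the sixth power of z
  times a sixth root of 1 / u, available through \<open>Ln\<close> while u stays in the disc of
  radius 1 around 1.\<close>

lemma eisenstein_sum_pole_normal_form:
  obtains r h where "r > 0" "r \<le> 1 / 2" "h holomorphic_on ball 0 r" "inj_on h (ball 0 r)" "h 0 = 0"
    "\<And>z. z \<in> ball 0 r \<Longrightarrow> z \<noteq> 0 \<Longrightarrow> eisenstein_sum z \<noteq> 0 \<and> inverse (eisenstein_sum z) = h z ^ 6"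
proof -
  obtain g where g: "g holomorphic_on ball 0 (1 / 2)"
    "\<And>z. z \<in> ball 0 (1 / 2) \<Longrightarrow> eisenstein_sum z = inverse z ^ 6 + g z"
    using eisenstein_sum_pole_part by blast
  define u where "u z = 1 + z ^ 6 * g z" for z
  have holu: "u holomorphic_on ball 0 (1 / 2)"
    unfolding u_def by (intro holomorphic_intros g(1))
  have "open (ball 0 (1 / 2) \<inter> u -` ball 1 1)"
    using holomorphic_on_imp_continuous_on[OF holu]
    by (simp add: continuous_open_preimage)
  moreover have "0 \<in> ball 0 (1 / 2) \<inter> u -` ball 1 1" by (simp add: u_def)
  ultimately obtain r0 where r0: "r0 > 0" "ball 0 r0 \<subseteq> ball 0 (1 / 2) \<inter> u -` ball 1 1"
    by (meson open_contains_ball)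
  have unp: "u z \<notin> \<real>\<^sub>\<le>\<^sub>0" if "z \<in> ball 0 r0" for z
  proof
    assume "u z \<in> \<real>\<^sub>\<le>\<^sub>0"
    then have "Re (u z) \<le> 0" by (auto elim: nonpos_Reals_cases)
    moreover have "norm (1 - u z) < 1" using r0(2) that by (auto simp: dist_norm)
    moreover have "Re (1 - u z) \<le> norm (1 - u z)" by (rule complex_Re_le_cmod)
    ultimately show False by simp
  qed
  define h where "h z = z * exp (- Ln (u z) / 6)" for z
  have holu0: "u holomorphic_on ball 0 r0"
    using holu r0(2) holomorphic_on_subset by blast
  have hol1: "(\<lambda>z. exp (- Ln (u z) / 6)) holomorphic_on ball 0 r0"
    using unp by (intro holomorphic_intros holu0) auto
  then have holh: "h holomorphic_on ball 0 r0"
    unfolding h_def by (rule holomorphic_on_mult[OF holomorphic_on_ident])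
  have dg: "((\<lambda>z. exp (- Ln (u z) / 6)) has_field_derivative deriv (\<lambda>z. exp (- Ln (u z) / 6)) 0) (at 0)"
    using holomorphic_derivI[OF hol1 open_ball] r0 by simp
  have "(h has_field_derivative (1 * exp (- Ln (u 0) / 6) + 0 * deriv (\<lambda>z. exp (- Ln (u z) / 6)) 0)) (at 0)"
    unfolding h_def by (rule derivative_eq_intros dg refl | simp)+
  then have dnz: "deriv h 0 \<noteq> 0" by (simp add: DERIV_imp_deriv)
  obtain r where r: "r > 0" "ball (0::complex) r \<subseteq> ball 0 r0" "inj_on h (ball 0 r)"
    by (rule has_complex_derivative_locally_injective[OF holh iffD2[OF centre_in_ball r0(1)] open_ball dnz]) (rule that)
  have eq: "eisenstein_sum z \<noteq> 0 \<and> inverse (eisenstein_sum z) = h z ^ 6" if z: "z \<in> ball 0 r" "z \<noteq> 0" for z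
  proof -
    have z0: "z \<in> ball 0 r0" "z \<in> ball 0 (1 / 2)" using z(1) r(2) r0(2) by blast+
    have u0: "u z \<noteq> 0" using unp[OF z0(1)] by auto
    have "eisenstein_sum z = u z / z ^ 6"
      unfolding g(2)[OF z0(2)] u_def add_divide_distrib using z(2) by (simp add: power_inverse divide_inverse)
    moreover have "h z ^ 6 = z ^ 6 / u z"
    proof -
      have "exp (- Ln (u z) / 6) ^ 6 = exp (of_nat 6 * (- Ln (u z) / 6))"
        by (rule exp_of_nat_mult[symmetric])
      also have "of_nat 6 * (- Ln (u z) / 6) = - Ln (u z)" by simp
      also have "exp (- Ln (u z)) = inverse (u z)" by (simp only: exp_minus exp_Ln[OF u0])
      finally have "exp (- Ln (u z) / 6) ^ 6 = inverse (u z)" .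
      then show ?thesis by (simp only: h_def power_mult_distrib divide_inverse)
    qed
    ultimately show ?thesis using u0 z(2) by (metis divide_eq_0_iff inverse_divide power_eq_0_iff)
  qed
  have "r \<le> 1 / 2"
  proof -
    have "ball 0 r \<subseteq> ball (0::complex) (1/2)" using r r0 by blast
    then show ?thesis using r(1) by (simp add: ball_subset_ball_iff)
  qed
  moreover have "h holomorphic_on ball 0 r" using holh r(2) holomorphic_on_subset by blast
  ultimately show ?thesis
    using that[of r h] r(1,3) eq by (simp add: h_def)
qed

text \<open>At the pole the reciprocal tends to 0 without being 0 nearby.\<close>

lemma eisenstein_sum_not_constant: "\<not> eisenstein_sum constant_on - eisenstein"
proof
  assume "eisenstein_sum constant_on - eisenstein"
  then obtain c where c: "\<And>z. z \<in> - eisenstein \<Longrightarrow> eisenstein_sum z = c" by (auto simp: constant_on_def)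
  obtain r h where r: "r > 0" "r \<le> 1 / 2" "h holomorphic_on ball 0 r" "inj_on h (ball 0 r)" "h 0 = 0"
    "\<And>z. z \<in> ball 0 r \<Longrightarrow> z \<noteq> 0 \<Longrightarrow> eisenstein_sum z \<noteq> 0 \<and> inverse (eisenstein_sum z) = h z ^ 6"
    using eisenstein_sum_pole_normal_form by metis
  have notE: "z \<in> - eisenstein" if "z \<in> ball 0 r" "z \<noteq> 0" for z
    using that r(2) eisenstein_norm_ge_1[of z] by auto
  have eq: "h z ^ 6 = inverse c" if "z \<in> ball 0 r - {0}" for z
    using that r(6) notE c by (metis Diff_iff singletonI)
  have "continuous_on (ball 0 r) h" using r(3) holomorphic_on_imp_continuous_on by blast
  then have "continuous (at 0) h" using r(1) by (simp add: continuous_on_eq_continuous_at)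
  then have "((\<lambda>z. h z ^ 6) \<longlongrightarrow> 0 ^ 6) (at 0)"
    using r(5) by (intro tendsto_power) (simp add: continuous_at)
  moreover have "\<forall>\<^sub>F z in at 0. h z ^ 6 = inverse c"
    unfolding eventually_at using r(1) eq by (intro exI[of _ r]) (auto simp: dist_norm)
  then have "((\<lambda>z. h z ^ 6) \<longlongrightarrow> inverse c) (at 0)"
    by (rule tendsto_eventually)
  ultimately have "inverse c = 0" using LIM_unique by fastforce
  moreover have "of_real (r / 2) \<in> ball 0 r - {0::complex}" using r(1) by simp
  ultimately have "eisenstein_sum (of_real (r / 2)) \<noteq> 0" "eisenstein_sum (of_real (r / 2)) = 0"
    using r(6)[of "of_real (r / 2)"] c[OF notE, of "of_real (r / 2)"] by auto
  then show False by simp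
qed

lemma connected_Compl_eisenstein: "connected (- eisenstein)"
  using connected_open_diff_countable[of "UNIV :: complex set" eisenstein] countable_eisenstein connected_UNIV
  by (simp add: Compl_eq_Diff_UNIV)

section \<open>Stabilisers and orbits near a point\<close>

lemma zeta_power_eq_1_iff: "\<zeta> ^ n = 1 \<longleftrightarrow> 6 dvd n"
proof
  assume "\<zeta> ^ n = 1"
  then have 1: "\<zeta> ^ (n mod 6) = 1" using zeta_power_mod by metis
  have "n mod 6 = 0 \<or> n mod 6 = 1 \<or> n mod 6 = 2 \<or> n mod 6 = 3 \<or> n mod 6 = 4 \<or> n mod 6 = 5" by presburger
  moreover have "\<zeta> ^ 2 \<noteq> 1" "\<zeta> ^ 3 \<noteq> 1" "\<zeta> ^ 4 \<noteq> 1" "\<zeta> ^ 5 \<noteq> 1"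
    unfolding zeta_powers by (auto simp: \<zeta>_def complex_eq_iff)
  ultimately have "n mod 6 = 0" using 1 by (elim disjE) simp_all
  then show "6 dvd n" by auto
next
  assume "6 dvd n"
  then show "\<zeta> ^ n = 1" by (auto elim!: dvdE simp: power_mult zeta_pow6)
qed

lemma sixth_root_of_unity:
  assumes "w ^ 6 = 1"
  obtains j where "w = \<zeta> ^ j"
proof -
  have inj: "inj_on (\<lambda>j. \<zeta> ^ j) {..<6}"
  proof -
    have "i = j" if "i \<le> j" "j < 6" "\<zeta> ^ i = \<zeta> ^ j" for i j
    proof -
      have "\<zeta> ^ i * \<zeta> ^ (j - i) = \<zeta> ^ (i + (j - i))" by (simp only: power_add)
      then have "\<zeta> ^ i * \<zeta> ^ (j - i) = \<zeta> ^ i" using that by simp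
      then have "6 dvd j - i" using zeta_power_eq_1_iff by simp
      then show ?thesis using that by (auto dest!: dvd_imp_le)
    qed
    then show ?thesis
      by (intro inj_onI) (metis lessThan_iff nle_le)
  qed
  have "(\<lambda>j. \<zeta> ^ j) ` {..<6} = {w. w ^ 6 = 1}"
  proof (rule card_subset_eq)
    show "finite {w::complex. w ^ 6 = 1}" by (rule finite_nth_roots) simp
    show "(\<lambda>j. \<zeta> ^ j) ` {..<6} \<subseteq> {w. w ^ 6 = 1}"
      by (auto simp: power_mult[symmetric] zeta_power_eq_1_iff)
    show "card ((\<lambda>j. \<zeta> ^ j) ` {..<6}) = card {w::complex. w ^ 6 = 1}"
      using card_nth_roots[of 1 6] card_image[OF inj] by simp
  qed
  then show ?thesis using assms that by blast
qed

lemma stab_dvd_6: "stab z dvd 6"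
  using stab_cases[of z] by (elim disjE) simp_all

lemma rot_power_eq_1_iff: "rot z ^ n = 1 \<longleftrightarrow> stab z dvd n"
proof -
  have "rot z ^ n = \<zeta> ^ (6 div stab z * n)" by (simp add: rot_def power_mult)
  then have "rot z ^ n = 1 \<longleftrightarrow> 6 dvd 6 div stab z * n" by (simp only: zeta_power_eq_1_iff)
  also have "\<dots> \<longleftrightarrow> 6 div stab z * stab z dvd 6 div stab z * n"
    by (simp only: dvd_div_mult_self[OF stab_dvd_6])
  also have "\<dots> \<longleftrightarrow> stab z dvd n"
    using stab_cases[of z] by (elim disjE) simp_all
  finally show ?thesis .
qed

lemma rot_power_eisenstein: "rot z ^ i * z - z \<in> eisenstein"
proof (induction i)
  case (Suc i)
  have eq: "rot z ^ Suc i * z - z = rot z * (rot z ^ i * z - z) + (rot z * z - z)"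
    by (simp add: algebra_simps)
  have "rot z \<in> eisenstein" by (simp add: rot_def)
  then show ?case unfolding eq using Suc rot_eisenstein[of z] by (intro eisenstein_add eisenstein_mult)
qed simp

lemma stab_root_of_unity:
  assumes "w ^ stab z = 1"
  obtains i where "w = rot z ^ i"
proof -
  have "w ^ 6 = 1" using assms stab_dvd_6 by (metis dvdE power_mult power_one)
  then obtain j where j: "w = \<zeta> ^ j" by (rule sixth_root_of_unity)
  then have "6 dvd j * stab z" using assms by (simp add: power_mult[symmetric] zeta_power_eq_1_iff)
  then have "6 div stab z * stab z dvd j * stab z" by (simp only: dvd_div_mult_self[OF stab_dvd_6])
  then have "(6 div stab z) dvd j" using stab_pos[of z] by simp
  then obtain i where "j = 6 div stab z * i" by (rule dvdE)
  then show ?thesis using that[of i] j by (simp add: rot_def power_mult)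
qed

lemma orbit_rel_rotation:
  assumes "\<zeta> ^ j * z - z \<in> eisenstein"
  shows "orbit_rel u (z + \<zeta> ^ j * (u - z))"
proof -
  have eq: "z + \<zeta> ^ j * (u - z) = \<zeta> ^ j * u + - (\<zeta> ^ j * z - z)" by (simp add: algebra_simps)
  show ?thesis unfolding eq by (rule orbit_relI) (use assms in \<open>simp only: eisenstein_minus_iff\<close>)
qed

lemma rot_power_zeta: "rot z ^ i = \<zeta> ^ (6 div stab z * i)"
  by (simp add: rot_def power_mult)

lemma orbit_rel_rot: "orbit_rel u (z + rot z ^ i * (u - z))"
  using orbit_rel_rotation[of "6 div stab z * i" z u] rot_power_eisenstein[of z i]
  by (simp add: rot_power_zeta)

text \<open>For each of the six rotation parts the values \<zeta> ^ j * z - z + l form a discrete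
  set. A motion taking a point near z to a point near z makes this value small, hence 0, and so
  fixes z.\<close>

lemma orbit_rel_near:
  obtains \<delta> where "\<delta> > 0"
    "\<And>u u'. u \<in> ball z \<delta> \<Longrightarrow> u' \<in> ball z \<delta> \<Longrightarrow> orbit_rel u u' \<Longrightarrow> \<exists>i. u' = z + rot z ^ i * (u - z)"
proof -
  have ex: "\<exists>\<delta>>0. \<forall>l\<in>eisenstein. norm (\<zeta> ^ j * z - z + l) < 2 * \<delta> \<longrightarrow> \<zeta> ^ j * z - z + l = 0" for j
  proof (cases "\<zeta> ^ j * z - z \<in> eisenstein")
    case True
    then show ?thesis
      by (intro exI[of _ "1/2"]) (auto intro: eisenstein_inter_unit_interval)
  next
    case False
    then have "\<zeta> ^ j * z - z \<in> - eisenstein" by simp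
    then obtain d where d: "d > 0" "ball (\<zeta> ^ j * z - z) d \<subseteq> - eisenstein"
      using closed_eisenstein by (metis open_Compl open_contains_ball)
    have "norm (\<zeta> ^ j * z - z + l) \<ge> d" if "l \<in> eisenstein" for l
    proof (rule ccontr)
      assume "\<not> ?thesis"
      then have "- l \<in> ball (\<zeta> ^ j * z - z) d" by (simp add: dist_norm)
      then show False using d(2) that by (metis ComplD eisenstein_minus subsetD)
    qed
    then show ?thesis using d(1) by (intro exI[of _ "d/2"]) force
  qed
  then obtain \<delta> where \<delta>: "\<And>j. \<delta> j > 0"
    "\<And>j l. l \<in> eisenstein \<Longrightarrow> norm (\<zeta> ^ j * z - z + l) < 2 * \<delta> j \<Longrightarrow> \<zeta> ^ j * z - z + l = 0"
    by metis
  define \<epsilon> where "\<epsilon> = Min (\<delta> ` {..<6::nat})"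
  have \<epsilon>: "\<epsilon> > 0" "\<And>j. j < 6 \<Longrightarrow> \<epsilon> \<le> \<delta> j"
  proof -
    have "\<epsilon> \<in> \<delta> ` {..<6::nat}"
      unfolding \<epsilon>_def by (intro Min_in) (auto simp: lessThan_empty_iff)
    then show "\<epsilon> > 0" using \<delta>(1) by auto
    show "\<epsilon> \<le> \<delta> j" if "j < 6" for j
      unfolding \<epsilon>_def using that by (intro Min_le) auto
  qed
  show ?thesis
  proof
    fix u u' assume u: "u \<in> ball z \<epsilon>" "u' \<in> ball z \<epsilon>" "orbit_rel u u'"
    then obtain j0 l where l: "l \<in> eisenstein" "u' = \<zeta> ^ j0 * u + l" by (auto simp: orbit_rel_def)
    define j where "j = j0 mod 6"
    have u': "u' = \<zeta> ^ j * u + l" using l by (simp add: j_def zeta_power_mod[symmetric])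
    have "j < 6" by (simp add: j_def)
    have "\<zeta> ^ j * z - z + l = (u' - z) - \<zeta> ^ j * (u - z)"
      by (simp add: u' algebra_simps)
    then have "norm (\<zeta> ^ j * z - z + l) \<le> norm (u' - z) + norm (\<zeta> ^ j * (u - z))"
      by (metis norm_triangle_ineq4)
    also have "\<dots> < \<epsilon> + \<epsilon>"
      using u by (simp add: norm_mult norm_power dist_norm norm_minus_commute)
    also have "\<dots> \<le> 2 * \<delta> j" using \<epsilon>(2)[OF \<open>j < 6\<close>] by simp
    finally have 0: "\<zeta> ^ j * z - z + l = 0" using \<delta>(2)[OF l(1)] by blast
    then have "\<zeta> ^ j * z - z = - l" by (simp add: eq_neg_iff_add_eq_0)
    then have "\<zeta> ^ j * z - z \<in> eisenstein" using l(1) by simp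
    then obtain i where "\<zeta> ^ j = rot z ^ i" by (rule stabilizer_generated)
    moreover have "u' = z + \<zeta> ^ j * (u - z)"
      using 0 by (simp add: u' algebra_simps)
    ultimately show "\<exists>i. u' = z + rot z ^ i * (u - z)" by auto
  qed (rule \<epsilon>)
qed

lemma open_orbit_of_open:
  assumes "open U"
  shows "open {w. \<exists>u\<in>U. orbit_rel u w}"
proof -
  have "{w. \<exists>u\<in>U. orbit_rel u w} = (\<Union>j. \<Union>l\<in>eisenstein. (\<lambda>w. \<zeta> ^ (5 * j) * (w - l)) -` U)"
    (is "?A = ?B")
  proof (intro equalityI subsetI)
    have inv: "\<zeta> ^ (5 * j) * (\<zeta> ^ j * u) = u" for j u
    proof -
      have "\<zeta> ^ (5 * j) * \<zeta> ^ j = (\<zeta> ^ 6) ^ j" by (simp add: power_add[symmetric] power_mult[symmetric])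
      then show ?thesis by (simp add: mult.assoc[symmetric] zeta_pow6)
    qed
    fix w
    show "w \<in> ?B" if "w \<in> ?A"
    proof -
      obtain u j l where "u \<in> U" "l \<in> eisenstein" "w = \<zeta> ^ j * u + l"
        using \<open>w \<in> ?A\<close> by (auto simp: orbit_rel_def)
      then have "\<zeta> ^ (5 * j) * (w - l) = u" using inv[of j u] by simp
      then show ?thesis using \<open>l \<in> eisenstein\<close> \<open>u \<in> U\<close> by (intro UN_I[of j] UN_I[of l]) simp_all
    qed
    show "w \<in> ?A" if "w \<in> ?B"
    proof -
      obtain j l where *: "l \<in> eisenstein" "\<zeta> ^ (5 * j) * (w - l) \<in> U"
        using \<open>w \<in> ?B\<close> by auto
      have "\<zeta> ^ j * (\<zeta> ^ (5 * j) * (w - l)) + l = w"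
        using inv[of j "w - l"] by (simp only: mult.left_commute[of "\<zeta> ^ j"]) simp
      then have "orbit_rel (\<zeta> ^ (5 * j) * (w - l)) w"
        using orbit_relI[OF *(1), of "\<zeta> ^ (5 * j) * (w - l)" j] by simp
      then show ?thesis using * by blast
    qed
  qed
  moreover have "open ((\<lambda>w. \<zeta> ^ (5 * j) * (w - l)) -` U)" for j l
    using assms by (intro open_vimage continuous_intros)
  ultimately show ?thesis by (simp add: open_UN)
qed

lemma orbit_rel_unit_ball: obtains k where "k \<in> cball 0 1" "orbit_rel w k"
proof -
  obtain l where l: "l \<in> eisenstein" "norm (w - l) < 1" by (rule nearest_eisenstein)
  then show ?thesis
    using that[of "w - l"] orbit_rel_translate[of "- l" w] by simp
qed

section \<open>The orbifold covering of the sphere by the plane\<close>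

locale orbifold_map =
  fixes b :: "real^3" and \<sigma> :: "complex \<Rightarrow> real^3" and \<sigma>' :: "real^3 \<Rightarrow> complex"
  assumes b: "b \<in> two_sphere" and hom: "homeomorphism UNIV (two_sphere - {b}) \<sigma> \<sigma>'"
begin

text \<open>The lattice points, where the sum has its poles, go to the point at infinity b; the
  finite value of \<open>eisenstein_sum\<close> there is discarded.\<close>

definition F :: "complex \<Rightarrow> real^3" where
  "F z = (if z \<in> eisenstein then b else \<sigma> (eisenstein_sum z))"

lemmas sig = sigma_simps[OF b hom]

lemma F_in: "F z \<in> two_sphere"
  using b sig(2) unfolding F_def by (cases "z \<in> eisenstein") auto

lemma F_eq_b_iff: "F z = b \<longleftrightarrow> z \<in> eisenstein"
  using sig(3) by (simp add: F_def)

lemma F_orbit_rel: "orbit_rel z w \<Longrightarrow> F w = F z"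
  using orbit_rel_eisenstein_mult[of z w 1] eisenstein_sum_orbit_rel[of z w] by (simp add: F_def)

text \<open>A witness for \<open>has_local_degree\<close> whose source chart is holomorphic: the
  derivative of h at z identifies how h responds to rotations.\<close>

definition local_form ::
  "complex \<Rightarrow> nat \<Rightarrow> real \<Rightarrow> (complex \<Rightarrow> complex) \<Rightarrow> (real^3) set \<Rightarrow> (real^3 \<Rightarrow> complex) \<Rightarrow> bool" where
  "local_form z m r h V \<psi> \<longleftrightarrow> m \<ge> 1 \<and> r > 0 \<and> h holomorphic_on ball z r \<and> inj_on h (ball z r) \<and> h z = 0 \<and>
     surface_chart two_sphere V \<psi> \<and> F ` ball z r \<subseteq> V \<and> (\<forall>u\<in>ball z r. \<psi> (F u) = h u ^ m)"

lemma local_formD: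
  assumes "local_form z m r h V \<psi>"
  shows "m \<ge> 1" "r > 0" "h holomorphic_on ball z r" "inj_on h (ball z r)" "h z = 0"
    "surface_chart two_sphere V \<psi>" "F ` ball z r \<subseteq> V" "\<And>u. u \<in> ball z r \<Longrightarrow> \<psi> (F u) = h u ^ m"
  using assms unfolding local_form_def by blast+

lemma local_form_orbit_rel:
  assumes "local_form z m r h V \<psi>" "orbit_rel z w"
  obtains h' where "local_form w m r h' V \<psi>"
proof -
  note lf = local_formD[OF assms(1)]
  obtain j l where l: "l \<in> eisenstein" "z = \<zeta> ^ j * w + l"
    using orbit_rel_sym[OF assms(2)] by (auto simp: orbit_rel_def)
  define A where "A u = \<zeta> ^ j * u + l" for u
  have Aball: "A u \<in> ball z r \<longleftrightarrow> u \<in> ball w r" for u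
  proof -
    have "z - A u = \<zeta> ^ j * (w - u)" by (simp add: A_def l(2) algebra_simps)
    then show ?thesis by (simp add: dist_norm norm_mult norm_power)
  qed
  have FA: "F (A u) = F u" for u
    using F_orbit_rel orbit_relI[OF l(1), of u j] by (simp add: A_def)
  have "A holomorphic_on ball w r" unfolding A_def[abs_def] by (intro holomorphic_intros)
  then have "(h \<circ> A) holomorphic_on ball w r"
    by (rule holomorphic_on_compose_gen[OF _ lf(3)]) (use Aball in blast)
  then have "(\<lambda>u. h (A u)) holomorphic_on ball w r" by (simp only: o_def)
  moreover have "inj_on (\<lambda>u. h (A u)) (ball w r)"
  proof (rule inj_onI)
    fix u v assume "u \<in> ball w r" "v \<in> ball w r" "h (A u) = h (A v)"
    then have "A u = A v" using lf(4) Aball by (meson inj_onD)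
    then show "u = v" by (simp add: A_def)
  qed
  moreover have "A w = z" by (simp add: A_def l(2))
  moreover have "F u \<in> V \<and> \<psi> (F u) = h (A u) ^ m" if "u \<in> ball w r" for u
    using lf(7,8) Aball[of u] that FA[of u] by (metis image_subset_iff)
  ultimately have "local_form w m r (\<lambda>u. h (A u)) V \<psi>"
    unfolding local_form_def using lf(1,2,5,6) by auto
  then show ?thesis using that by blast
qed

lemma local_form_exists_0: "\<exists>r h V \<psi>. local_form 0 6 r h V \<psi>"
proof -
  obtain r h where r: "r > 0" "r \<le> 1 / 2" "h holomorphic_on ball 0 r" "inj_on h (ball 0 r)" "h 0 = 0"
    and eisenstein_sum: "\<And>z. z \<in> ball 0 r \<Longrightarrow> z \<noteq> 0 \<Longrightarrow> eisenstein_sum z \<noteq> 0 \<and> inverse (eisenstein_sum z) = h z ^ 6"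
    using eisenstein_sum_pole_normal_form by metis
  let ?\<psi> = "chart_at_puncture b \<sigma>'" and ?V = "two_sphere - {\<sigma> 0}"
  have notE: "z \<notin> eisenstein" if "z \<in> ball 0 r" "z \<noteq> 0" for z
    using that r(2) eisenstein_norm_ge_1[of z] by auto
  have "F u \<in> ?V \<and> ?\<psi> (F u) = h u ^ 6" if u: "u \<in> ball 0 r" for u
  proof (cases "u = 0")
    case True
    then show ?thesis using b sig(3)[of 0] r(5) by (auto simp: F_def chart_at_puncture_def[OF b hom])
  next
    case False
    have Fu: "F u = \<sigma> (eisenstein_sum u)" using notE[OF u False] by (simp add: F_def)
    have "\<sigma> (eisenstein_sum u) \<noteq> \<sigma> 0" using eisenstein_sum[OF u False] sig(1) by metis
    then show ?thesis
      using eisenstein_sum[OF u False] sig(1,2,3)[of "eisenstein_sum u"] by (simp add: Fu chart_at_puncture_def[OF b hom])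
  qed
  then have "local_form 0 6 r h ?V ?\<psi>"
    unfolding local_form_def using r surface_chart_at_puncture[OF b hom] by auto
  then show ?thesis by blast
qed

text \<open>Off the lattice m is so far only some order of a zero; that it is \<open>stab z\<close>
  follows later from regularity. At lattice points the pole order is already known to be 6.\<close>

lemma local_form_exists: "\<exists>m r h V \<psi>. local_form z m r h V \<psi> \<and> (z \<in> eisenstein \<longrightarrow> m = 6)"
proof (cases "z \<in> eisenstein")
  case True
  obtain r h V \<psi> where "local_form 0 6 r h V \<psi>" using local_form_exists_0 by blast
  then obtain h' where "local_form z 6 r h' V \<psi>"
    using local_form_orbit_rel True orbit_rel_0 by metis
  then show ?thesis by blast
next
  case False
  obtain n r h where n: "n \<ge> 1" "r > 0" "ball z r \<subseteq> - eisenstein" "h holomorphic_on ball z r" "inj_on h (ball z r)"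
    "h z = 0" and eisenstein_sum: "\<And>w. w \<in> ball z r \<Longrightarrow> eisenstein_sum w - eisenstein_sum z = h w ^ n"
    using holomorphic_power_normal_form[OF eisenstein_sum_holomorphic _ connected_Compl_eisenstein _ eisenstein_sum_not_constant, of z]
      False closed_eisenstein by (metis ComplI open_Compl)
  let ?\<psi> = "\<lambda>s. \<sigma>' s - eisenstein_sum z" and ?V = "two_sphere - {b}"
  have "F u \<in> ?V \<and> ?\<psi> (F u) = h u ^ n" if u: "u \<in> ball z r" for u
  proof -
    have "F u = \<sigma> (eisenstein_sum u)" using n(3) u by (auto simp: F_def)
    then show ?thesis using sig(1,2,3)[of "eisenstein_sum u"] eisenstein_sum[OF u] by simp
  qed
  then have "local_form z n r h ?V ?\<psi>"
    unfolding local_form_def using n surface_chart_translate[OF surface_chart_finite[OF b hom]] by auto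
  then show ?thesis using False by blast
qed

lemma local_form_shrink:
  assumes "local_form z m r h V \<psi>" "0 < r'" "r' \<le> r"
  shows "local_form z m r' h V \<psi>"
proof -
  have sub: "ball z r' \<subseteq> ball z r" using assms(3) by (rule subset_ball)
  note lf = local_formD[OF assms(1)]
  show ?thesis
    unfolding local_form_def
  proof (intro conjI ballI)
    show "h holomorphic_on ball z r'" using lf(3) sub holomorphic_on_subset by blast
    show "inj_on h (ball z r')" using lf(4) sub inj_on_subset by blast
    show "F ` ball z r' \<subseteq> V" using lf(7) sub by blast
    show "\<psi> (F u) = h u ^ m" if "u \<in> ball z r'" for u using lf(8) sub that by blast
  qed (use assms(2) lf in simp_all)
qed

lemma local_form_has_local_degree:
  assumes "local_form z m r h V \<psi>"
  shows "has_local_degree UNIV two_sphere F z m"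
proof -
  note lf = local_formD[OF assms]
  have "surface_chart UNIV (ball z r) h"
    using lf(3,4) by (intro surface_chart_injective_continuous holomorphic_on_imp_continuous_on) auto
  moreover have "\<psi> (F z) = 0" using lf(8)[of z] lf(1,2,5) by simp
  ultimately show ?thesis
    unfolding has_local_degree_def using lf
    by (intro conjI exI[of _ "ball z r"] exI[of _ h] exI[of _ V] exI[of _ \<psi>]) auto
qed

lemma F_has_local_degree: "\<exists>m. has_local_degree UNIV two_sphere F z m"
  using local_form_exists local_form_has_local_degree by blast

lemma F_continuous: "continuous_on UNIV F"
proof -
  have "isCont F z" for z
  proof -
    obtain m r h V \<psi> where "local_form z m r h V \<psi>" using local_form_exists by blast
    note lf = local_formD[OF this]
    have "continuous_on (ball z r) (\<lambda>u. h u ^ m)"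
      using lf(3) by (intro continuous_intros holomorphic_on_imp_continuous_on)
    moreover have "(\<lambda>u. h u ^ m) ` ball z r \<subseteq> \<psi> ` V"
    proof
      fix x assume "x \<in> (\<lambda>u. h u ^ m) ` ball z r"
      then obtain u where u: "u \<in> ball z r" "x = h u ^ m" by (rule imageE)
      then have "x = \<psi> (F u)" using lf(8) by simp
      moreover have "F u \<in> V" using lf(7) u(1) by blast
      ultimately show "x \<in> \<psi> ` V" by blast
    qed
    ultimately have "continuous_on (ball z r) (\<lambda>u. inv_into V \<psi> (h u ^ m))"
      using continuous_on_compose2[OF surface_chart_continuous_inv[OF lf(6)]] by blast
    moreover have "inv_into V \<psi> (h u ^ m) = F u" if "u \<in> ball z r" for u
    proof -
      have "F u \<in> V" using lf(7) that by blast
      then show ?thesis using lf(8)[OF that] inv_into_f_f[OF surface_chart_inj[OF lf(6)]] by metis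
    qed
    ultimately have "continuous_on (ball z r) F"
      by (rule continuous_on_eq)
    then show ?thesis using lf(2) by (simp add: continuous_on_eq_continuous_at)
  qed
  then show ?thesis by (simp add: continuous_at_imp_continuous_on)
qed

lemma F_open_map:
  assumes "open W"
  shows "openin (top_of_set two_sphere) (F ` W)"
proof (rule has_local_degree_imp_open_map)
  show "openin (top_of_set UNIV) W" using assms by simp
qed (rule F_has_local_degree)

text \<open>h after the rotation and h have equal m-th powers, so their quotient is continuous with
  values in the m-th roots of unity on a connected punctured disc, hence constant. Derivatives at z
  identify the constant.\<close>

lemma local_form_equivariant:
  assumes lf: "local_form z m r h V \<psi>" and \<eta>: "\<zeta> ^ j * z - z \<in> eisenstein" and u: "u \<in> ball z r"
  shows "h (z + \<zeta> ^ j * (u - z)) = \<zeta> ^ j * h u"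
proof -
  note lf = local_formD[OF lf]
  define \<rho> where "\<rho> u = z + \<zeta> ^ j * (u - z)" for u
  have \<rho>ball: "\<rho> u \<in> ball z r" if "u \<in> ball z r" for u
    using that by (simp add: \<rho>_def dist_norm norm_mult norm_power norm_minus_commute)
  have F\<rho>: "F (\<rho> u) = F u" for u
    using F_orbit_rel[OF orbit_rel_rotation[OF \<eta>]] by (simp add: \<rho>_def)
  have hpow: "h (\<rho> u) ^ m = h u ^ m" if "u \<in> ball z r" for u
    using lf(8)[OF that] lf(8)[OF \<rho>ball[OF that]] F\<rho> by simp
  have hnz: "h u \<noteq> 0" if "u \<in> ball z r - {z}" for u
    using that lf(2,4,5) by (metis Diff_iff centre_in_ball inj_onD singletonI)
  have "\<rho> holomorphic_on ball z r" unfolding \<rho>_def[abs_def] by (intro holomorphic_intros)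
  then have "(h \<circ> \<rho>) holomorphic_on ball z r"
    by (rule holomorphic_on_compose_gen[OF _ lf(3)]) (use \<rho>ball in blast)
  then have hol\<rho>: "(\<lambda>u. h (\<rho> u)) holomorphic_on ball z r" by (simp only: o_def)
  have "continuous_on (ball z r - {z}) (\<lambda>u. h (\<rho> u) / h u)"
    using hnz lf(3) hol\<rho>
    by (intro continuous_intros continuous_on_subset[OF holomorphic_on_imp_continuous_on]) auto
  moreover have "connected (ball z r - {z})"
    by (intro connected_punctured_ball) simp
  moreover have "finite ((\<lambda>u. h (\<rho> u) / h u) ` (ball z r - {z}))"
  proof (rule finite_subset)
    show "(\<lambda>u. h (\<rho> u) / h u) ` (ball z r - {z}) \<subseteq> {w. w ^ m = 1}"
      using hpow hnz by (auto simp: power_divide)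
    show "finite {w::complex. w ^ m = 1}" using lf(1) by (intro finite_nth_roots) auto
  qed
  ultimately have "(\<lambda>u. h (\<rho> u) / h u) constant_on (ball z r - {z})"
    using continuous_finite_range_constant by blast
  then obtain c where c: "\<And>u. u \<in> ball z r - {z} \<Longrightarrow> h (\<rho> u) / h u = c"
    by (auto simp: constant_on_def)
  have hc: "h (\<rho> u) = c * h u" if "u \<in> ball z r" for u
  proof (cases "u = z")
    case True
    then show ?thesis using lf(5) by (simp add: \<rho>_def)
  next
    case False
    then show ?thesis using c[of u] hnz[of u] that by (simp add: divide_eq_eq)
  qed
  have z: "z \<in> ball z r" using lf(2) by simp
  have dh: "(h has_field_derivative deriv h z) (at z)"
    using holomorphic_derivI[OF lf(3) open_ball z] by simp
  have dh0: "deriv h z \<noteq> 0"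
    by (rule holomorphic_injective_imp_regular[OF lf(3) open_ball lf(4) z])
  have "\<rho> z = z" by (simp add: \<rho>_def)
  then have d1: "(h has_field_derivative deriv h z) (at (\<rho> z))" using dh by (simp only:)
  have d2: "(\<rho> has_field_derivative \<zeta> ^ j) (at z)"
    unfolding \<rho>_def[abs_def] by (auto intro!: derivative_eq_intros)
  have "((\<lambda>u. h (\<rho> u)) has_field_derivative deriv h z * \<zeta> ^ j) (at z)"
    by (rule DERIV_chain2[OF d1 d2])
  moreover have "((\<lambda>u. h (\<rho> u)) has_field_derivative c * deriv h z) (at z)"
    by (rule has_field_derivative_transform_within_open[OF DERIV_cmult[OF dh] open_ball z]) (simp add: hc)
  ultimately have "deriv h z * \<zeta> ^ j = c * deriv h z" by (rule DERIV_unique)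
  then have "c = \<zeta> ^ j" using dh0 by simp
  then show ?thesis using hc[OF u] by (simp add: \<rho>_def)
qed

text \<open>Rotating about z by \<open>rot z\<close> leaves F unchanged and multiplies h by
  \<open>rot z\<close>, so \<open>rot z ^ m = 1\<close>.\<close>

lemma local_form_stab_dvd:
  assumes "local_form z m r h V \<psi>"
  shows "stab z dvd m"
proof -
  note lf = local_formD[OF assms]
  define u where "u = z + of_real (r / 2)"
  have u: "u \<in> ball z r" "u \<noteq> z" using lf(2) by (auto simp: u_def dist_norm)
  then have "h u \<noteq> 0" using lf(2,4,5) by (metis centre_in_ball inj_onD)
  have \<eta>: "\<zeta> ^ (6 div stab z) * z - z \<in> eisenstein" using rot_eisenstein by (simp add: rot_def)
  have "h (z + rot z * (u - z)) = rot z * h u"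
    using local_form_equivariant[OF assms \<eta> u(1)] by (simp add: rot_def)
  moreover have "z + rot z * (u - z) \<in> ball z r"
    using u(1) by (simp add: rot_def dist_norm norm_mult norm_power norm_minus_commute)
  moreover have "F (z + rot z * (u - z)) = F u"
    using F_orbit_rel orbit_rel_rot[of u z 1] by simp
  ultimately have "(rot z * h u) ^ m = h u ^ m"
    using lf(8) u(1) by metis
  then have "rot z ^ m = 1" using \<open>h u \<noteq> 0\<close> by (simp add: power_mult_distrib)
  then show ?thesis by (simp add: rot_power_eq_1_iff)
qed

text \<open>When the exponent is \<open>stab z\<close>, the quotient of the values of h is a power
  of \<open>rot z\<close>, and equivariance turns this into a rotation about z.\<close>

lemma local_form_stab_injective:
  assumes "local_form z (stab z) r h V \<psi>" "u \<in> ball z r" "u' \<in> ball z r" "F u = F u'"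
  obtains i where "u' = z + rot z ^ i * (u - z)"
proof (cases "h u = 0")
  case True
  note lf = local_formD[OF assms(1)]
  have "h u' ^ stab z = h u ^ stab z" using lf(8) assms by metis
  moreover have "h u ^ stab z = 0" using True stab_pos[of z] by simp
  ultimately have "h u' = 0" by simp
  then have "u = z" "u' = z" using True lf(2,4,5) assms(2,3) by (metis centre_in_ball inj_onD)+
  then show ?thesis using that[of 0] by simp
next
  case False
  note lf = local_formD[OF assms(1)]
  have "h u' ^ stab z = h u ^ stab z" using lf(8) assms by metis
  then have "(h u' / h u) ^ stab z = 1" using False by (simp add: power_divide)
  then obtain i where i: "h u' / h u = rot z ^ i" by (rule stab_root_of_unity)
  then have "h u' = rot z ^ i * h u" using False by (simp add: divide_eq_eq)
  also have "\<dots> = h (z + rot z ^ i * (u - z))"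
    using local_form_equivariant[OF assms(1), of "6 div stab z * i" u] rot_power_eisenstein[of z i] assms(2)
    by (simp add: rot_power_zeta)
  finally have "u' = z + rot z ^ i * (u - z)"
    using lf(4) assms(2,3) by (elim inj_onD) (auto simp: rot_power_zeta dist_norm norm_mult norm_power norm_minus_commute)
  then show ?thesis by (rule that)
qed

end

section \<open>The fibres of the orbifold map are orbits\<close>

context orbifold_map
begin

text \<open>The set of regular values is open and closed and contains \<open>b\<close>, hence is the whole sphere. This
  replaces counting zeros of an elliptic function by the argument principle.\<close>

definition regular_value :: "real^3 \<Rightarrow> bool" where
  "regular_value v \<longleftrightarrow> (\<exists>z. F z = v) \<and> (\<forall>z w. F z = v \<longrightarrow> F w = v \<longrightarrow> orbit_rel z w) \<and>
     (\<forall>z. F z = v \<longrightarrow> has_local_degree UNIV two_sphere F z (stab z))"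

lemma regular_value_b: "regular_value b"
  unfolding regular_value_def F_eq_b_iff
proof (intro conjI allI impI)
  show "\<exists>z. z \<in> eisenstein" using eisenstein_0 by blast
  show "orbit_rel z w" if "z \<in> eisenstein" "w \<in> eisenstein" for z w
    using that orbit_rel_0 orbit_rel_sym orbit_rel_trans by blast
  show "has_local_degree UNIV two_sphere F z (stab z)" if z: "z \<in> eisenstein" for z
  proof -
    obtain m r h V \<psi> where "local_form z m r h V \<psi>" "m = 6" using local_form_exists z by blast
    then show ?thesis using local_form_has_local_degree stab_eqI(1)[OF z] by metis
  qed
qed

lemma compact_F_image_closed_invariant:
  assumes "closed C"
  shows "compact (F ` (cball 0 1 \<inter> C))"
  using assms F_continuous
  by (intro compact_continuous_image continuous_on_subset[OF F_continuous]) (auto simp: compact_Int_closed)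

lemma openin_sphere_diff_compact:
  assumes "compact C"
  shows "openin (top_of_set two_sphere) (two_sphere - C)"
  using assms by (simp add: Diff_eq openin_open_Int compact_imp_closed open_Compl)

text \<open>Each way of failing persists nearby: a value outside the compact image is surrounded by
  such values; inequivalent preimages have inequivalent neighbourhoods with open images; and a local
  degree above \<open>stab z\<close> yields more nearby preimages than one orbit has near z.\<close>

lemma nonregular_openin:
  assumes v: "v \<in> two_sphere" "\<not> regular_value v"
  shows "\<exists>N. openin (top_of_set two_sphere) N \<and> v \<in> N \<and> (\<forall>y\<in>N. \<not> regular_value y)"
proof -
  consider (none) "\<not> (\<exists>z. F z = v)" | (two) z w where "F z = v" "F w = v" "\<not> orbit_rel z w"
    | (deg) z where "F z = v" "\<not> has_local_degree UNIV two_sphere F z (stab z)"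
    using v(2) unfolding regular_value_def by blast
  then show ?thesis
  proof cases
    case none
    have "F z \<in> F ` (cball 0 1 \<inter> UNIV)" for z
    proof -
      obtain k where k: "k \<in> cball 0 1" "orbit_rel z k" by (rule orbit_rel_unit_ball)
      then show ?thesis using F_orbit_rel[OF k(2)] by (intro image_eqI[of _ _ k]) auto
    qed
    then show ?thesis
      using openin_sphere_diff_compact[OF compact_F_image_closed_invariant[OF closed_UNIV]] none v(1)
      by (intro exI[of _ "two_sphere - F ` (cball 0 1 \<inter> UNIV)"]) (auto simp: regular_value_def)
  next
    case two
    obtain r where r: "r > 0" "\<And>u v. u \<in> ball z r \<Longrightarrow> v \<in> ball w r \<Longrightarrow> \<not> orbit_rel u v"
      using not_orbit_rel_nhds[OF two(3)] by blast
    have "\<not> regular_value y" if y: "y \<in> F ` ball z r \<inter> F ` ball w r" for y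
    proof -
      obtain u where u: "u \<in> ball z r" "y = F u" using y by (elim IntE imageE)
      obtain u' where u': "u' \<in> ball w r" "y = F u'" using y by (elim IntE imageE)
      show ?thesis using r(2)[OF u(1) u'(1)] u(2) u'(2) unfolding regular_value_def by metis
    qed
    moreover have "v \<in> F ` ball z r \<inter> F ` ball w r"
      using two r(1) by (metis IntI centre_in_ball imageI)
    moreover have "openin (top_of_set two_sphere) (F ` ball z r \<inter> F ` ball w r)"
      by (intro openin_Int F_open_map) auto
    ultimately show ?thesis by blast
  next
    case deg
    obtain m r h V \<psi> where lf: "local_form z m r h V \<psi>" using local_form_exists by blast
    have degm: "has_local_degree UNIV two_sphere F z m" by (rule local_form_has_local_degree[OF lf])
    have "stab z dvd m" by (rule local_form_stab_dvd[OF lf])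
    moreover have "m \<noteq> stab z" using degm deg(2) by blast
    moreover have "m \<ge> 1" using lf local_formD by blast
    ultimately have less: "stab z < m" using dvd_imp_le[of "stab z" m] by linarith
    obtain \<delta> where \<delta>: "\<delta> > 0"
      "\<And>u u'. u \<in> ball z \<delta> \<Longrightarrow> u' \<in> ball z \<delta> \<Longrightarrow> orbit_rel u u' \<Longrightarrow> \<exists>i. u' = z + rot z ^ i * (u - z)"
      using orbit_rel_near[of z] by metis
    have op: "openin (top_of_set UNIV) (ball z \<delta>)" "z \<in> ball z \<delta>" using \<delta>(1) by auto
    obtain N where N: "openin (top_of_set two_sphere) N" "F z \<in> N"
      "\<And>y. y \<in> N \<Longrightarrow> y \<noteq> F z \<Longrightarrow> \<exists>X\<subseteq>ball z \<delta>. finite X \<and> card X = m \<and> (\<forall>x'\<in>X. F x' = y)"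
      using has_local_degree_nhd[OF degm op] by metis
    have "\<not> regular_value y" if y: "y \<in> N" for y
    proof (cases "y = F z")
      case True
      then show ?thesis using deg v(2) by simp
    next
      case False
      obtain X where X: "X \<subseteq> ball z \<delta>" "card X = m" "\<And>x. x \<in> X \<Longrightarrow> F x = y"
        using N(3)[OF y False] by blast
      show ?thesis
      proof
        assume reg: "regular_value y"
        have "X \<noteq> {}" using X(2) less by auto
        then obtain x0 where x0: "x0 \<in> X" by blast
        have "X \<subseteq> (\<lambda>i. z + rot z ^ i * (x0 - z)) ` {..<stab z}"
        proof
          fix x assume x: "x \<in> X"
          then have "orbit_rel x0 x" using reg X(3) x0 unfolding regular_value_def by blast
          then obtain i where i: "x = z + rot z ^ i * (x0 - z)" using \<delta>(2) X(1) x x0 by blast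
          have "rot z ^ i = rot z ^ (stab z * (i div stab z) + i mod stab z)" by simp
          also have "\<dots> = rot z ^ (i mod stab z)"
            unfolding power_add power_mult using rot_power_eq_1_iff[of z "stab z"] by simp
          finally show "x \<in> (\<lambda>i. z + rot z ^ i * (x0 - z)) ` {..<stab z}"
            using i stab_pos[of z] by (intro image_eqI[of _ _ "i mod stab z"]) auto
        qed
        then have "card X \<le> card {..<stab z}"
          using card_image_le[of "{..<stab z}"] by (meson card_mono finite_imageI finite_lessThan le_trans)
        then show False using X(2) less by simp
      qed
    qed
    then show ?thesis using N deg(1) by blast
  qed
qed

text \<open>Values near v are taken only on the orbits of a disc around z, since the rest of the
  unit disc has compact image missing v. On that disc F identifies only rotations about z, and away
  from z itself it is locally injective.\<close>

lemma regular_openin: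
  assumes v: "regular_value v"
  shows "\<exists>N. openin (top_of_set two_sphere) N \<and> v \<in> N \<and> (\<forall>y\<in>N. regular_value y)"
proof -
  obtain z where z: "F z = v" "has_local_degree UNIV two_sphere F z (stab z)"
    and orb: "\<And>w. F w = v \<Longrightarrow> orbit_rel z w"
    using v unfolding regular_value_def by blast
  obtain m r h V \<psi> where lf: "local_form z m r h V \<psi>" using local_form_exists by blast
  have "m = stab z"
    using has_local_degree_unique[OF local_form_has_local_degree[OF lf] z(2)] .
  then have lf: "local_form z (stab z) r h V \<psi>" using lf by simp
  have r: "r > 0" using local_formD(2)[OF lf] .
  define GU where "GU = {w. \<exists>u\<in>ball z r. orbit_rel u w}"
  have "open GU" unfolding GU_def by (rule open_orbit_of_open) simp
  define C where "C = F ` (cball 0 1 \<inter> - GU)"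
  have "compact C"
    unfolding C_def using \<open>open GU\<close> by (intro compact_F_image_closed_invariant) auto
  have inC: "F w \<in> C" if w: "w \<notin> GU" for w
  proof -
    obtain k where k: "k \<in> cball 0 1" "orbit_rel w k" by (rule orbit_rel_unit_ball)
    have "k \<notin> GU" using w k(2) orbit_rel_sym orbit_rel_trans unfolding GU_def by blast
    then show ?thesis using F_orbit_rel[OF k(2)] k(1) unfolding C_def by (metis ComplI IntI imageI)
  qed
  define N where "N = F ` ball z r \<inter> (two_sphere - C)"
  have "openin (top_of_set two_sphere) N"
    unfolding N_def by (intro openin_Int F_open_map openin_sphere_diff_compact \<open>compact C\<close>) auto
  moreover have "v \<in> N"
  proof -
    have "v \<notin> C"
    proof
      assume "v \<in> C"
      then obtain k where "k \<notin> GU" "F k = v" by (auto simp: C_def)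
      then show False using orb r unfolding GU_def by (metis (mono_tags, lifting) centre_in_ball mem_Collect_eq)
    qed
    then show ?thesis using z r F_in by (auto simp: N_def)
  qed
  moreover have "regular_value y" if y: "y \<in> N" for y
    unfolding regular_value_def
  proof (intro conjI allI impI)
    show "\<exists>z. F z = y" using y by (auto simp: N_def)
    have GU: "\<exists>u\<in>ball z r. orbit_rel u w \<and> F u = y" if w: "F w = y" for w
    proof -
      have "w \<in> GU" using inC[of w] y w by (auto simp: N_def)
      then obtain u where u: "u \<in> ball z r" "orbit_rel u w" by (auto simp: GU_def)
      then show ?thesis using F_orbit_rel[OF u(2)] w by auto
    qed
    show "orbit_rel w1 w2" if "F w1 = y" "F w2 = y" for w1 w2
    proof -
      obtain u1 u2 where u: "u1 \<in> ball z r" "orbit_rel u1 w1" "F u1 = y"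
        "u2 \<in> ball z r" "orbit_rel u2 w2" "F u2 = y"
        using GU[OF \<open>F w1 = y\<close>] GU[OF \<open>F w2 = y\<close>] by metis
      obtain i where "u2 = z + rot z ^ i * (u1 - z)"
        using local_form_stab_injective[OF lf u(1,4)] u(3,6) by metis
      then have "orbit_rel u1 u2" using orbit_rel_rot by simp
      then show ?thesis using u orbit_rel_sym orbit_rel_trans by blast
    qed
    show "has_local_degree UNIV two_sphere F w (stab w)" if w: "F w = y" for w
    proof -
      obtain u where u: "u \<in> ball z r" "orbit_rel u w" "F u = y" using GU[OF w] by blast
      show ?thesis
      proof (cases "u = z")
        case True
        then show ?thesis using v w u(3) z(1) unfolding regular_value_def by auto
      next
        case False
        obtain m' r' h' V' \<psi>' where lf': "local_form u m' r' h' V' \<psi>'" using local_form_exists by blast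
        \<comment> \<open>Within half the distance to z no nontrivial rotation about z can identify
          two points near u, because \<open>rot z ^ i - 1\<close>, if nonzero, has norm at least
          1.\<close>
        define \<epsilon> where "\<epsilon> = min (norm (u - z) / 2) (r - dist z u)"
        have \<epsilon>: "\<epsilon> > 0" using False u(1) by (simp add: \<epsilon>_def)
        have sub: "ball u \<epsilon> \<subseteq> ball z r"
        proof
          fix x assume "x \<in> ball u \<epsilon>"
          then have "dist u x < r - dist z u" by (simp add: \<epsilon>_def)
          then show "x \<in> ball z r" using dist_triangle[of z x u] by simp
        qed
        have inj: "u1 = u2" if u12: "u1 \<in> ball u \<epsilon>" "u2 \<in> ball u \<epsilon>" "F u1 = F u2" for u1 u2
        proof -
          have in_ball: "u1 \<in> ball z r" "u2 \<in> ball z r" using sub u12 by blast+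
          obtain i where i: "u2 = z + rot z ^ i * (u1 - z)"
            by (rule local_form_stab_injective[OF lf in_ball u12(3)])
          have "(rot z ^ i - 1) * (u - z) = (u2 - u) - rot z ^ i * (u1 - u)"
            by (simp add: i algebra_simps)
          then have "norm (rot z ^ i - 1) * norm (u - z) \<le> norm (u2 - u) + norm (rot z ^ i * (u1 - u))"
            by (metis norm_mult norm_triangle_ineq4)
          also have "\<dots> < \<epsilon> + \<epsilon>"
            using u12 by (simp add: norm_mult rot_power_zeta norm_power dist_norm norm_minus_commute)
          also have "\<dots> \<le> norm (u - z)"
            unfolding \<epsilon>_def using min.cobounded1[of "norm (u - z) / 2" "r - dist z u"] by linarith
          finally have "norm (rot z ^ i - 1) < 1" using False by simp
          moreover have "rot z ^ i - 1 \<in> eisenstein" by (simp add: rot_power_zeta)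
          ultimately have "rot z ^ i = 1" using eisenstein_inter_unit_interval by fastforce
          then show ?thesis using i by simp
        qed
        have op: "openin (top_of_set UNIV) (ball u \<epsilon>)" "u \<in> ball u \<epsilon>" using \<epsilon> by auto
        obtain N' where N': "\<exists>y\<in>N'. y \<noteq> F u"
          "\<And>y. y \<in> N' \<Longrightarrow> y \<noteq> F u \<Longrightarrow> \<exists>X\<subseteq>ball u \<epsilon>. finite X \<and> card X = m' \<and> (\<forall>x'\<in>X. F x' = y)"
          using has_local_degree_nhd[OF local_form_has_local_degree[OF lf'] op] by metis
        then obtain X y' where X: "X \<subseteq> ball u \<epsilon>" "finite X" "card X = m'" "\<And>x. x \<in> X \<Longrightarrow> F x = y'"
          by metis
        have "card X \<le> 1"
          unfolding One_nat_def card_le_Suc0_iff_eq[OF X(2)] using inj X by (metis subsetD)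
        moreover have "m' \<ge> 1" using local_formD(1)[OF lf'] .
        ultimately have "m' = 1" using X(3) by simp
        then have "stab u = 1" using local_form_stab_dvd[OF lf'] by simp
        then have "stab w = 1" using stab_orbit_rel[OF u(2)] by simp
        obtain h'' where "local_form w m' r' h'' V' \<psi>'"
          using local_form_orbit_rel[OF lf' u(2)] by blast
        then show ?thesis
          using local_form_has_local_degree \<open>m' = 1\<close> \<open>stab w = 1\<close> by metis
      qed
    qed
  qed
  ultimately show ?thesis by blast
qed

lemma all_regular:
  assumes "v \<in> two_sphere"
  shows "regular_value v"
proof -
  define A where "A = {v \<in> two_sphere. regular_value v}"
  have opA: "openin (top_of_set two_sphere) A"
  proof (subst openin_subopen, intro ballI)
    fix x assume "x \<in> A"
    then obtain N where N: "openin (top_of_set two_sphere) N" "x \<in> N" "\<forall>y\<in>N. regular_value y"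
      using regular_openin[of x] by (auto simp: A_def)
    then have "N \<subseteq> A" using openin_imp_subset[OF N(1)] by (auto simp: A_def)
    then show "\<exists>T. openin (top_of_set two_sphere) T \<and> x \<in> T \<and> T \<subseteq> A" using N by blast
  qed
  have "openin (top_of_set two_sphere) (two_sphere - A)"
  proof (subst openin_subopen, intro ballI)
    fix x assume x: "x \<in> two_sphere - A"
    then obtain N where N: "openin (top_of_set two_sphere) N" "x \<in> N" "\<forall>y\<in>N. \<not> regular_value y"
      using nonregular_openin[of x] by (auto simp: A_def)
    then have "N \<subseteq> two_sphere - A" using openin_imp_subset[OF N(1)] by (auto simp: A_def)
    then show "\<exists>T. openin (top_of_set two_sphere) T \<and> x \<in> T \<and> T \<subseteq> two_sphere - A" using N by blast
  qed
  then have clA: "closedin (top_of_set two_sphere) A"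
    unfolding closedin_def topspace_euclidean_subtopology A_def by (intro conjI Collect_restrict)
  have "connected two_sphere" by (rule connected_sphere) simp
  then have "A = {} \<or> A = two_sphere"
    using opA clA unfolding connected_clopen by (elim allE[of _ A]) (rule mp, assumption, rule conjI)
  moreover have "b \<in> A" using regular_value_b b by (simp add: A_def)
  ultimately have "A = two_sphere" by blast
  then have "v \<in> A" using assms by blast
  then show ?thesis unfolding A_def by blast
qed

lemma F_surj: "range F = two_sphere"
  using all_regular F_in unfolding regular_value_def by (metis image_subset_iff rangeI subsetI subset_antisym)

lemma F_eq_iff: "F z = F w \<longleftrightarrow> orbit_rel z w"
  using all_regular[OF F_in] F_orbit_rel unfolding regular_value_def by metis

lemma local_form_stab: obtains r h V \<psi> where "local_form z (stab z) r h V \<psi>"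
proof -
  obtain m r h V \<psi> where lf: "local_form z m r h V \<psi>" using local_form_exists by blast
  have "has_local_degree UNIV two_sphere F z (stab z)"
    using all_regular[OF F_in] unfolding regular_value_def by blast
  then have "m = stab z"
    using has_local_degree_unique[OF local_form_has_local_degree[OF lf]] by blast
  then show ?thesis using lf that by blast
qed

end

section \<open>From the norm form to a branched cover\<close>

locale lattes_map = orbifold_map +
  fixes \<alpha> :: complex and k :: nat
  assumes \<alpha>: "\<alpha> \<in> eisenstein" and norm_\<alpha>: "(norm \<alpha>)\<^sup>2 = real (6 * k + 1)"
begin

lemma \<alpha>_nz: "\<alpha> \<noteq> 0"
proof
  assume "\<alpha> = 0"
  then have "real (6 * k + 1) = 0" using norm_\<alpha> by simp
  then show False by linarith
qed

definition f :: "real^3 \<Rightarrow> real^3" where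
  "f s = F (\<alpha> * (SOME z. F z = s))"

text \<open>Independence of the choice in \<open>f\<close>: multiplication by \<alpha> maps orbits
  into orbits.\<close>

lemma f_F: "f (F z) = F (\<alpha> * z)"
proof -
  have "F (SOME w. F w = F z) = F z" by (rule someI) (rule refl)
  then show ?thesis unfolding f_def F_eq_iff by (rule orbit_rel_mult[OF _ \<alpha>])
qed

text \<open>F is an open continuous surjection, so openness of a preimage under f can be checked in
  the plane.\<close>

lemma f_continuous: "continuous_on two_sphere f"
  unfolding continuous_openin_preimage_eq
proof (intro allI impI)
  fix T :: "(real^3) set" assume "open T"
  have eq: "two_sphere \<inter> f -` T = F ` ((\<lambda>z. F (\<alpha> * z)) -` T)"
    unfolding F_surj[symmetric] by (auto simp: f_F)
  have "continuous_on UNIV (\<lambda>z. F (\<alpha> * z))"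
    by (rule continuous_on_compose2[OF F_continuous]) (auto intro!: continuous_intros)
  then have "open ((\<lambda>z. F (\<alpha> * z)) -` T)"
    using \<open>open T\<close> by (simp add: continuous_on_open_vimage[OF open_UNIV])
  then show "openin (top_of_set two_sphere) (two_sphere \<inter> f -` T)"
    unfolding eq by (rule F_open_map)
qed

lemma f_image: "f ` two_sphere = two_sphere"
proof -
  have "F w \<in> f ` two_sphere" for w
    using f_F[of "w / \<alpha>"] \<alpha>_nz F_in by (intro image_eqI[of _ _ "F (w / \<alpha>)"]) auto
  then show ?thesis
    unfolding F_surj[symmetric] by (auto simp: f_F)
qed

text \<open>With e and e' the orders at z and \<alpha> * z, the e-th power of the pulled-back
  coordinate H is invariant under the rotations about z and descends to a chart at F z. The target
  coordinate is H ^ e' = (H ^ e) ^ (e' div e).\<close>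

lemma f_has_local_degree: "has_local_degree two_sphere two_sphere f (F z) (stab (\<alpha> * z) div stab z)"
proof -
  define e where "e = stab z"
  define e' where "e' = stab (\<alpha> * z)"
  have e: "e \<ge> 1" "e' \<ge> 1" using stab_pos[of z] stab_pos[of "\<alpha> * z"] by (auto simp: e_def e'_def)
  have dvd: "e dvd e'" unfolding e_def e'_def by (rule stab_dvd_mult[OF \<alpha>])
  obtain r1 h1 V1 \<psi>1 where lf1: "local_form z e r1 h1 V1 \<psi>1" using local_form_stab e_def by metis
  obtain r2 h2 V2 \<psi>2 where lf2: "local_form (\<alpha> * z) e' r2 h2 V2 \<psi>2" using local_form_stab e'_def by metis
  note l1 = local_formD[OF lf1] and l2 = local_formD[OF lf2]
  define r where "r = min r1 (r2 / norm \<alpha>)"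
  have r: "r > 0" "r \<le> r1" "r * norm \<alpha> \<le> r2"
    using l1(2) l2(2) \<alpha>_nz by (auto simp: r_def min_mult_distrib_right)
  have ab: "\<alpha> * u \<in> ball (\<alpha> * z) r2" if "u \<in> ball z r" for u
  proof -
    have "norm (\<alpha> * z - \<alpha> * u) = norm \<alpha> * norm (z - u)"
      by (simp add: norm_mult[symmetric] right_diff_distrib)
    also have "\<dots> < norm \<alpha> * r" using that \<alpha>_nz by (simp add: dist_norm)
    finally show ?thesis using r(3) by (simp add: dist_norm mult.commute)
  qed
  have lf1: "local_form z (stab z) r h1 V1 \<psi>1" using local_form_shrink[OF lf1 r(1,2)] by (simp add: e_def)
  \<comment> \<open>The chart is built from h2 rather than h1 so that f becomes an exact power in
    it; h1 describes which points F identifies.\<close>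
  define H where "H u = h2 (\<alpha> * u)" for u
  have H: "continuous_on (ball z r) H" "inj_on H (ball z r)" "H z = 0"
  proof -
    show "continuous_on (ball z r) H"
      unfolding H_def[abs_def]
      by (rule continuous_on_compose2[OF holomorphic_on_imp_continuous_on[OF l2(3)]])
        (use ab in \<open>auto intro!: continuous_intros\<close>)
    show "inj_on H (ball z r)"
    proof (rule inj_onI)
      fix u v assume "u \<in> ball z r" "v \<in> ball z r" "H u = H v"
      then have "\<alpha> * u = \<alpha> * v" using l2(4) ab unfolding H_def by (meson inj_onD)
      then show "u = v" using \<alpha>_nz by simp
    qed
    show "H z = 0" using l2(5) by (simp add: H_def)
  qed
  have Hrot: "H (z + rot z ^ i * (u - z)) = rot z ^ i * H u" if u: "u \<in> ball z r" for i u
  proof -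
    have "rot z ^ i * (\<alpha> * z) - \<alpha> * z = \<alpha> * (rot z ^ i * z - z)" by (simp add: algebra_simps)
    then have "rot z ^ i * (\<alpha> * z) - \<alpha> * z \<in> eisenstein"
      using \<alpha> rot_power_eisenstein[of z i] by (metis eisenstein_mult)
    then have "h2 (\<alpha> * z + rot z ^ i * (\<alpha> * u - \<alpha> * z)) = rot z ^ i * h2 (\<alpha> * u)"
      using local_form_equivariant[OF lf2 _ ab[OF u]] unfolding rot_power_zeta by blast
    moreover have "\<alpha> * (z + rot z ^ i * (u - z)) = \<alpha> * z + rot z ^ i * (\<alpha> * u - \<alpha> * z)"
      by (simp add: algebra_simps)
    ultimately show ?thesis by (simp add: H_def)
  qed
  have rot_ball: "z + rot z ^ i * (u - z) \<in> ball z r" if "u \<in> ball z r" for i u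
    using that by (simp add: rot_power_zeta dist_norm norm_mult norm_power norm_minus_commute)
  have rot_e: "(rot z ^ i) ^ e = 1" for i
    using rot_power_eq_1_iff[of z "i * e"] by (simp add: power_mult e_def)
  define U where "U = F ` ball z r"
  \<comment> \<open>An arbitrary section of F: two choices differ by a rotation about z, which H ^ e
    does not see.\<close>
  define g where "g s = (SOME u. u \<in> ball z r \<and> F u = s)" for s
  define \<omega> where "\<omega> s = H (g s) ^ e" for s
  have \<omega>F: "\<omega> (F u) = H u ^ e" if u: "u \<in> ball z r" for u
  proof -
    have "g (F u) \<in> ball z r \<and> F (g (F u)) = F u"
      unfolding g_def by (rule someI[of _ u]) (use u in auto)
    then obtain i where "g (F u) = z + rot z ^ i * (u - z)"
      using local_form_stab_injective[OF lf1 u, of "g (F u)"] by metis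
    then have "H (g (F u)) = rot z ^ i * H u" using Hrot[OF u] by simp
    then show ?thesis by (simp add: \<omega>_def power_mult_distrib rot_e)
  qed
  have inj: "inj_on \<omega> U"
  proof (rule inj_onI)
    fix s t assume "s \<in> U" "t \<in> U" and eq: "\<omega> s = \<omega> t"
    then obtain u v where u: "u \<in> ball z r" "s = F u" and v: "v \<in> ball z r" "t = F v"
      by (auto simp: U_def)
    have pow: "H u ^ e = H v ^ e" using eq \<omega>F u v by simp
    show "s = t"
    proof (cases "H u = 0")
      case True
      then have "H u ^ e = 0" using e by simp
      then have "H v = 0" using pow by simp
      then have "H u = H v" using True by simp
      then show ?thesis using H(2) u v by (metis inj_onD)
    next
      case False
      have hv: "H v ^ stab z = H u ^ stab z" using pow by (simp add: e_def)
      have "(H v / H u) ^ stab z = 1" unfolding power_divide hv using False by simp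
      then obtain i where "H v / H u = rot z ^ i" by (rule stab_root_of_unity)
      then have "H v = rot z ^ i * H u" using False by (simp add: divide_eq_eq)
      also have "\<dots> = H (z + rot z ^ i * (u - z))" using Hrot[OF u(1)] by simp
      finally have "v = z + rot z ^ i * (u - z)"
        using H(2) v(1) rot_ball[OF u(1)] by (meson inj_onD)
      then show ?thesis using u(2) v(2) F_orbit_rel[OF orbit_rel_rot[of u z i]] by simp
    qed
  qed
  have Hpow_cont: "continuous_on (ball z r) (\<lambda>u. H u ^ e)" by (intro continuous_intros H(1))
  have cont: "continuous_on U \<omega>"
    unfolding continuous_openin_preimage_eq
  proof (intro allI impI)
    fix T :: "complex set" assume "open T"
    have eq: "U \<inter> \<omega> -` T = F ` (ball z r \<inter> (\<lambda>u. H u ^ e) -` T)"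
      using \<omega>F by (auto simp: U_def)
    have "open (ball z r \<inter> (\<lambda>u. H u ^ e) -` T)"
      using Hpow_cont \<open>open T\<close> by (simp add: continuous_open_preimage)
    then have "openin (top_of_set two_sphere) (U \<inter> \<omega> -` T)"
      unfolding eq by (rule F_open_map)
    moreover have "U \<subseteq> two_sphere" using F_in by (auto simp: U_def)
    ultimately show "openin (top_of_set U) (U \<inter> \<omega> -` T)"
      by (meson Int_lower1 openin_subset_trans)
  qed
  have open_pow: "open ((\<lambda>w::complex. w ^ e) ` W)" if "open W" for W
  proof (rule open_mapping_thm[of "\<lambda>w. w ^ e" UNIV])
    show "\<not> (\<lambda>w::complex. w ^ e) constant_on UNIV"
    proof
      assume "(\<lambda>w::complex. w ^ e) constant_on UNIV"
      then obtain c where c: "\<And>w::complex. w ^ e = c" by (auto simp: constant_on_def)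
      have "(0::complex) ^ e = 1 ^ e" using c by metis
      then show False using e by (simp add: power_0_left)
    qed
  qed (use that in \<open>auto intro!: holomorphic_intros\<close>)
  have op: "open (\<omega> ` W)" if W: "openin (top_of_set U) W" for W
  proof -
    obtain T where T: "open T" "W = U \<inter> T" using W by (auto simp: openin_open)
    have contF: "continuous_on (ball z r) F" using F_continuous continuous_on_subset by blast
    have op1: "open (ball z r \<inter> F -` T)" using contF T(1) by (simp add: continuous_open_preimage)
    have "\<omega> ` W = (\<lambda>w. w ^ e) ` (H ` (ball z r \<inter> F -` T))"
      unfolding T(2) U_def using \<omega>F by (force simp: image_image)
    moreover have "open (H ` (ball z r \<inter> F -` T))"
      by (rule invariance_of_domain[OF continuous_on_subset[OF H(1)] op1 inj_on_subset[OF H(2)]]) auto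
    ultimately show ?thesis using open_pow by simp
  qed
  obtain q where q: "homeomorphism U (\<omega> ` U) \<omega> q"
  proof (rule homeomorphism_injective_open_map[OF cont refl inj])
    show "openin (top_of_set (\<omega> ` U)) (\<omega> ` W)" if "openin (top_of_set U) W" for W
      using op[OF that] openin_imp_subset[OF that] by (simp add: image_mono open_subset)
  qed blast
  have U: "openin (top_of_set two_sphere) U" unfolding U_def by (rule F_open_map) simp
  have chart: "surface_chart two_sphere U \<omega>"
    by (rule surface_chartI[OF U q]) (rule op, simp)
  have zb: "z \<in> ball z r" using r(1) by simp
  show ?thesis
    unfolding has_local_degree_def e_def[symmetric] e'_def[symmetric]
  proof (intro conjI exI)
    show "1 \<le> e' div e" using div_le_mono[OF dvd_imp_le[OF dvd], of e] e by simp
    show "surface_chart two_sphere U \<omega>" by (rule chart)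
    show "F z \<in> U" using zb by (auto simp: U_def)
    show "\<omega> (F z) = 0" using \<omega>F[OF zb] H(3) e by simp
    show "surface_chart two_sphere V2 \<psi>2" by (rule l2(6))
    show "f ` U \<subseteq> V2"
      using l2(7) ab by (auto simp: U_def f_F)
    show "\<psi>2 (f (F z)) = 0"
      using l2(8)[OF ab[OF zb]] l2(5) e by (simp add: f_F)
    show "\<forall>u\<in>U. \<psi>2 (f u) = \<omega> u ^ (e' div e)"
    proof
      fix s assume "s \<in> U"
      then obtain u where u: "u \<in> ball z r" "s = F u" by (auto simp: U_def)
      have "\<psi>2 (f s) = H u ^ e'" using l2(8)[OF ab[OF u(1)]] by (simp add: u(2) f_F H_def)
      also have "\<dots> = H u ^ (e * (e' div e))" using dvd by simp
      also have "\<dots> = \<omega> s ^ (e' div e)" unfolding power_mult using \<omega>F[OF u(1)] u(2) by simp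
      finally show "\<psi>2 (f s) = \<omega> s ^ (e' div e)" .
    qed
  qed
qed

lemma f_local_degree: "local_degree two_sphere two_sphere f (F z) = stab (\<alpha> * z) div stab z"
  by (rule local_degree_eqI[OF f_has_local_degree])

lemma f_branched_cover: "branched_cover two_sphere two_sphere f"
  unfolding branched_cover_def
proof (intro conjI ballI)
  show "\<exists>k. has_local_degree two_sphere two_sphere f x k" if x: "x \<in> two_sphere" for x
  proof -
    have "x \<in> range F" using x by (simp only: F_surj)
    then obtain z where "x = F z" by (rule imageE)
    then show ?thesis using f_has_local_degree by blast
  qed
qed (use closed_connected_orientable_surface_two_sphere f_continuous f_image in auto)

end

lemma eisenstein_zeta_power_mult_iff: "\<zeta> ^ j * z \<in> eisenstein \<longleftrightarrow> z \<in> eisenstein"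
  by (induction j) (simp_all add: mult.assoc)

text \<open>Representatives of the orbits of points with stabiliser of order 6, 2 and 3.\<close>

definition special_points :: "complex set" where "special_points = {0, 1 / 2, third_point}"

lemma special_orbit_of_stab:
  assumes "stab z \<noteq> 1"
  obtains p where "p \<in> special_points" "orbit_rel p z"
proof -
  have "stab z = 6 \<or> stab z = 2 \<or> stab z = 3" using stab_cases[of z] assms by blast
  then show ?thesis
    using that stab_6_orbit[of z] stab_2_orbit[of z] stab_3_orbit[of z]
    unfolding special_points_def by blast
qed

lemma special_stab_inj:
  assumes "p \<in> special_points" "q \<in> special_points" "stab p = stab q"
  shows "p = q"
  using assms unfolding special_points_def
  by - (elim insertE emptyE; hypsubst; simp add: stab_0 stab_half stab_third)

lemma special_orbit_eq: "p \<in> special_points \<Longrightarrow> q \<in> special_points \<Longrightarrow> orbit_rel p q \<Longrightarrow> p = q"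
  using special_stab_inj stab_orbit_rel by blast

lemma special_stab_ne_1: "p \<in> special_points \<Longrightarrow> stab p > 1"
  unfolding special_points_def by (elim insertE emptyE; hypsubst; simp add: stab_0 stab_half stab_third)

lemma special_orbit_of_stab_eq:
  assumes "p \<in> special_points" "stab z = stab p"
  shows "orbit_rel p z"
proof -
  have "stab z \<noteq> 1" using special_stab_ne_1[OF assms(1)] assms(2) by simp
  then obtain q where q: "q \<in> special_points" "orbit_rel q z" by (rule special_orbit_of_stab)
  then have "p = q" using special_stab_inj[OF assms(1) q(1)] stab_orbit_rel[OF q(2)] assms(2) by simp
  then show ?thesis using q by simp
qed

lemma special_6_mult: "p \<in> special_points \<Longrightarrow> 6 * p \<in> eisenstein"
proof -
  have "6 * third_point = 2 * ((2 - \<zeta>) * ((1 + \<zeta>) * third_point))"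
    by (simp add: two_minus_zeta_mult)
  then have "6 * third_point \<in> eisenstein" by (simp only: third_point_mult) simp
  then show "p \<in> special_points \<Longrightarrow> 6 * p \<in> eisenstein"
    unfolding special_points_def by (elim insertE emptyE; hypsubst; simp)
qed

section \<open>Fibres and branching of the map induced by multiplication with \<alpha>\<close>

context lattes_map
begin

text \<open>A rotation relating \<alpha> * z to w up to the lattice can be transferred to z, where F
  ignores it; only the translation part remains.\<close>

lemma fibre_eq: "{s \<in> two_sphere. f s = F w} = (\<lambda>l. F ((w + l) / \<alpha>)) ` eisenstein"
proof (intro equalityI subsetI)
  fix s assume s: "s \<in> {s \<in> two_sphere. f s = F w}"
  then have "s \<in> range F" using F_surj by simp
  then obtain z where z: "s = F z" by (rule imageE)
  have "f s = F w" using s by simp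
  then have "F (\<alpha> * z) = F w" using z f_F by simp
  then obtain j l where l: "l \<in> eisenstein" "w = \<zeta> ^ j * (\<alpha> * z) + l"
    unfolding F_eq_iff orbit_rel_def by blast
  have "(w + - l) / \<alpha> = \<zeta> ^ j * z" using l \<alpha>_nz by simp
  then have "F ((w + - l) / \<alpha>) = F z" using F_orbit_rel[OF orbit_rel_rotate[of z j]] by simp
  then show "s \<in> (\<lambda>l. F ((w + l) / \<alpha>)) ` eisenstein"
    using z l(1) by (intro image_eqI[of _ _ "- l"]) simp_all
next
  fix s assume "s \<in> (\<lambda>l. F ((w + l) / \<alpha>)) ` eisenstein"
  then obtain l where l: "l \<in> eisenstein" "s = F ((w + l) / \<alpha>)" by blast
  have "f s = F (w + l)" using \<alpha>_nz by (simp add: l f_F)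
  then show "s \<in> {s \<in> two_sphere. f s = F w}"
    using F_in F_orbit_rel[OF orbit_rel_translate[OF l(1), of w]] l by simp
qed

lemma fibre_map_eq_iff:
  "F ((w + l) / \<alpha>) = F ((w + m) / \<alpha>) \<longleftrightarrow> (\<exists>j. \<exists>n\<in>eisenstein. w + m = \<zeta> ^ j * (w + l) + \<alpha> * n)"
proof -
  have "(w + m) / \<alpha> = \<zeta> ^ j * ((w + l) / \<alpha>) + n \<longleftrightarrow> w + m = \<zeta> ^ j * (w + l) + \<alpha> * n" for j n
  proof -
    have "(\<zeta> ^ j * ((w + l) / \<alpha>) + n) * \<alpha> = \<zeta> ^ j * (w + l) + \<alpha> * n"
      using \<alpha>_nz by (simp add: distrib_right)
    then show ?thesis unfolding nonzero_divide_eq_eq[OF \<alpha>_nz] by (simp only:)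
  qed
  then show ?thesis unfolding F_eq_iff orbit_rel_def by simp
qed

text \<open>A trivial stabiliser excludes every nontrivial rotation part, leaving the lattice modulo
  \<alpha>.\<close>

lemma generic_fibre:
  assumes "stab w = 1"
  shows "finite {s \<in> two_sphere. f s = F w} \<and> card {s \<in> two_sphere. f s = F w} = 6 * k + 1"
proof -
  have "finite {s \<in> two_sphere. f s = F w} \<and> real (card {s \<in> two_sphere. f s = F w}) = (norm \<alpha>)\<^sup>2"
    unfolding fibre_eq
  proof (rule card_eisenstein_quotient[OF \<alpha> \<alpha>_nz refl])
    fix l m assume lm: "l \<in> eisenstein" "m \<in> eisenstein"
    show "F ((w + l) / \<alpha>) = F ((w + m) / \<alpha>) \<longleftrightarrow> l - m \<in> (*) \<alpha> ` eisenstein"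
      unfolding fibre_map_eq_iff
    proof
      assume "\<exists>j. \<exists>n\<in>eisenstein. w + m = \<zeta> ^ j * (w + l) + \<alpha> * n"
      then obtain j n where n: "n \<in> eisenstein" "w + m = \<zeta> ^ j * (w + l) + \<alpha> * n" by blast
      have "\<zeta> ^ j * w - w = m - \<zeta> ^ j * l - \<alpha> * n" using n(2) by (simp add: algebra_simps)
      also have "\<dots> \<in> eisenstein" using lm n(1) \<alpha> by (intro eisenstein_diff eisenstein_mult) auto
      finally obtain i where "\<zeta> ^ j = rot w ^ i" by (rule stabilizer_generated)
      then have "\<zeta> ^ j = 1" using rot_power_eq_1_iff[of w i] assms by simp
      then have "l - m = \<alpha> * (- n)" using n(2) by (simp add: algebra_simps)
      then show "l - m \<in> (*) \<alpha> ` eisenstein" using n(1) by (intro image_eqI[of _ _ "- n"]) auto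
    next
      assume "l - m \<in> (*) \<alpha> ` eisenstein"
      then obtain n where n: "n \<in> eisenstein" "l - m = \<alpha> * n" by blast
      have "w + m = \<zeta> ^ 0 * (w + l) + \<alpha> * (- n)" using n(2) by (simp add: algebra_simps)
      then show "\<exists>j. \<exists>n\<in>eisenstein. w + m = \<zeta> ^ j * (w + l) + \<alpha> * n"
        using n(1) eisenstein_minus by blast
    qed
  qed
  then show ?thesis unfolding norm_\<alpha> by (simp only: of_nat_eq_iff)
qed

text \<open>Multiplication by \<alpha> preserves the order of the stabiliser of p, and each order
  above 1 belongs to one orbit only.\<close>

lemma special_fixed:
  assumes "p \<in> special_points"
  shows "F (\<alpha> * p) = F p"
proof -
  have "stab (\<alpha> * p) = stab p"
  proof -
    have "p = 0 \<or> p = 1 / 2 \<or> p = third_point" using assms unfolding special_points_def by blast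
    then show ?thesis
    proof (elim disjE)
      assume p: "p = 0" show ?thesis unfolding p by simp
    next
      assume p: "p = 1 / 2" show ?thesis
        unfolding p stab_mult_special(1)[OF \<alpha> norm_\<alpha>] stab_half ..
    next
      assume p: "p = third_point" show ?thesis
        unfolding p stab_mult_special(2)[OF \<alpha> norm_\<alpha>] stab_third ..
    qed
  qed
  then show ?thesis
    using F_orbit_rel special_orbit_of_stab_eq[OF assms] by simp
qed

text \<open>f fixes each of the three special values, so no other special value lies over F
  p.\<close>

lemma special_fibre_stab:
  assumes p: "p \<in> special_points" and z: "F (\<alpha> * z) = F p" "F z \<noteq> F p"
  shows "stab z = 1"
proof (rule ccontr)
  assume "stab z \<noteq> 1"
  then obtain q where q: "q \<in> special_points" "orbit_rel q z" by (rule special_orbit_of_stab)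
  have Fz: "F z = F q" by (rule F_orbit_rel[OF q(2)])
  have "F (\<alpha> * z) = F (\<alpha> * q)" using F_orbit_rel[OF orbit_rel_mult[OF q(2) \<alpha>]] .
  then have "F q = F p" using special_fixed[OF q(1)] z(1) by simp
  then show False using Fz z(2) by simp
qed

text \<open>Map the 6 * k + 1 residues modulo \<alpha> onto the fibre. F p comes from one residue;
  every other point is F z with \<open>stab z = 1\<close> and comes from \<open>stab p\<close>
  residues, permuted by the rotations about p.\<close>

lemma special_fibre_card:
  assumes p: "p \<in> special_points"
  defines "X \<equiv> {s \<in> two_sphere. f s = F p}"
  shows "finite X" "F p \<in> X" "card (X - {F p}) * stab p = 6 * k"
proof -
  define e where "e = stab p"
  have e: "e > 0" using stab_pos[of p] by (simp add: e_def)
  define g where "g l = F ((p + l) / \<alpha>)" for l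
  have Xg: "X = g ` eisenstein" unfolding X_def fibre_eq g_def ..
  have g_iff: "g l = g m \<longleftrightarrow> (\<exists>j. \<exists>n\<in>eisenstein. p + m = \<zeta> ^ j * (p + l) + \<alpha> * n)" for l m
    unfolding g_def by (rule fibre_map_eq_iff)
  obtain R where R: "residue_system \<alpha> R" using residue_system_exists[OF \<alpha> \<alpha>_nz] by blast
  note RD = residue_systemD[OF R]
  have cardR: "card R = 6 * k + 1"
    using residue_system_card[OF \<alpha> \<alpha>_nz R] unfolding norm_\<alpha> by (simp only: of_nat_eq_iff)
  define rep where "rep l = (THE r. r \<in> R \<and> l - r \<in> (*) \<alpha> ` eisenstein)" for l
  have rep: "rep l \<in> R" "l - rep l \<in> (*) \<alpha> ` eisenstein" if "l \<in> eisenstein" for l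
    using theI'[OF RD(3)[OF that]] unfolding rep_def by blast+
  have rep_eq: "rep l = r" if "l \<in> eisenstein" "r \<in> R" "l - r \<in> (*) \<alpha> ` eisenstein" for l r
    unfolding rep_def by (rule the1_equality[OF RD(3)[OF that(1)]]) (use that in blast)
  have g_rep: "g (rep l) = g l" if l: "l \<in> eisenstein" for l
  proof -
    obtain n where n: "n \<in> eisenstein" "l - rep l = \<alpha> * n" using rep(2)[OF l] by blast
    have "p + l = \<zeta> ^ 0 * (p + rep l) + \<alpha> * n" using n(2) by (simp add: algebra_simps)
    then show ?thesis unfolding g_iff using n(1) by blast
  qed
  have gR: "g ` R = X"
  proof
    show "g ` R \<subseteq> X" unfolding Xg using RD(1) by blast
    show "X \<subseteq> g ` R" unfolding Xg using g_rep rep(1) by (metis image_eqI image_subsetI)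
  qed
  show finX: "finite X" using gR RD(2) by blast
  show FpX: "F p \<in> X" using F_in[of p] special_fixed[OF p] by (simp add: X_def f_F)
  have one: "card {r \<in> R. g r = F p} = 1"
  proof -
    obtain r0 where r0: "r0 \<in> R" "g r0 = F p" using FpX gR by (metis imageE)
    have "r = r'" if r: "r \<in> R" "g r = F p" and r': "r' \<in> R" "g r' = F p" for r r'
    proof -
      have form: "\<exists>j. \<exists>n\<in>eisenstein. p + r = \<alpha> * (\<zeta> ^ j * p + n)" if "g r = F p" for r
      proof -
        have "orbit_rel p ((p + r) / \<alpha>)" using that unfolding g_def F_eq_iff by (rule orbit_rel_sym)
        then obtain j n where n: "n \<in> eisenstein" "(p + r) / \<alpha> = \<zeta> ^ j * p + n" by (auto simp: orbit_rel_def)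
        then have "p + r = \<alpha> * (\<zeta> ^ j * p + n)" using \<alpha>_nz by (simp add: divide_eq_eq mult.commute)
        then show ?thesis using n(1) by blast
      qed
      obtain j n where n: "n \<in> eisenstein" "p + r = \<alpha> * (\<zeta> ^ j * p + n)" using form[OF r(2)] by blast
      obtain j' n' where n': "n' \<in> eisenstein" "p + r' = \<alpha> * (\<zeta> ^ j' * p + n')" using form[OF r'(2)] by blast
      \<comment> \<open>Both \<alpha> * c and 6 * c are in the lattice, so c is.\<close>
      define c where "c = (\<zeta> ^ j - \<zeta> ^ j') * p"
      have d: "r - r' = \<alpha> * (c + (n - n'))"
      proof -
        have "r - r' = (p + r) - (p + r')" by simp
        then show ?thesis unfolding n(2) n'(2) by (simp add: c_def algebra_simps)
      qed
      have "\<alpha> * c = r - r' - \<alpha> * (n - n')" unfolding d by (simp add: algebra_simps)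
      also have "\<dots> \<in> eisenstein"
        using RD(1) r(1) r'(1) n(1) n'(1) \<alpha> by (intro eisenstein_diff eisenstein_mult) auto
      finally have "\<alpha> * c \<in> eisenstein" .
      moreover have "6 * c = (\<zeta> ^ j - \<zeta> ^ j') * (6 * p)" by (simp add: c_def)
      then have "6 * c \<in> eisenstein" using special_6_mult[OF p] by (metis eisenstein_mult eisenstein_diff eisenstein_power eisenstein_zeta)
      ultimately have "c \<in> eisenstein" using eisenstein_cancel_coprime[OF \<alpha> norm_\<alpha>] by blast
      then have "r - r' \<in> (*) \<alpha> ` eisenstein" unfolding d using n(1) n'(1) by (intro imageI eisenstein_add eisenstein_diff)
      moreover have "r - r \<in> (*) \<alpha> ` eisenstein" by (intro image_eqI[of _ _ 0]) auto
      moreover have "r \<in> eisenstein" using RD(1) r(1) by blast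
      ultimately show ?thesis using rep_eq r(1) r'(1) by metis
    qed
    then have "{r \<in> R. g r = F p} = {r0}" using r0 by blast
    then show ?thesis by simp
  qed
  have eeq: "card {r \<in> R. g r = x} = e" if x: "x \<in> X - {F p}" for x
  proof -
    obtain l where l: "l \<in> eisenstein" "x = g l" using x unfolding Xg by blast
    define z where "z = (p + l) / \<alpha>"
    have \<alpha>z: "\<alpha> * z = p + l" using \<alpha>_nz by (simp add: z_def)
    have "F (\<alpha> * z) = F p" unfolding \<alpha>z by (rule F_orbit_rel[OF orbit_rel_translate[OF l(1)]])
    moreover have "F z \<noteq> F p" using x l(2) by (simp add: g_def z_def)
    ultimately have stabz: "stab z = 1" by (rule special_fibre_stab[OF p])
    \<comment> \<open>The i-th rotate as a lattice parameter: p + m i is p + l turned by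
      \<open>rot p ^ i\<close>.\<close>
    define m where "m i = rot p ^ i * (p + l) - p" for i
    have m: "m i \<in> eisenstein" for i
    proof -
      have "m i = rot p ^ i * l + (rot p ^ i * p - p)" by (simp add: m_def algebra_simps)
      then show ?thesis using l(1) rot_power_eisenstein[of p i]
        by (simp only:) (intro eisenstein_add eisenstein_mult, simp_all add: rot_power_zeta)
    qed
    have "{r \<in> R. g r = x} = (\<lambda>i. rep (m i)) ` {..<e}"
    proof (intro equalityI subsetI)
      fix r assume r: "r \<in> {r \<in> R. g r = x}"
      then have rE: "r \<in> R" "r \<in> eisenstein" "g l = g r" using RD(1) l(2) by auto
      obtain j n where n: "n \<in> eisenstein" "p + r = \<zeta> ^ j * (p + l) + \<alpha> * n"
        using rE(3) unfolding g_iff by blast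
      have "\<zeta> ^ j * p - p = r - \<zeta> ^ j * l - \<alpha> * n" using n(2) by (simp add: algebra_simps)
      also have "\<dots> \<in> eisenstein" using rE l(1) n(1) \<alpha> by (intro eisenstein_diff eisenstein_mult) auto
      finally obtain i where i: "\<zeta> ^ j = rot p ^ i" by (rule stabilizer_generated)
      have "rot p ^ i = rot p ^ (e * (i div e) + i mod e)" by simp
      also have "\<dots> = rot p ^ (i mod e)"
        unfolding power_add power_mult using rot_power_eq_1_iff[of p e] by (simp add: e_def)
      finally have "m (i mod e) - r = \<alpha> * (- n)"
        using n(2) i by (simp add: m_def algebra_simps)
      then have "m (i mod e) - r \<in> (*) \<alpha> ` eisenstein" using n(1) by (intro image_eqI[of _ _ "- n"]) auto
      then have "rep (m (i mod e)) = r" by (rule rep_eq[OF m rE(1)])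
      then show "r \<in> (\<lambda>i. rep (m i)) ` {..<e}" using e by (intro image_eqI[of _ _ "i mod e"]) auto
    next
      fix r assume "r \<in> (\<lambda>i. rep (m i)) ` {..<e}"
      then obtain i where i: "r = rep (m i)" by blast
      have "g (m i) = g l"
      proof -
        have "p + m i = \<zeta> ^ (6 div stab p * i) * (p + l) + \<alpha> * 0" by (simp add: m_def rot_power_zeta)
        then show ?thesis unfolding g_iff[of l "m i"] eq_commute[of "g (m i)"] using eisenstein_0 by blast
      qed
      then show "r \<in> {r \<in> R. g r = x}" using i g_rep[OF m] rep(1)[OF m] l(2) by simp
    qed
    moreover have "inj_on (\<lambda>i. rep (m i)) {..<e}"
    proof -
      \<comment> \<open>A coincidence for different exponents would give a nontrivial rotation
        fixing z modulo the lattice, against \<open>stab z = 1\<close>.\<close>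
      have "i = i'" if ii: "i' \<le> i" "i < e" "rep (m i) = rep (m i')" for i i'
      proof -
        have "m i - m i' = (m i - rep (m i)) - (m i' - rep (m i'))" using ii(3) by simp
        also have "\<dots> \<in> (*) \<alpha> ` eisenstein" by (intro eisenstein_multiples_diff rep m)
        finally obtain n where n: "n \<in> eisenstein" "m i - m i' = \<alpha> * n" by blast
        have "rot p ^ i = rot p ^ i' * rot p ^ (i - i')" using ii(1) by (simp add: power_add[symmetric])
        then have "m i - m i' = \<alpha> * (rot p ^ i' * (rot p ^ (i - i') * z - z))"
          unfolding m_def \<alpha>z[symmetric] by (simp add: algebra_simps)
        then have "rot p ^ i' * (rot p ^ (i - i') * z - z) \<in> eisenstein" using n \<alpha>_nz by simp
        then have "\<zeta> ^ (6 div stab p * (i - i')) * z - z \<in> eisenstein"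
          unfolding rot_power_zeta eisenstein_zeta_power_mult_iff .
        then obtain n where "\<zeta> ^ (6 div stab p * (i - i')) = rot z ^ n" by (rule stabilizer_generated)
        then have "rot p ^ (i - i') = 1" using rot_power_eq_1_iff[of z n] stabz by (simp add: rot_power_zeta)
        then have "e dvd i - i'" by (simp add: rot_power_eq_1_iff e_def)
        then show ?thesis using ii by (auto dest: dvd_imp_le)
      qed
      then show ?thesis by (intro inj_onI) (metis lessThan_iff nle_le)
    qed
    ultimately show ?thesis by (simp add: card_image)
  qed
  have "card R = (\<Sum>x\<in>X. card {r \<in> R. g r = x})"
    using sum.image_gen[OF RD(2), of "\<lambda>_. 1::nat" g] unfolding gR by simp
  also have "\<dots> = card {r \<in> R. g r = F p} + (\<Sum>x\<in>X - {F p}. card {r \<in> R. g r = x})"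
    by (rule sum.remove[OF finX FpX])
  also have "\<dots> = 1 + card (X - {F p}) * e"
    unfolding one using eeq by simp
  finally show "card (X - {F p}) * stab p = 6 * k" unfolding cardR by (simp add: e_def)
qed

text \<open>The quotient formula gives 1 at F p, where the order is preserved, and
  \<open>stab p\<close> at the other points, where it rises from 1.\<close>

lemma special_local_degrees:
  assumes p: "p \<in> special_points"
  shows "local_degrees_over two_sphere two_sphere f (F p) = add_mset 1 (replicate_mset (6 * k div stab p) (stab p))"
proof -
  define X where "X = {s \<in> two_sphere. f s = F p}"
  note X = special_fibre_card[OF p, folded X_def]
  have fixp: "stab (\<alpha> * p) = stab p"
    using special_fixed[OF p] stab_orbit_rel unfolding F_eq_iff by blast
  have deg_p: "local_degree two_sphere two_sphere f (F p) = 1"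
    unfolding f_local_degree fixp using stab_pos[of p] by simp
  have deg: "local_degree two_sphere two_sphere f x = stab p" if x: "x \<in> X - {F p}" for x
  proof -
    have "x \<in> range F" using x by (simp add: X_def F_surj)
    then obtain z where z: "x = F z" by (rule imageE)
    have Fz: "F (\<alpha> * z) = F p" using x z by (simp add: X_def f_F)
    have "stab z = 1" using special_fibre_stab[OF p Fz] x z by simp
    moreover have "stab (\<alpha> * z) = stab p" using Fz stab_orbit_rel unfolding F_eq_iff by blast
    ultimately show ?thesis unfolding z f_local_degree by simp
  qed
  have card: "card (X - {F p}) = 6 * k div stab p"
    using X(3) stab_pos[of p] by (metis nonzero_mult_div_cancel_right not_gr_zero)
  have "mset_set X = add_mset (F p) (mset_set (X - {F p}))"
    by (rule mset_set.remove[OF X(1,2)])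
  moreover have "image_mset (local_degree two_sphere two_sphere f) (mset_set (X - {F p}))
      = image_mset (\<lambda>_. stab p) (mset_set (X - {F p}))"
    using X(1) deg by (intro image_mset_cong) simp
  ultimately show ?thesis
    unfolding local_degrees_over_def X_def[symmetric]
    by (simp add: deg_p image_mset_const_eq card[symmetric] del: One_nat_def)
qed

lemma f_branching_points:
  assumes "k \<ge> 1"
  shows "branching_points two_sphere two_sphere f = F ` special_points"
proof (intro equalityI subsetI)
  fix y assume "y \<in> branching_points two_sphere two_sphere f"
  then obtain x where x: "x \<in> range F" "f x = y" "local_degree two_sphere two_sphere f x > 1"
    unfolding branching_points_def F_surj by blast
  then obtain z where z: "x = F z" by blast
  have "stab (\<alpha> * z) \<noteq> 1"
  proof
    assume "stab (\<alpha> * z) = 1"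
    then have "stab (\<alpha> * z) div stab z \<le> 1" by (metis div_le_dividend)
    then show False using x(3) unfolding z f_local_degree by simp
  qed
  then obtain p where "p \<in> special_points" "orbit_rel p (\<alpha> * z)" by (rule special_orbit_of_stab)
  then show "y \<in> F ` special_points" using F_orbit_rel x(2) z f_F by (metis imageI)
next
  fix y assume "y \<in> F ` special_points"
  then obtain p where p: "p \<in> special_points" "y = F p" by blast
  define X where "X = {s \<in> two_sphere. f s = F p}"
  note X = special_fibre_card[OF p(1), folded X_def]
  \<comment> \<open>k \<ge> 1 guarantees a second point over F p, and there f is branched.\<close>
  have "X - {F p} \<noteq> {}"
  proof
    assume "X - {F p} = {}"
    then have "6 * k = 0" using X(3) by (metis card.empty mult_0)
    then show False using assms by simp
  qed
  then obtain x where x: "x \<in> X" "x \<noteq> F p" by blast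
  then have "x \<in> range F" by (simp add: X_def F_surj)
  then obtain z where z: "x = F z" by (rule imageE)
  have Fz: "F (\<alpha> * z) = F p" using x z by (simp add: X_def f_F)
  have "stab z = 1" using special_fibre_stab[OF p(1) Fz] x z by simp
  moreover have "stab (\<alpha> * z) = stab p" using Fz stab_orbit_rel unfolding F_eq_iff by blast
  ultimately have "local_degree two_sphere two_sphere f x > 1"
    unfolding z f_local_degree using special_stab_ne_1[OF p(1)] by simp
  then show "y \<in> branching_points two_sphere two_sphere f"
    unfolding branching_points_def using x(1) F_in[of p] p(2) by (auto simp: X_def)
qed

lemma f_realizes:
  assumes "k \<ge> 1"
  shows "realizable two_sphere two_sphere (6 * k + 1)
    {# add_mset 1 (replicate_mset (3 * k) 2), add_mset 1 (replicate_mset (2 * k) 3),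
       add_mset 1 (replicate_mset k 6) #}"
proof -
  let ?B = "branching_points two_sphere two_sphere f"
  note B = f_branching_points[OF assms]
  have inj: "inj_on F special_points"
    by (rule inj_onI) (auto simp: F_eq_iff dest: special_orbit_eq)
  have fin: "finite special_points" by (simp add: special_points_def)
  have "stab 0 \<noteq> stab (1 / 2)" "stab 0 \<noteq> stab third_point" "stab (1 / 2) \<noteq> stab third_point"
    unfolding stab_0 stab_half stab_third by simp_all
  then have ne: "(0::complex) \<noteq> 1 / 2" "(0::complex) \<noteq> third_point" "1 / 2 \<noteq> third_point"
    by metis+
  have mset: "mset_set special_points = {# 1 / 2, third_point, 0 #}"
    using ne by (simp add: special_points_def)
  have "has_cover_degree two_sphere two_sphere f (6 * k + 1)"
    unfolding has_cover_degree_def Let_def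
  proof (intro conjI ballI)
    show "covering_space (two_sphere - f -` ?B) f (two_sphere - ?B)"
      by (rule branched_cover_covering_space[OF f_branched_cover f_image]) (simp add: B fin)
    fix y assume y: "y \<in> two_sphere - ?B"
    then have "y \<in> range F" by (simp add: F_surj)
    then obtain w where w: "y = F w" by (rule imageE)
    have "stab w = 1"
    proof (rule ccontr)
      assume "stab w \<noteq> 1"
      then obtain p where "p \<in> special_points" "orbit_rel p w" by (rule special_orbit_of_stab)
      then have "y \<in> ?B" unfolding B w using F_orbit_rel by (metis imageI)
      then show False using y by simp
    qed
    from generic_fibre[OF this]
    show "finite {x \<in> two_sphere. f x = y}" "card {x \<in> two_sphere. f x = y} = 6 * k + 1"
      unfolding w by blast+
  qed
  moreover have "image_mset (local_degrees_over two_sphere two_sphere f) (mset_set ?B) =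
     {# add_mset 1 (replicate_mset (3 * k) 2), add_mset 1 (replicate_mset (2 * k) 3),
       add_mset 1 (replicate_mset k 6) #}"
  proof -
    have "mset_set ?B = image_mset F (mset_set special_points)"
      unfolding B by (rule image_mset_mset_set[OF inj, symmetric])
    then show ?thesis
      unfolding mset
      using special_local_degrees[of "1/2"] special_local_degrees[of third_point] special_local_degrees[of 0]
      by (simp add: stab_0 stab_half stab_third special_points_def del: One_nat_def)
  qed
  moreover have "card ?B = 3"
    unfolding B card_image[OF inj] using ne by (simp add: special_points_def)
  ultimately show ?thesis
    unfolding realizable_def using f_branched_cover fin B by (intro exI[of _ f]) (simp del: One_nat_def)
qed

end

lemma realizable_if_norm_form:
  assumes "k \<ge> 1" "6 * k + 1 = x\<^sup>2 + x * y + y\<^sup>2"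
  shows "realizable two_sphere two_sphere (6 * k + 1)
    {# add_mset 1 (replicate_mset (3 * k) 2), add_mset 1 (replicate_mset (2 * k) 3),
       add_mset 1 (replicate_mset k 6) #}"
proof -
  define b :: "real^3" where "b = axis 1 1"
  have b: "b \<in> two_sphere" by (simp add: b_def)
  obtain \<sigma> \<sigma>' where hom: "homeomorphism (UNIV :: complex set) (two_sphere - {b}) \<sigma> \<sigma>'"
    using punctured_sphere_homeomorphism[OF b] by blast
  define \<alpha> where "\<alpha> = of_int (int x) + of_int (int y) * \<zeta>"
  have "(norm \<alpha>)\<^sup>2 = of_int (int (x\<^sup>2 + x * y + y\<^sup>2))"
    unfolding \<alpha>_def norm_sq_eisenstein by simp
  then have "(norm \<alpha>)\<^sup>2 = real (6 * k + 1)" unfolding assms(2) by simp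
  moreover have "\<alpha> \<in> eisenstein" unfolding \<alpha>_def eisenstein_def by blast
  ultimately interpret lattes_map b \<sigma> \<sigma>' \<alpha> k
    by unfold_locales (use b hom in auto)
  show ?thesis by (rule f_realizes[OF assms(1)])
qed

section \<open>Lifting through the branched cover\<close>

text \<open>Writing \<open>\<theta> (exp s) = exp (\<tau> s)\<close> on a half-plane, the root is \<open>exp (\<tau> (m * s) / m)\<close>: the function
  \<open>\<tau>\<close> changes by a multiple of \<open>2 * pi * \<i>\<close> under the period of \<open>exp\<close>, so this depends on \<open>exp s\<close>
  only.\<close>

lemma continuous_root_of_power_pullback:
  fixes \<theta> :: "complex \<Rightarrow> complex"
  assumes \<rho>: "\<rho> > 0" and cont: "continuous_on (ball 0 \<rho>) \<theta>" and \<theta>0: "\<theta> 0 = 0"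
    and nz: "\<And>w. w \<in> ball 0 \<rho> \<Longrightarrow> w \<noteq> 0 \<Longrightarrow> \<theta> w \<noteq> 0" and m: "m \<ge> 1"
  obtains R q where "R > 0" "continuous_on (ball 0 R) q"
    "\<And>w. w \<in> ball 0 R \<Longrightarrow> w ^ m \<in> ball 0 \<rho> \<and> q w ^ m = \<theta> (w ^ m)"
proof -
  define T where "T = 2 * of_real pi * \<i>"
  define Hp where "Hp = {s. Re s < ln \<rho>}"
  have Hp_iff: "s \<in> Hp \<longleftrightarrow> exp s \<in> ball 0 \<rho>" for s
  proof -
    have "Re s < ln \<rho> \<longleftrightarrow> exp (Re s) < \<rho>" using \<rho> by (metis exp_less_cancel_iff exp_ln)
    then show ?thesis by (simp add: Hp_def)
  qed
  have expT: "exp (s + of_int n * T) = exp s" for s n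
    using exp_eq[of "s + of_int n * T" s] by (auto simp: T_def intro!: exI[of _ n])
  have Hp_T: "s + of_int n * T \<in> Hp \<longleftrightarrow> s \<in> Hp" for s n
    unfolding Hp_iff expT ..
  have "convex Hp" unfolding Hp_def by (rule convex_halfspace_Re_lt)
  have "continuous_on Hp (\<lambda>s. \<theta> (exp s))"
    by (rule continuous_on_compose2[OF cont]) (auto simp: Hp_iff intro!: continuous_intros)
  then obtain \<tau> where \<tau>: "continuous_on Hp \<tau>" "\<And>s. s \<in> Hp \<Longrightarrow> \<theta> (exp s) = exp (\<tau> s)"
    using continuous_logarithm_on_contractible[OF _ convex_imp_contractible[OF \<open>convex Hp\<close>]] nz
    by (metis Hp_iff exp_not_eq_zero)
  have integral: "\<exists>n::int. \<tau> (s + T) - \<tau> s = of_int n * T" if s: "s \<in> Hp" for s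
  proof -
    have "s + T \<in> Hp" using Hp_T[of s 1] s by simp
    then have "exp (\<tau> (s + T)) = exp (\<tau> s)" using \<tau>(2) s expT[of s 1] by (metis mult_1 of_int_1)
    then obtain n :: int where "\<tau> (s + T) = \<tau> s + of_real (of_int (2 * n) * pi) * \<i>"
      unfolding exp_eq by blast
    then show ?thesis by (intro exI[of _ n]) (simp add: T_def)
  qed
  have "(\<lambda>s. \<tau> (s + T) - \<tau> s) constant_on Hp"
  proof (rule continuous_discrete_range_constant)
    show "connected Hp" using \<open>convex Hp\<close> by (rule convex_connected)
    show "continuous_on Hp (\<lambda>s. \<tau> (s + T) - \<tau> s)"
      using Hp_T[of _ 1]
      by (intro continuous_intros \<tau>(1) continuous_on_compose2[OF \<tau>(1)]) auto
    fix s assume s: "s \<in> Hp"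
    show "\<exists>e>0. \<forall>t. t \<in> Hp \<and> \<tau> (t + T) - \<tau> t \<noteq> \<tau> (s + T) - \<tau> s \<longrightarrow>
        e \<le> norm ((\<tau> (t + T) - \<tau> t) - (\<tau> (s + T) - \<tau> s))"
    proof (intro exI[of _ "2 * pi"] conjI allI impI)
      \<comment> \<open>The values are integer multiples of T, hence at least 2 pi apart when
        different.\<close>
      fix t assume t: "t \<in> Hp \<and> \<tau> (t + T) - \<tau> t \<noteq> \<tau> (s + T) - \<tau> s"
      obtain n n' :: int where n: "\<tau> (s + T) - \<tau> s = of_int n * T" "\<tau> (t + T) - \<tau> t = of_int n' * T"
        using integral s t by metis
      have "n \<noteq> n'" using n t by auto
      then have "1 \<le> norm (of_int (n' - n) :: complex)" unfolding norm_of_int by linarith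
      then have "1 * (2 * pi) \<le> norm (of_int (n' - n) :: complex) * norm T"
        by (intro mult_mono) (simp_all add: T_def norm_mult)
      also have "\<dots> = norm (of_int n' * T - of_int n * T)"
        by (simp add: norm_mult[symmetric] left_diff_distrib)
      finally show "2 * pi \<le> norm ((\<tau> (t + T) - \<tau> t) - (\<tau> (s + T) - \<tau> s))"
        unfolding n by simp
    qed simp
  qed
  then obtain D where D: "\<And>s. s \<in> Hp \<Longrightarrow> \<tau> (s + T) - \<tau> s = D" by (auto simp: constant_on_def)
  have "\<exists>N::int. D = of_int N * T"
  proof -
    have "of_real (ln \<rho> - 1) \<in> Hp" by (simp add: Hp_def)
    then show ?thesis using D integral by metis
  qed
  then obtain N :: int where N: "D = of_int N * T" by blast
  have shift: "\<tau> (s + of_nat j * T) = \<tau> s + of_nat j * D" if s: "s \<in> Hp" for s j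
  proof (induction j)
    case (Suc j)
    have "s + of_nat j * T \<in> Hp" using Hp_T[of s "int j"] s by simp
    from D[OF this] have "\<tau> (s + of_nat j * T + T) = \<tau> (s + of_nat j * T) + D" by (simp add: algebra_simps)
    then show ?case using Suc by (simp add: algebra_simps)
  qed simp
  define E where "E s = exp (\<tau> (of_nat m * s) / of_nat m)" for s
  \<comment> \<open>Shifting s by j periods shifts m * s by m * j periods and \<tau> by m * j * D;
    division by m leaves j * D, again a multiple of the period. Without the pullback by w ^ m one
    would meet D / m, which need not be one.\<close>
  have E_shift: "E (s + of_nat j * T) = E s" if s: "of_nat m * s \<in> Hp" for s j
  proof -
    have "\<tau> (of_nat m * (s + of_nat j * T)) = \<tau> (of_nat m * s) + of_nat (m * j) * D"
      using shift[OF s, of "m * j"] by (simp add: algebra_simps)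
    then have "\<tau> (of_nat m * (s + of_nat j * T)) / of_nat m = \<tau> (of_nat m * s) / of_nat m + of_int (int j * N) * T"
      using m by (simp add: N add_divide_distrib)
    then show ?thesis unfolding E_def by (simp only: expT)
  qed
  have E_eq: "E s = E s'" if "exp s = exp s'" "of_nat m * s \<in> Hp" "of_nat m * s' \<in> Hp" for s s'
  proof -
    obtain n :: int where n: "s = s' + of_int n * T"
      using \<open>exp s = exp s'\<close> unfolding exp_eq T_def by (auto simp: mult_ac)
    show ?thesis
    proof (cases "n \<ge> 0")
      case True
      then have "s = s' + of_nat (nat n) * T" using n by simp
      then show ?thesis using E_shift[OF that(3)] by simp
    next
      case False
      then have "s' = s + of_nat (nat (- n)) * T" using n by simp
      then show ?thesis using E_shift[OF that(2)] by simp
    qed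
  qed
  \<comment> \<open>The bound 1 gives |w ^ m| \<le> |w|, as m \<ge> 1.\<close>
  define R where "R = min 1 \<rho>"
  have R: "R > 0" using \<rho> by (simp add: R_def)
  have wm: "w ^ m \<in> ball 0 \<rho>" if "w \<in> ball 0 R" for w :: complex
  proof -
    have w: "norm w < 1" "norm w < \<rho>" using that by (auto simp: R_def)
    have "norm w ^ m \<le> norm w ^ 1" using w(1) m by (intro power_decreasing) auto
    then show ?thesis using w(2) by (simp add: norm_power)
  qed
  have mHp: "of_nat m * s \<in> Hp" if "exp s \<in> ball 0 R" for s
    using wm[OF that] by (simp add: Hp_iff exp_of_nat_mult)
  define q where "q w = (if w = 0 then 0 else E (Ln w))" for w
  have q_exp: "q (exp s) = E s" if "exp s \<in> ball 0 R" for s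
    unfolding q_def using E_eq[of "Ln (exp s)" s] mHp[OF that] mHp[of "Ln (exp s)"] that by simp
  have q_pow: "q w ^ m = \<theta> (w ^ m)" if w: "w \<in> ball 0 R" for w
  proof (cases "w = 0")
    case True
    then show ?thesis using m \<theta>0 by (simp add: q_def power_0_left)
  next
    case False
    have in_Hp: "of_nat m * Ln w \<in> Hp" using mHp[of "Ln w"] False w by simp
    have "q w ^ m = exp (of_nat m * (\<tau> (of_nat m * Ln w) / of_nat m))"
      using False by (simp only: q_def E_def if_False exp_of_nat_mult)
    also have "\<dots> = exp (\<tau> (of_nat m * Ln w))" using m by simp
    also have "\<dots> = \<theta> (exp (of_nat m * Ln w))" using \<tau>(2)[OF in_Hp] by simp
    also have "\<dots> = \<theta> (w ^ m)" unfolding exp_of_nat_mult exp_Ln[OF False] ..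
    finally show ?thesis .
  qed
  have E_cont: "continuous_on {s. exp s \<in> ball 0 R} E"
  proof -
    have "continuous_on {s. exp s \<in> ball 0 R} (\<lambda>s. \<tau> (of_nat m * s))"
      by (rule continuous_on_compose2[OF \<tau>(1)]) (use mHp in \<open>auto intro!: continuous_intros\<close>)
    then show ?thesis unfolding E_def[abs_def] using m by (intro continuous_intros) auto
  qed
  \<comment> \<open>Continuity of q is checked through any continuous branch L of the logarithm,
    since q (exp s) = E s: \<open>Ln\<close> off the nonpositive axis, and Ln (- x) + pi * \<i>
    across the negative one.\<close>
  have patch: "isCont q w" if A: "open A" "w \<in> A" "A \<subseteq> ball 0 R" and L: "continuous_on A L" "\<And>x. x \<in> A \<Longrightarrow> exp (L x) = x"
    for A w L
  proof -
    have "L ` A \<subseteq> {s. exp s \<in> ball 0 R}"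
    proof
      fix s assume "s \<in> L ` A"
      then obtain x where x: "x \<in> A" "s = L x" by blast
      then show "s \<in> {s. exp s \<in> ball 0 R}" using L(2)[OF x(1)] A(3) by (simp only: mem_Collect_eq) blast
    qed
    then have "continuous_on A (\<lambda>x. E (L x))"
      by (rule continuous_on_compose2[OF E_cont L(1)])
    moreover have "E (L x) = q x" if "x \<in> A" for x
      using q_exp[of "L x"] L(2)[OF that] A(3) that by auto
    ultimately have "continuous_on A q" by (rule continuous_on_eq)
    then show ?thesis using A by (simp add: continuous_on_eq_continuous_at)
  qed
  have "isCont q w" if w: "w \<in> ball 0 R" for w
  proof -
    consider "w = 0" | "w \<notin> \<real>\<^sub>\<le>\<^sub>0" | "w \<noteq> 0" "w \<in> \<real>\<^sub>\<le>\<^sub>0" by blast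
    then show ?thesis
    proof cases
      case 1
      \<comment> \<open>No logarithm exists around 0; there continuity comes from |q w| ^ m =
        |\<theta> (w ^ m)|.\<close>
      have "(q \<longlongrightarrow> 0) (at 0)"
      proof (rule tendstoI)
        fix \<epsilon> :: real assume \<epsilon>: "\<epsilon> > 0"
        have cm: "continuous_on (ball 0 R) (\<lambda>w. \<theta> (w ^ m))"
          by (rule continuous_on_compose2[OF cont]) (use wm in \<open>auto intro!: continuous_intros\<close>)
        then have "isCont (\<lambda>w. \<theta> (w ^ m)) 0" using R by (simp add: continuous_on_eq_continuous_at)
        then have "((\<lambda>w. \<theta> (w ^ m)) \<longlongrightarrow> 0) (at 0)" using \<theta>0 m by (simp add: isCont_def power_0_left)
        then have "\<forall>\<^sub>F w in at 0. dist (\<theta> (w ^ m)) 0 < \<epsilon> ^ m" using \<epsilon> by (intro tendstoD) simp_all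
        moreover have "\<forall>\<^sub>F w in at 0. w \<in> ball 0 R" using R by (intro eventually_at_in_open') auto
        ultimately show "\<forall>\<^sub>F w in at 0. dist (q w) 0 < \<epsilon>"
        proof eventually_elim
          case (elim w)
          then have "norm (q w) ^ m < \<epsilon> ^ m" using q_pow by (simp add: norm_power[symmetric])
          then show ?case using \<epsilon> by (simp add: power_less_imp_less_base)
        qed
      qed
      then show ?thesis using 1 by (simp add: isCont_def q_def)
    next
      case 2
      show ?thesis
      proof (rule patch)
        show "open (ball 0 R \<inter> - \<real>\<^sub>\<le>\<^sub>0 :: complex set)" by (intro open_Int open_ball open_Compl closed_nonpos_Reals_complex)
        show "continuous_on (ball 0 R \<inter> - \<real>\<^sub>\<le>\<^sub>0) Ln" by (intro continuous_intros) auto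
        show "exp (Ln x) = x" if "x \<in> ball 0 R \<inter> - \<real>\<^sub>\<le>\<^sub>0" for x :: complex
          by (rule exp_Ln) (use that in auto)
      qed (use 2 w in auto)
    next
      case 3
      let ?A = "ball 0 R \<inter> uminus -` (- \<real>\<^sub>\<le>\<^sub>0) :: complex set"
      show ?thesis
      proof (rule patch)
        have "open (uminus -` (- \<real>\<^sub>\<le>\<^sub>0) :: complex set)"
          by (intro open_vimage open_Compl closed_nonpos_Reals_complex continuous_intros)
        then show "open ?A" by (intro open_Int open_ball)
        show "w \<in> ?A" using 3 w by (auto simp: complex_nonpos_Reals_iff complex_eq_iff)
        show "continuous_on ?A (\<lambda>x. Ln (- x) + of_real pi * \<i>)" by (intro continuous_intros) auto
        show "exp (Ln (- x) + of_real pi * \<i>) = x" if "x \<in> ?A" for x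
        proof -
          have "- x \<noteq> 0" using that by auto
          then show ?thesis by (simp add: exp_add)
        qed
      qed auto
    qed
  qed
  then have "continuous_on (ball 0 R) q" by (simp add: continuous_at_imp_continuous_on)
  then show ?thesis using that R wm q_pow by blast
qed

section \<open>Gluing local lifts over the plane\<close>

lemma exists_outside_countable:
  fixes D :: "complex set"
  assumes "open D" "D \<noteq> {}" "countable P"
  obtains z where "z \<in> D" "z \<notin> P"
proof -
  obtain z r where "r > 0" "ball z r \<subseteq> D"
    using assms(1,2) by (meson ex_in_conv open_contains_ball)
  then have "uncountable D"
    using uncountable_ball countable_subset by blast
  then have "\<not> D \<subseteq> P" using assms(3) countable_subset by blast
  then show ?thesis using that by blast
qed

text \<open>Parallelogram law for c - z0 and c' - z0.\<close>

lemma sphere_midpoint: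
  fixes c c' z0 :: complex
  assumes "dist z0 c = R" "dist z0 c' = R" "c \<noteq> c'"
  shows "midpoint c c' \<in> ball z0 R"
proof -
  let ?a = "c - z0" and ?b = "c' - z0"
  have "(norm (?a + ?b))\<^sup>2 + (norm (?a - ?b))\<^sup>2 = 2 * (norm ?a)\<^sup>2 + 2 * (norm ?b)\<^sup>2"
    unfolding cmod_power2 by (simp add: power2_eq_square algebra_simps)
  moreover have "norm ?a = R" "norm ?b = R" using assms by (simp_all add: dist_norm norm_minus_commute)
  ultimately have "(norm (?a + ?b))\<^sup>2 + (norm (?a - ?b))\<^sup>2 = 4 * R\<^sup>2" by simp
  moreover have "(norm (?a - ?b))\<^sup>2 > 0" using assms(3) by simp
  ultimately have "(norm (?a + ?b))\<^sup>2 < 4 * R\<^sup>2" by linarith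
  then have "(norm (?a + ?b))\<^sup>2 < (2 * R)\<^sup>2" by (simp only: power_mult_distrib) simp
  moreover have "R \<ge> 0" using assms(1) zero_le_dist[of z0 c] by linarith
  then have "0 \<le> 2 * R" by simp
  ultimately have "norm (?a + ?b) < 2 * R" by (rule power2_less_imp_less)
  moreover have "midpoint c c' - z0 = (?a + ?b) / 2"
    by (simp add: midpoint_def scaleR_conv_of_real field_simps)
  then have "norm (midpoint c c' - z0) = norm (?a + ?b) / 2"
    by (simp only: norm_divide norm_numeral)
  ultimately have "norm (midpoint c c' - z0) < R" by linarith
  then show ?thesis unfolding mem_ball dist_norm norm_minus_commute[of z0] .
qed

text \<open>P holds the exceptional points, at which two lifts may agree without being equal;
  countability leaves base points outside P in every nonempty open set.\<close>

locale local_lifting =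
  fixes F :: "complex \<Rightarrow> 'b" and T :: "'a::metric_space set" and f :: "'a \<Rightarrow> 'b" and P :: "complex set"
  assumes P: "countable P"
begin

definition is_lift :: "complex set \<Rightarrow> (complex \<Rightarrow> 'a) \<Rightarrow> bool" where
  "is_lift D g \<longleftrightarrow> continuous_on D g \<and> (\<forall>u\<in>D. g u \<in> T \<and> f (g u) = F u)"

lemma is_lift_subset: "is_lift D g \<Longrightarrow> D' \<subseteq> D \<Longrightarrow> is_lift D' g"
  unfolding is_lift_def using continuous_on_subset by blast

lemma is_lift_glue:
  assumes "\<And>u. u \<in> D \<Longrightarrow> \<exists>A g'. open A \<and> u \<in> A \<and> is_lift A g' \<and> (\<forall>v\<in>A. g v = g' v)"
  shows "is_lift D g"
proof -
  have "isCont g u \<and> g u \<in> T \<and> f (g u) = F u" if u: "u \<in> D" for u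
  proof -
    obtain A g' where A: "open A" "u \<in> A" "is_lift A g'" "\<And>v. v \<in> A \<Longrightarrow> g v = g' v"
      using assms[OF u] by blast
    have "continuous_on A g'" using A(3) by (simp add: is_lift_def)
    then have "continuous_on A g" by (rule continuous_on_eq) (simp add: A(4))
    then have "isCont g u" using A(1,2) by (simp add: continuous_on_eq_continuous_at)
    moreover have "g u \<in> T \<and> f (g u) = F u" using A(2-4) by (simp add: is_lift_def)
    ultimately show ?thesis by blast
  qed
  then show ?thesis unfolding is_lift_def by (blast intro: continuous_at_imp_continuous_on)
qed

end

text \<open>In \<open>local\<close> one radius serves every base point z' of the ball and every
  point over it, because the extension step starts from points other than the centre.\<close>

locale unique_lifting = local_lifting +
  assumes local: "\<And>z. \<exists>r>0. \<forall>z'\<in>ball z r. \<forall>x\<in>T. f x = F z' \<longrightarrow> (\<exists>g. is_lift (ball z r) g \<and> g z' = x)"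
    and unique: "\<And>D g1 g2 z' u. open D \<Longrightarrow> connected D \<Longrightarrow> is_lift D g1 \<Longrightarrow> is_lift D g2 \<Longrightarrow>
      z' \<in> D \<Longrightarrow> z' \<notin> P \<Longrightarrow> g1 z' = g2 z' \<Longrightarrow> u \<in> D \<Longrightarrow> g1 u = g2 u"
begin

text \<open>The new pieces are balls centred on the circle of radius \<open>R\<close>. Two that meet also meet inside the
  old disc, at the midpoint of their centres, so the pieces fit together there and hence everywhere.\<close>

lemma lift_extend:
  assumes \<epsilon>: "\<epsilon> > 0" "\<And>c. c \<in> cball z0 Rm \<Longrightarrow> \<exists>z r. ball c \<epsilon> \<subseteq> ball z r \<and>
      (\<forall>z'\<in>ball z r. \<forall>x\<in>T. f x = F z' \<longrightarrow> (\<exists>g. is_lift (ball z r) g \<and> g z' = x))"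
    and R: "0 < R" "R \<le> Rm" and g: "is_lift (ball z0 R) g"
  shows "\<exists>G. is_lift (ball z0 (R + \<epsilon>)) G \<and> (\<forall>u\<in>ball z0 R. G u = g u)"
proof -
  have "\<exists>h. is_lift (ball c \<epsilon>) h \<and> (\<forall>u\<in>ball c \<epsilon> \<inter> ball z0 R. h u = g u)" if c: "dist z0 c = R" for c
  proof -
    have "ball c \<epsilon> \<inter> ball z0 R \<noteq> {}"
    proof -
      have "c \<in> closure (ball z0 R)" using c R(1) by simp
      moreover have "c \<in> ball c \<epsilon>" using \<epsilon>(1) by simp
      ultimately have "ball c \<epsilon> \<inter> closure (ball z0 R) \<noteq> {}" by blast
      then show ?thesis unfolding open_Int_closure_eq_empty[OF open_ball] .
    qed
    \<comment> \<open>A base point outside P, so that agreement there propagates.\<close>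
    then obtain z' where z': "z' \<in> ball c \<epsilon> \<inter> ball z0 R" "z' \<notin> P"
      using exists_outside_countable[OF _ _ P, of "ball c \<epsilon> \<inter> ball z0 R"] by auto
    have "c \<in> cball z0 Rm" using c R by simp
    then obtain z r where zr: "ball c \<epsilon> \<subseteq> ball z r"
      and loc: "\<And>z' x. z'\<in>ball z r \<Longrightarrow> x \<in> T \<Longrightarrow> f x = F z' \<Longrightarrow> \<exists>g. is_lift (ball z r) g \<and> g z' = x"
      using \<epsilon>(2) by meson
    have "g z' \<in> T" "f (g z') = F z'" using g z' by (auto simp: is_lift_def)
    then obtain h where h: "is_lift (ball z r) h" "h z' = g z'" using loc z'(1) zr by blast
    have "h u = g u" if u: "u \<in> ball c \<epsilon> \<inter> ball z0 R" for u
    proof (rule unique[where D = "ball c \<epsilon> \<inter> ball z0 R" and z' = z'])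
      show "z' \<in> ball c \<epsilon> \<inter> ball z0 R" "z' \<notin> P" "h z' = g z'" "u \<in> ball c \<epsilon> \<inter> ball z0 R"
        by (fact z' h(2) u)+
      show "open (ball c \<epsilon> \<inter> ball z0 R)" by auto
      show "connected (ball c \<epsilon> \<inter> ball z0 R)" by (intro convex_connected convex_Int) auto
      show "is_lift (ball c \<epsilon> \<inter> ball z0 R) h" using is_lift_subset[OF h(1)] zr by blast
      show "is_lift (ball c \<epsilon> \<inter> ball z0 R) g" using is_lift_subset[OF g] by blast
    qed
    then show ?thesis using is_lift_subset[OF h(1) zr] by blast
  qed
  then obtain h where h: "\<And>c. dist z0 c = R \<Longrightarrow> is_lift (ball c \<epsilon>) (h c)"
    "\<And>c u. dist z0 c = R \<Longrightarrow> u \<in> ball c \<epsilon> \<Longrightarrow> u \<in> ball z0 R \<Longrightarrow> h c u = g u"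
    by (metis IntI)
  have hh: "h c u = h c' u" if c: "dist z0 c = R" "dist z0 c' = R" and u: "u \<in> ball c \<epsilon>" "u \<in> ball c' \<epsilon>" for c c' u
  proof (cases "c = c'")
    case False
    have mid: "midpoint c c' \<in> ball z0 R" by (rule sphere_midpoint[OF c False])
    \<comment> \<open>Intersecting balls of radius \<epsilon> have centres less than 2 * \<epsilon>
      apart, so both contain the midpoint.\<close>
    have "dist c c' < 2 * \<epsilon>" using u dist_triangle2[of c c' u] by (simp add: dist_commute)
    then have "midpoint c c' \<in> ball c \<epsilon>" "midpoint c c' \<in> ball c' \<epsilon>" by (simp_all add: dist_midpoint)
    then have ne: "ball c \<epsilon> \<inter> ball c' \<epsilon> \<inter> ball z0 R \<noteq> {}" using mid by blast
    have op: "open (ball c \<epsilon> \<inter> ball c' \<epsilon> \<inter> ball z0 R)" by (intro open_Int open_ball)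
    obtain z' where z': "z' \<in> ball c \<epsilon> \<inter> ball c' \<epsilon> \<inter> ball z0 R" "z' \<notin> P"
      by (rule exists_outside_countable[OF op ne P])
    have eq: "h c z' = h c' z'" using h(2)[OF c(1)] h(2)[OF c(2)] z'(1) by simp
    show ?thesis
    proof (rule unique[where D = "ball c \<epsilon> \<inter> ball c' \<epsilon>" and z' = z'])
      show "z' \<notin> P" "h c z' = h c' z'" by (fact z'(2) eq)+
      show "open (ball c \<epsilon> \<inter> ball c' \<epsilon>)" by auto
      show "connected (ball c \<epsilon> \<inter> ball c' \<epsilon>)" by (intro convex_connected convex_Int) auto
      show "is_lift (ball c \<epsilon> \<inter> ball c' \<epsilon>) (h c)" using is_lift_subset[OF h(1)[OF c(1)]] by blast
      show "is_lift (ball c \<epsilon> \<inter> ball c' \<epsilon>) (h c')" using is_lift_subset[OF h(1)[OF c(2)]] by blast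
    qed (use z' u in auto)
  qed simp
  define cc where "cc u = (SOME c. dist z0 c = R \<and> u \<in> ball c \<epsilon>)" for u
  define G where "G u = (if u \<in> ball z0 R then g u else h (cc u) u)" for u
  have Gh: "G u = h c u" if c: "dist z0 c = R" "u \<in> ball c \<epsilon>" for c u
  proof (cases "u \<in> ball z0 R")
    case True
    then show ?thesis using h(2)[OF c] by (simp add: G_def)
  next
    case False
    have cu: "dist z0 (cc u) = R \<and> u \<in> ball (cc u) \<epsilon>"
      unfolding cc_def by (rule someI[of _ c]) (use c in blast)
    show ?thesis unfolding G_def if_not_P[OF False] by (rule hh) (use cu c in blast)+
  qed
  have "is_lift (ball z0 (R + \<epsilon>)) G"
  proof (rule is_lift_glue)
    fix u assume u: "u \<in> ball z0 (R + \<epsilon>)"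
    show "\<exists>A g'. open A \<and> u \<in> A \<and> is_lift A g' \<and> (\<forall>v\<in>A. G v = g' v)"
    proof (cases "u \<in> ball z0 R")
      case True
      then show ?thesis using g by (intro exI[of _ "ball z0 R"] exI[of _ g]) (simp add: G_def)
    next
      case False
      define d where "d = norm (u - z0)"
      have d: "d \<ge> R" "d < R + \<epsilon>" using False u by (auto simp: d_def dist_norm norm_minus_commute)
      \<comment> \<open>Radial projection of u to the circle; its distance from u is d - R <
        \<epsilon>.\<close>
      define c where "c = z0 + of_real (R / d) * (u - z0)"
      have c: "dist z0 c = R"
        using d(1) R(1) by (simp add: c_def dist_norm norm_mult norm_divide d_def[symmetric])
      have "u - c = of_real (1 - R / d) * (u - z0)" by (simp add: c_def algebra_simps)
      then have "norm (u - c) = \<bar>1 - R / d\<bar> * d" by (simp only: norm_mult norm_of_real d_def)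
      also have "\<dots> = d - R" using d(1) R(1) by (simp add: field_simps abs_if)
      finally have "u \<in> ball c \<epsilon>" using d(2) by (simp add: dist_norm norm_minus_commute)
      then show ?thesis using h(1)[OF c] Gh[OF c]
        by (intro exI[of _ "ball c \<epsilon>"] exI[of _ "h c"]) auto
    qed
  qed
  then show ?thesis by (intro exI[of _ G]) (simp add: G_def)
qed

text \<open>\<epsilon> is a Lebesgue number for the cover of the closed disc by lifting balls, so
  the radius can grow by \<epsilon> until it reaches \<open>Rm\<close>.\<close>

lemma lift_on_balls:
  assumes x0: "x0 \<in> T" "f x0 = F z0" and Rm: "Rm > 0"
  shows "\<exists>g. is_lift (ball z0 Rm) g \<and> g z0 = x0"
proof -
  define Q where "Q R \<longleftrightarrow> (\<exists>g. is_lift (ball z0 R) g \<and> g z0 = x0)" for R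
  have Qmono: "Q R'" if "Q R" "R' \<le> R" for R R'
    using that is_lift_subset subset_ball unfolding Q_def by blast
  obtain r where r: "\<And>z. r z > 0" "\<And>z z' x. z' \<in> ball z (r z) \<Longrightarrow> x \<in> T \<Longrightarrow> f x = F z' \<Longrightarrow>
      \<exists>g. is_lift (ball z (r z)) g \<and> g z' = x"
    using local by metis
  obtain \<epsilon> where "\<epsilon> > 0" "\<And>c. c \<in> cball z0 Rm \<Longrightarrow> \<exists>G\<in>range (\<lambda>z. ball z (r z)). ball c \<epsilon> \<subseteq> G"
  proof (rule Heine_Borel_lemma[of "cball z0 Rm" "range (\<lambda>z. ball z (r z))"])
    show "cball z0 Rm \<subseteq> \<Union> (range (\<lambda>z. ball z (r z)))"
    proof
      fix z
      have "z \<in> ball z (r z)" using r(1) by simp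
      then show "z \<in> \<Union> (range (\<lambda>z. ball z (r z)))" by blast
    qed
  qed auto
  then have \<epsilon>: "\<epsilon> > 0" "\<And>c. c \<in> cball z0 Rm \<Longrightarrow> \<exists>z. ball c \<epsilon> \<subseteq> ball z (r z)" by blast+
  have step: "Q (R + \<epsilon>)" if R: "0 < R" "R \<le> Rm" and "Q R" for R
  proof -
    obtain g where g: "is_lift (ball z0 R) g" "g z0 = x0" using \<open>Q R\<close> Q_def by blast
    have "\<exists>G. is_lift (ball z0 (R + \<epsilon>)) G \<and> (\<forall>u\<in>ball z0 R. G u = g u)"
    proof (rule lift_extend[OF \<epsilon>(1) _ R g(1)])
      fix c assume "c \<in> cball z0 Rm"
      then obtain z where "ball c \<epsilon> \<subseteq> ball z (r z)" using \<epsilon>(2) by blast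
      then show "\<exists>z r. ball c \<epsilon> \<subseteq> ball z r \<and>
          (\<forall>z'\<in>ball z r. \<forall>x\<in>T. f x = F z' \<longrightarrow> (\<exists>g. is_lift (ball z r) g \<and> g z' = x))"
        using r(2) by (intro exI[of _ z] exI[of _ "r z"]) blast
    qed
    then obtain G where "is_lift (ball z0 (R + \<epsilon>)) G" "\<And>u. u \<in> ball z0 R \<Longrightarrow> G u = g u" by blast
    then show ?thesis using g(2) R(1) unfolding Q_def by (metis centre_in_ball)
  qed
  have Q0: "Q (r z0)" unfolding Q_def using r(2)[of z0 z0 x0] r(1)[of z0] x0 by simp
  have "Q (min Rm (r z0 + of_nat n * \<epsilon>))" for n
  proof (induction n)
    case 0
    then show ?case using Q0 Qmono by simp
  next
    case (Suc n)
    have "Q (min Rm (r z0 + of_nat n * \<epsilon>) + \<epsilon>)"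
      by (rule step) (use Rm r(1)[of z0] \<epsilon>(1) Suc in \<open>auto intro: add_pos_nonneg\<close>)
    then show ?case by (rule Qmono) (use \<epsilon>(1) in \<open>auto simp: min_def algebra_simps\<close>)
  qed
  moreover obtain n :: nat where "Rm / \<epsilon> < of_nat n" using reals_Archimedean2 by blast
  then have "Rm < of_nat n * \<epsilon>" using \<epsilon>(1) by (simp add: divide_less_eq)
  then have "min Rm (r z0 + of_nat n * \<epsilon>) = Rm" using r(1)[of z0] by simp
  ultimately have "Q Rm" by metis
  then show ?thesis by (simp add: Q_def)
qed

text \<open>The centre lies outside P, so lifts with the same value there agree on nested discs and
  glue.\<close>

lemma global_lift:
  assumes x0: "x0 \<in> T" "f x0 = F z0" and z0: "z0 \<notin> P"
  shows "\<exists>g. is_lift UNIV g \<and> g z0 = x0"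
proof -
  have "\<exists>g. is_lift (ball z0 (real n + 1)) g \<and> g z0 = x0" for n
    by (rule lift_on_balls[OF x0]) simp
  then obtain g where g: "\<And>n. is_lift (ball z0 (real n + 1)) (g n)" "\<And>n. g n z0 = x0" by metis
  have mono: "g n u = g m u" if "n \<le> m" "u \<in> ball z0 (real n + 1)" for n m u
  proof (rule unique[where D = "ball z0 (real n + 1)" and z' = z0])
    show "is_lift (ball z0 (real n + 1)) (g n)" "z0 \<notin> P" "u \<in> ball z0 (real n + 1)"
      by (fact g(1) z0 that(2))+
    show "is_lift (ball z0 (real n + 1)) (g m)"
      using that(1) by (intro is_lift_subset[OF g(1)[of m]] subset_ball) simp
  qed (auto simp: g(2))
  have agree: "g n u = g m u" if "u \<in> ball z0 (real n + 1)" "u \<in> ball z0 (real m + 1)" for n m u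
    using mono[of n m u] mono[of m n u] that by (metis nle_le)
  define n where "n u = nat \<lceil>dist z0 u\<rceil>" for u
  have n: "u \<in> ball z0 (real (n u) + 1)" for u
  proof -
    have "dist z0 u \<le> real (n u)" unfolding n_def by (rule real_nat_ceiling_ge)
    then show ?thesis by simp
  qed
  have "is_lift UNIV (\<lambda>u. g (n u) u)"
  proof (rule is_lift_glue)
    fix u
    show "\<exists>A g'. open A \<and> u \<in> A \<and> is_lift A g' \<and> (\<forall>v\<in>A. g (n v) v = g' v)"
    proof (intro exI conjI ballI)
      show "u \<in> ball z0 (real (n u) + 1)" by (rule n)
      show "is_lift (ball z0 (real (n u) + 1)) (g (n u))" by (rule g(1))
      show "g (n v) v = g (n u) v" if "v \<in> ball z0 (real (n u) + 1)" for v
        by (rule agree[OF n that])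
    qed simp
  qed
  then show ?thesis using g(2) by blast
qed

end

text \<open>One point of Q serves as puncture; the plane stays connected when finitely many further
  points are removed.\<close>

lemma connected_sphere_diff_finite:
  assumes Q: "finite Q" "Q \<noteq> {}" "Q \<subseteq> two_sphere"
  shows "connected (two_sphere - Q)"
proof -
  obtain a where a: "a \<in> Q" using Q(2) by blast
  then have a': "a \<in> two_sphere" using Q(3) by blast
  obtain \<sigma> \<sigma>' where hom: "homeomorphism (UNIV :: complex set) (two_sphere - {a}) \<sigma> \<sigma>'"
    using punctured_sphere_homeomorphism[OF a'] by blast
  note sig = sigma_simps[OF a' hom]
  have eq: "two_sphere - Q = \<sigma> ` (UNIV - \<sigma>' ` (Q - {a}))"
  proof (intro equalityI subsetI)
    fix s assume s: "s \<in> two_sphere - Q"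
    then have ss: "\<sigma> (\<sigma>' s) = s" using sig(4) a by blast
    have "\<sigma>' s \<notin> \<sigma>' ` (Q - {a})"
    proof
      assume "\<sigma>' s \<in> \<sigma>' ` (Q - {a})"
      then obtain t where t: "t \<in> Q" "t \<noteq> a" "\<sigma>' s = \<sigma>' t" by blast
      have "\<sigma> (\<sigma>' t) = t" by (rule sig(4)) (use t Q(3) in blast)+
      then have "s = t" using ss t(3) by simp
      then show False using t(1) s by blast
    qed
    then show "s \<in> \<sigma> ` (UNIV - \<sigma>' ` (Q - {a}))" using ss by (intro image_eqI[of _ _ "\<sigma>' s"]) simp_all
  next
    fix s assume "s \<in> \<sigma> ` (UNIV - \<sigma>' ` (Q - {a}))"
    then obtain w where w: "s = \<sigma> w" "w \<notin> \<sigma>' ` (Q - {a})" by blast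
    have "\<sigma> w \<notin> Q"
    proof
      assume "\<sigma> w \<in> Q"
      then have "\<sigma>' (\<sigma> w) \<in> \<sigma>' ` (Q - {a})" using sig(3) by (intro imageI) simp
      then show False using w(2) sig(1) by simp
    qed
    then show "s \<in> two_sphere - Q" using sig(2) w(1) by blast
  qed
  have "connected (UNIV - \<sigma>' ` (Q - {a}))"
    using Q(1) by (intro connected_open_diff_countable) (auto intro: countable_finite)
  then show ?thesis
    unfolding eq by (rule connected_continuous_image[OF continuous_on_subset[OF sigma_continuous(1)[OF a' hom]], rotated]) simp
qed

section \<open>From a branched cover to the norm form\<close>

locale orbifold_cover = orbifold_map +
  fixes f :: "real^3 \<Rightarrow> real^3" and B :: "(real^3) set" and d :: nat and x0 :: "real^3"
  assumes bc: "branched_cover two_sphere two_sphere f"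
    and cov: "covering_space (two_sphere - f -` B) f (two_sphere - B)"
    and finB: "finite B"
    and branch: "\<And>z. F z \<in> B \<longleftrightarrow> stab z \<noteq> 1"
    and deg_dvd: "\<And>x z. x \<in> two_sphere \<Longrightarrow> f x = F z \<Longrightarrow> \<exists>k. has_local_degree two_sphere two_sphere f x k \<and> k dvd stab z"
    and fibre: "\<And>y. y \<in> two_sphere - B \<Longrightarrow> finite {x \<in> two_sphere. f x = y} \<and> card {x \<in> two_sphere. f x = y} = d"
    and x0: "x0 \<in> two_sphere" "f x0 = F 0" "has_local_degree two_sphere two_sphere f x0 1"
begin

definition P :: "complex set" where "P = {z. stab z \<noteq> 1}"

lemma countable_P: "countable P"
  unfolding P_def by (rule countable_stab_ne_1)

lemma P_iff: "z \<in> P \<longleftrightarrow> F z \<in> B"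
  by (simp add: P_def branch)

sublocale local_lifting F two_sphere f P
  by unfold_locales (rule countable_P)

lemma f_facts: "continuous_on two_sphere f" "f ` two_sphere \<subseteq> two_sphere"
  using bc by (auto simp: branched_cover_def)

text \<open>In charts f is v ^ k and F is h ^ e with e = k * l. If \<theta> changes the target chart
  of F into that of f and q is a continuous k-th root of \<theta> (w ^ k), then t = q (h ^ l)
  satisfies t ^ k = \<omega> (F u), so it is a lift in the source chart. A k-th root of unity c
  steers it through any prescribed x'.\<close>

lemma local_lift_at:
  assumes x: "x \<in> two_sphere" "f x = F z"
  shows "\<exists>r U'. r > 0 \<and> openin (top_of_set two_sphere) U' \<and> x \<in> U' \<and>
    (\<forall>z'\<in>ball z r. \<forall>x'\<in>U'. f x' = F z' \<longrightarrow> (\<exists>g. is_lift (ball z r) g \<and> g z' = x'))"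
proof -
  define e where "e = stab z"
  obtain k where deg: "has_local_degree two_sphere two_sphere f x k" and kdvd: "k dvd e"
    using deg_dvd[OF x] e_def by blast
  obtain U \<phi> W \<omega> where k: "k \<ge> 1" and U: "surface_chart two_sphere U \<phi>" "x \<in> U" "\<phi> x = 0"
    and W: "surface_chart two_sphere W \<omega>" "f ` U \<subseteq> W" "\<omega> (f x) = 0"
    and f\<phi>: "\<And>u. u \<in> U \<Longrightarrow> \<omega> (f u) = \<phi> u ^ k"
    using deg unfolding has_local_degree_def by blast
  obtain r0 h V \<psi> where "local_form z e r0 h V \<psi>" using local_form_stab e_def by metis
  note lf = local_formD[OF this]
  obtain \<delta> where \<delta>: "\<delta> > 0" "ball 0 \<delta> \<subseteq> \<phi> ` U"
    using surface_chart_open_image[OF U(1)] U(2,3) by (metis image_eqI open_contains_ball)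
  define U' where "U' = U \<inter> \<phi> -` ball 0 \<delta>"
  have U': "openin (top_of_set two_sphere) U'" "x \<in> U'"
    unfolding U'_def using surface_chart_openin_preimage[OF U(1)] U(2,3) \<delta>(1) by auto
  have zr0: "z \<in> ball z r0" using lf(2) by simp
  have FzV: "F z \<in> V" using lf(7) zr0 by blast
  have FzW: "F z \<in> W" using W(2) U(2) x(2) by (metis imageI subsetD)
  have \<omega>Fz: "\<omega> (F z) = 0" using W(3) x(2) by simp
  have \<psi>Fz: "\<psi> (F z) = 0" using lf(8)[OF zr0] lf(1,5) by (simp add: power_0_left)
  \<comment> \<open>Values at which both target charts are defined and all k-th roots stay inside
    the source chart of f.\<close>
  define Y where "Y = V \<inter> (W \<inter> \<omega> -` ball 0 (\<delta> ^ k))"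
  have Yop: "openin (top_of_set two_sphere) Y"
    unfolding Y_def
    by (intro openin_Int surface_chart_openin[OF lf(6)] surface_chart_openin_preimage[OF W(1)]) simp
  have YV: "Y \<subseteq> V" by (auto simp: Y_def)
  have "open (\<psi> ` Y)" by (rule surface_chart_open_image_openin[OF lf(6) Yop YV])
  moreover have "F z \<in> Y" using FzV FzW \<omega>Fz \<delta>(1) by (simp add: Y_def)
  then have "0 \<in> \<psi> ` Y" using \<psi>Fz by (metis imageI)
  ultimately obtain \<rho> where \<rho>: "\<rho> > 0" "ball 0 \<rho> \<subseteq> \<psi> ` Y" by (meson open_contains_ball)
  define \<theta> where "\<theta> w = \<omega> (inv_into V \<psi> w)" for w
  note inj\<psi> = surface_chart_inj[OF lf(6)] and inj\<omega> = surface_chart_inj[OF W(1)]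
    and inj\<phi> = surface_chart_inj[OF U(1)]
  have inv\<psi>: "inv_into V \<psi> (\<psi> y) = y" if "y \<in> V" for y
    using inv_into_f_f[OF inj\<psi> that] .
  have invY: "inv_into V \<psi> w \<in> Y" if w: "w \<in> ball 0 \<rho>" for w
  proof -
    have "w \<in> \<psi> ` Y" using w \<rho>(2) by blast
    then obtain y where "y \<in> Y" "w = \<psi> y" by (rule imageE)
    then show ?thesis using inv\<psi> YV by (metis subsetD)
  qed
  obtain R q where R: "R > 0" and q: "continuous_on (ball 0 R) q"
    "\<And>w. w \<in> ball 0 R \<Longrightarrow> w ^ k \<in> ball 0 \<rho> \<and> q w ^ k = \<theta> (w ^ k)"
  proof (rule continuous_root_of_power_pullback[OF \<rho>(1)])
    show "continuous_on (ball 0 \<rho>) \<theta>"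
    proof -
      have "continuous_on (ball 0 \<rho>) (inv_into V \<psi>)"
        using continuous_on_subset[OF surface_chart_continuous_inv[OF lf(6)]] \<rho>(2) YV by blast
      moreover have "inv_into V \<psi> ` ball 0 \<rho> \<subseteq> W" using invY by (auto simp: Y_def)
      ultimately show ?thesis
        unfolding \<theta>_def[abs_def] using continuous_on_compose2[OF surface_chart_continuous[OF W(1)]] by blast
    qed
    show "\<theta> 0 = 0" using inv\<psi>[OF FzV] \<psi>Fz \<omega>Fz by (simp add: \<theta>_def)
    show "\<theta> w \<noteq> 0" if w: "w \<in> ball 0 \<rho>" "w \<noteq> 0" for w
    proof
      assume "\<theta> w = 0"
      then have "\<omega> (inv_into V \<psi> w) = \<omega> (F z)" using \<omega>Fz by (simp add: \<theta>_def)
      moreover have "inv_into V \<psi> w \<in> W" using invY[OF w(1)] by (simp add: Y_def)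
      ultimately have "inv_into V \<psi> w = F z" using inj\<omega> FzW by (meson inj_onD)
      moreover have "w \<in> \<psi> ` V" using w(1) \<rho>(2) YV by blast
      ultimately have "w = \<psi> (F z)" by (metis f_inv_into_f)
      then show False using \<psi>Fz w(2) by simp
    qed
  qed (use k in \<open>blast+\<close>)
  obtain l where l: "e = k * l" using kdvd by (rule dvdE)
  have l1: "l \<ge> 1" using l lf(1) by (cases l) auto
  have conth: "continuous_on (ball z r0) h" using lf(3) holomorphic_on_imp_continuous_on by blast
  have "open (ball z r0 \<inter> (\<lambda>u. h u ^ l) -` ball 0 R)"
    using conth by (intro continuous_open_preimage continuous_intros) auto
  moreover have "z \<in> ball z r0 \<inter> (\<lambda>u. h u ^ l) -` ball 0 R"
    using zr0 lf(5) R l1 by (simp add: power_0_left)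
  ultimately obtain r where r: "r > 0" "ball z r \<subseteq> ball z r0 \<inter> (\<lambda>u. h u ^ l) -` ball 0 R"
    by (meson open_contains_ball)
  define t where "t u = q (h u ^ l)" for u
  have hR: "h u ^ l \<in> ball 0 R" and ur0: "u \<in> ball z r0" if "u \<in> ball z r" for u using r(2) that by auto
  have t_cont: "continuous_on (ball z r) t"
    unfolding t_def[abs_def]
    by (rule continuous_on_compose2[OF q(1)])
      (use hR ur0 conth in \<open>auto intro!: continuous_intros intro: continuous_on_subset\<close>)
  have FY: "F u \<in> Y" and t_pow: "t u ^ k = \<omega> (F u)" if u: "u \<in> ball z r" for u
  proof -
    have eq: "(h u ^ l) ^ k = \<psi> (F u)"
      using lf(8)[OF ur0[OF u]] l by (simp add: power_mult[symmetric] mult.commute)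
    have FuV: "F u \<in> V" using lf(7) ur0[OF u] by blast
    have "\<psi> (F u) \<in> ball 0 \<rho>" using q(2)[OF hR[OF u]] eq by simp
    then show "F u \<in> Y" using invY inv\<psi>[OF FuV] by metis
    show "t u ^ k = \<omega> (F u)" using q(2)[OF hR[OF u]] inv\<psi>[OF FuV] unfolding eq by (simp add: t_def \<theta>_def)
  qed
  have t_small: "norm (t u) < \<delta>" if u: "u \<in> ball z r" for u
  proof -
    have "norm (t u) ^ k < \<delta> ^ k" using FY[OF u] t_pow[OF u] by (simp add: Y_def norm_power[symmetric])
    then show ?thesis using \<delta>(1) by (simp add: power_less_imp_less_base)
  qed
  have "\<exists>g. is_lift (ball z r) g \<and> g z' = x'" if z': "z' \<in> ball z r" and x': "x' \<in> U'" "f x' = F z'" for z' x'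
  proof -
    have x'U: "x' \<in> U" using x'(1) by (simp add: U'_def)
    have pow: "\<phi> x' ^ k = t z' ^ k" using f\<phi>[OF x'U] x'(2) t_pow[OF z'] by simp
    obtain c where c: "c ^ k = 1" "\<phi> x' = c * t z'"
    proof (cases "t z' = 0")
      case True
      then have "\<phi> x' ^ k = 0" using pow k by (simp add: power_0_left)
      then have "\<phi> x' = 0" by simp
      then show ?thesis using that[of 1] True by simp
    next
      case False
      have "(\<phi> x' / t z') ^ k = 1" unfolding power_divide pow using False by simp
      then show ?thesis using that[of "\<phi> x' / t z'"] False by simp
    qed
    have "norm c ^ k = 1" using c(1) by (metis norm_one norm_power)
    then have c1: "norm c = 1" using k power_eq_imp_eq_base[of "norm c" k 1] by simp
    have ct: "c * t u \<in> \<phi> ` U" if "u \<in> ball z r" for u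
      using t_small[OF that] \<delta>(2) c1 by (intro subsetD[OF \<delta>(2)]) (simp add: norm_mult)
    define g where "g u = inv_into U \<phi> (c * t u)" for u
    have gU: "g u \<in> U" and \<phi>g: "\<phi> (g u) = c * t u" if "u \<in> ball z r" for u
      unfolding g_def using ct[OF that] by (auto intro: inv_into_into f_inv_into_f)
    have "continuous_on (ball z r) g"
      unfolding g_def[abs_def]
      by (rule continuous_on_compose2[OF surface_chart_continuous_inv[OF U(1)]])
        (use ct in \<open>auto intro!: continuous_intros t_cont\<close>)
    moreover have "f (g u) = F u" if u: "u \<in> ball z r" for u
    proof -
      have "\<omega> (f (g u)) = (c * t u) ^ k" using f\<phi>[OF gU[OF u]] \<phi>g[OF u] by simp
      also have "\<dots> = \<omega> (F u)" using c(1) t_pow[OF u] by (simp add: power_mult_distrib)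
      finally have "\<omega> (f (g u)) = \<omega> (F u)" .
      moreover have "f (g u) \<in> W" using W(2) gU[OF u] by blast
      moreover have "F u \<in> W" using FY[OF u] by (simp add: Y_def)
      ultimately show ?thesis using inj\<omega> by (meson inj_onD)
    qed
    moreover have "g u \<in> two_sphere" if "u \<in> ball z r" for u
      using gU[OF that] surface_chart_subset[OF U(1)] by blast
    ultimately have "is_lift (ball z r) g" unfolding is_lift_def by blast
    moreover have "g z' = x'" unfolding g_def c(2)[symmetric] by (rule inv_into_f_f[OF inj\<phi> x'U])
    ultimately show ?thesis by blast
  qed
  then show ?thesis using r(1) U' by blast
qed

text \<open>The fibre over F z is finite, and by compactness all points over nearby values lie in
  the neighbourhoods of its points; the minimum of the radii then works for all.\<close>

lemma local_lift:
  "\<exists>r>0. \<forall>z'\<in>ball z r. \<forall>x\<in>two_sphere. f x = F z' \<longrightarrow> (\<exists>g. is_lift (ball z r) g \<and> g z' = x)"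
proof -
  define X where "X = {x \<in> two_sphere. f x = F z}"
  have finX: "finite X" unfolding X_def by (rule branched_cover_finite_fibre[OF bc])
  have "\<forall>x\<in>X. \<exists>r U'. r > 0 \<and> openin (top_of_set two_sphere) U' \<and> x \<in> U' \<and>
    (\<forall>z'\<in>ball z r. \<forall>x'\<in>U'. f x' = F z' \<longrightarrow> (\<exists>g. is_lift (ball z r) g \<and> g z' = x'))"
    using local_lift_at[of _ z] unfolding X_def by simp
  then obtain r U' where rU: "\<And>x. x \<in> X \<Longrightarrow> r x > 0" "\<And>x. x \<in> X \<Longrightarrow> openin (top_of_set two_sphere) (U' x)"
    "\<And>x. x \<in> X \<Longrightarrow> x \<in> U' x"
    and lift: "\<And>x z' x'. x \<in> X \<Longrightarrow> z' \<in> ball z (r x) \<Longrightarrow> x' \<in> U' x \<Longrightarrow> f x' = F z' \<Longrightarrow>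
      \<exists>g. is_lift (ball z (r x)) g \<and> g z' = x'"
    unfolding bchoice_iff by metis
  define C where "C = f ` (two_sphere - (\<Union>x\<in>X. U' x))"
  have "closedin (top_of_set two_sphere) (two_sphere - (\<Union>x\<in>X. U' x))"
    using rU(2) by (intro closedin_diff) auto
  then have "compact (two_sphere - (\<Union>x\<in>X. U' x))"
    using closedin_compact[OF compact_sphere] by blast
  then have "compact C"
    unfolding C_def by (intro compact_continuous_image continuous_on_subset[OF f_facts(1)]) auto
  then have "open (F -` (- C))"
    using F_continuous by (simp add: compact_imp_closed open_Compl continuous_on_open_vimage[OF open_UNIV])
  moreover have "z \<in> F -` (- C)"
  proof -
    have "F z \<notin> C"
    proof
      assume "F z \<in> C"
      then obtain y where "y \<in> two_sphere - (\<Union>x\<in>X. U' x)" "F z = f y" unfolding C_def by (rule imageE)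
      then show False using rU(3)[of y] by (auto simp: X_def)
    qed
    then show ?thesis by simp
  qed
  ultimately obtain r1 where r1: "r1 > 0" "ball z r1 \<subseteq> F -` (- C)" by (meson open_contains_ball)
  define r2 where "r2 = Min (insert r1 (r ` X))"
  have r2: "r2 > 0" "r2 \<le> r1" "\<And>x. x \<in> X \<Longrightarrow> r2 \<le> r x"
    using finX r1(1) rU(1) by (auto simp: r2_def)
  have "\<exists>g. is_lift (ball z r2) g \<and> g z' = x" if z': "z' \<in> ball z r2" and x: "x \<in> two_sphere" "f x = F z'" for z' x
  proof -
    have "z' \<in> ball z r1" using z' r2(2) by auto
    then have "F z' \<notin> C" using r1(2) by blast
    then have "x \<in> (\<Union>x\<in>X. U' x)" using x unfolding C_def by (metis DiffI imageI)
    then obtain y where y: "y \<in> X" "x \<in> U' y" by blast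
    have sub: "ball z r2 \<subseteq> ball z (r y)" by (rule subset_ball[OF r2(3)[OF y(1)]])
    obtain g where "is_lift (ball z (r y)) g" "g z' = x"
      using lift[OF y(1) _ y(2) x(2)] z' sub by blast
    then show ?thesis using is_lift_subset[OF _ sub] by blast
  qed
  then show ?thesis using r2(1) by blast
qed

text \<open>Off P both lifts go through a covering, and D - P stays connected because P is
  countable. The set where they differ is open, so if nonempty it would contain a point outside
  P.\<close>

lemma unique_lift:
  assumes D: "open D" "connected D" and g: "is_lift D g1" "is_lift D g2"
    and z': "z' \<in> D" "z' \<notin> P" "g1 z' = g2 z'" and u: "u \<in> D"
  shows "g1 u = g2 u"
proof -
  have conn: "connected (D - P)"
    using D countable_P by (intro connected_open_diff_countable) auto
  have c1: "continuous_on D g1" "continuous_on D g2" using g by (auto simp: is_lift_def)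
  have eqP: "g1 v = g2 v" if v: "v \<in> D - P" for v
  proof (rule covering_space_lift_unique[OF cov, where a = z' and T = "D - P" and f = F and x = v
        and ?g1.0 = g1 and ?g2.0 = g2])
    show "g1 z' = g2 z'" by fact
    show "continuous_on (D - P) F" using F_continuous continuous_on_subset by blast
    show "F \<in> D - P \<rightarrow> two_sphere - B" using F_in P_iff by auto
    show "continuous_on (D - P) g1" "continuous_on (D - P) g2" using c1 continuous_on_subset by blast+
    show "g1 \<in> D - P \<rightarrow> two_sphere - f -` B" "g2 \<in> D - P \<rightarrow> two_sphere - f -` B"
      using g P_iff unfolding is_lift_def by auto
    show "F y = f (g1 y)" "F y = f (g2 y)" if "y \<in> D - P" for y
      using g that unfolding is_lift_def by auto
  qed (use conn z' v in auto)
  show ?thesis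
  proof (rule ccontr)
    assume ne: "g1 u \<noteq> g2 u"
    have "open (D \<inter> (\<lambda>v. g1 v - g2 v) -` (- {0}))"
      using D(1) c1 by (intro continuous_open_preimage continuous_intros) auto
    moreover have "D \<inter> (\<lambda>v. g1 v - g2 v) -` (- {0}) \<noteq> {}" using ne u by auto
    ultimately obtain v where "v \<in> D \<inter> (\<lambda>v. g1 v - g2 v) -` (- {0})" "v \<notin> P"
      by (rule exists_outside_countable[OF _ _ countable_P])
    then show False using eqP[of v] by simp
  qed
qed

sublocale unique_lifting F two_sphere f P
  by unfold_locales (rule local_lift, rule unique_lift)

text \<open>0 belongs to P, so \<open>global_lift\<close> cannot start there. A local lift supplies
  a start outside P, and uniqueness returns the value at 0.\<close>

lemma global_lift_at_0:
  obtains G where "is_lift UNIV G" "G 0 = x0"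
proof -
  obtain r where r: "r > 0" "\<And>z' x. z' \<in> ball 0 r \<Longrightarrow> x \<in> two_sphere \<Longrightarrow> f x = F z' \<Longrightarrow>
      \<exists>g. is_lift (ball 0 r) g \<and> g z' = x"
    using local_lift[of 0] by blast
  have 0: "(0::complex) \<in> ball 0 r" using r(1) by simp
  obtain g where g: "is_lift (ball 0 r) g" "g 0 = x0" using r(2)[OF 0 x0(1,2)] by blast
  obtain z1 where z1: "z1 \<in> ball 0 r" "z1 \<notin> P"
    using exists_outside_countable[OF open_ball _ countable_P, of "0::complex" r] 0 by blast
  have "g z1 \<in> two_sphere" "f (g z1) = F z1" using g(1) z1(1) by (auto simp: is_lift_def)
  then obtain G where G: "is_lift UNIV G" "G z1 = g z1" using global_lift[OF _ _ z1(2)] by blast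
  have "G 0 = g 0"
    by (rule unique_lift[OF open_ball connected_ball is_lift_subset[OF G(1)] g(1) z1 G(2) 0]) simp
  then show ?thesis using that G(1) g(2) by simp
qed

lemma degree_norm_form: "\<exists>x y :: nat. d = x\<^sup>2 + x * y + y\<^sup>2"
proof -
  obtain G where G: "is_lift UNIV G" "G 0 = x0" by (rule global_lift_at_0)
  have Gcont: "continuous_on UNIV G" and GS: "G u \<in> two_sphere" and fG: "f (G u) = F u" for u
    using G(1) by (auto simp: is_lift_def)
  have lift_affine: "is_lift UNIV (\<lambda>u. G (a * u + c))" if "\<And>u. F (a * u + c) = F u" for a c
    unfolding is_lift_def using GS fG that
    by (intro conjI ballI continuous_on_compose2[OF Gcont] continuous_intros) auto
  have uniq: "g1 = g2" if "is_lift UNIV g1" "is_lift UNIV g2" "w \<notin> P" "g1 w = g2 w" for g1 g2 w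
    using unique_lift[OF open_UNIV connected_UNIV that(1,2) UNIV_I that(3,4) UNIV_I] by blast
  have trans: "is_lift UNIV (\<lambda>u. G (u + l))" if "l \<in> eisenstein" for l
    using lift_affine[of 1 l] F_orbit_rel[OF orbit_rel_translate[OF that]] by simp
  \<comment> \<open>Near 0 both G u and G (\<zeta> * u) lie where f is injective and have the same
    image under f; one common value outside P suffices.\<close>
  have Gzeta: "G (\<zeta> * u) = G u" for u
  proof -
    have lz: "is_lift UNIV (\<lambda>u. G (\<zeta> * u))"
      using lift_affine[of \<zeta> 0] F_orbit_rel[OF orbit_rel_rotate[of _ 1]] by simp
    obtain U where U: "openin (top_of_set two_sphere) U" "x0 \<in> U" "inj_on f U"
      by (rule has_local_degree_1_inj[OF x0(3)])
    obtain O' where O': "open O'" "U = two_sphere \<inter> O'" using U(1) by (auto simp: openin_open)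
    have "open (G -` O' \<inter> (\<lambda>u. G (\<zeta> * u)) -` O')"
      using O'(1) Gcont lz
      by (intro open_Int) (auto simp: is_lift_def continuous_on_open_vimage[OF open_UNIV])
    moreover have "0 \<in> G -` O' \<inter> (\<lambda>u. G (\<zeta> * u)) -` O'" using G(2) U(2) O'(2) by simp
    then have "G -` O' \<inter> (\<lambda>u. G (\<zeta> * u)) -` O' \<noteq> {}" by blast
    ultimately obtain u1 where u1: "u1 \<in> G -` O' \<inter> (\<lambda>u. G (\<zeta> * u)) -` O'" "u1 \<notin> P"
      by (rule exists_outside_countable[OF _ _ countable_P])
    have "G (\<zeta> * u1) \<in> U" "G u1 \<in> U" using u1(1) O'(2) GS by auto
    moreover have "f (G (\<zeta> * u1)) = f (G u1)"
      using fG F_orbit_rel[OF orbit_rel_rotate[of u1 1]] by simp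
    ultimately have "G (\<zeta> * u1) = G u1" using U(3) by (meson inj_onD)
    then have "(\<lambda>u. G (\<zeta> * u)) = G" by (rule uniq[OF lz G(1) u1(2)])
    then show ?thesis by (rule fun_cong)
  qed
  have Gzeta_pow: "G (\<zeta> ^ j * u) = G u" for j u
    by (induction j) (simp_all add: mult.assoc Gzeta)
  obtain w0 where w0: "w0 \<notin> P"
    using exists_outside_countable[OF open_UNIV _ countable_P] by blast
  define X where "X = {x \<in> two_sphere. f x = F w0}"
  have X: "finite X" "card X = d"
    using fibre[of "F w0"] F_in[of w0] w0 P_iff unfolding X_def by auto
  \<comment> \<open>The image of G off P is open and closed in the sphere without the points over B,
    which is connected.\<close>
  have surj: "\<exists>z. x = G z" if x: "x \<in> X" for x
  proof -
    define Q where "Q = two_sphere \<inter> f -` B"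
    have "Q = (\<Union>y\<in>B. {x \<in> two_sphere. f x = y})" by (auto simp: Q_def)
    then have finQ: "finite Q" using finB branched_cover_finite_fibre[OF bc] by simp
    \<comment> \<open>This makes Q nonempty, as \<open>connected_sphere_diff_finite\<close>
      demands.\<close>
    have "0 \<in> P" by (simp add: P_def stab_0)
    then have "x0 \<in> Q" using x0(1,2) P_iff by (simp add: Q_def)
    then have connW: "connected (two_sphere - Q)"
      by (intro connected_sphere_diff_finite finQ) (auto simp: Q_def)
    define V where "V = G ` (- P)"
    have GQ: "G u \<in> Q \<longleftrightarrow> u \<in> P" for u using GS fG P_iff by (simp add: Q_def)
    have VW: "V \<subseteq> two_sphere - Q" using GS GQ by (auto simp: V_def)
    have openP: "open (- P)"
    proof -
      have "P = F -` B" using P_iff by auto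
      then have "- P = F -` (- B)" by auto
      then show ?thesis
        using finB F_continuous by (simp add: finite_imp_closed open_Compl continuous_on_open_vimage[OF open_UNIV])
    qed
    have "openin (top_of_set two_sphere) V"
    proof (subst openin_subopen, intro ballI)
      fix v assume "v \<in> V"
      then obtain z where z: "z \<notin> P" "v = G z" by (auto simp: V_def)
      obtain U where U: "openin (top_of_set two_sphere) U" "v \<in> U" "inj_on f U"
      proof -
        obtain k where "has_local_degree two_sphere two_sphere f v k" "k dvd stab z"
          using deg_dvd[of v z] GS fG z(2) by blast
        then have "has_local_degree two_sphere two_sphere f v 1" using z(1) by (simp add: P_def)
        then show ?thesis using that by (rule has_local_degree_1_inj)
      qed
      obtain O' where O': "open O'" "U = two_sphere \<inter> O'" using U(1) by (auto simp: openin_open)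
      define N where "N = G -` O' \<inter> - P"
      have "open N" unfolding N_def using openP O'(1) Gcont
        by (intro open_Int) (auto simp: continuous_on_open_vimage[OF open_UNIV])
      then have "openin (top_of_set two_sphere) (F ` N)" by (rule F_open_map)
      then have "openin (top_of_set two_sphere) (two_sphere \<inter> f -` (F ` N))"
        using f_facts by (metis continuous_on_open_gen image_subset_iff_funcset)
      then have op: "openin (top_of_set two_sphere) (U \<inter> (two_sphere \<inter> f -` (F ` N)))"
        by (rule openin_Int[OF U(1)])
      have "z \<in> N" using z U(2) O'(2) by (simp add: N_def)
      then have "v \<in> U \<inter> (two_sphere \<inter> f -` (F ` N))"
        using U(2) z(2) GS fG by auto
      moreover have "U \<inter> (two_sphere \<inter> f -` (F ` N)) \<subseteq> V"
      proof
        fix y assume y: "y \<in> U \<inter> (two_sphere \<inter> f -` (F ` N))"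
        then have "f y \<in> F ` N" by simp
        then obtain n where n: "f y = F n" "n \<in> N" by (rule imageE)
        have "G n \<in> U" using n(2) GS O'(2) by (simp add: N_def)
        moreover have "f (G n) = f y" using fG n(1) by simp
        moreover have "y \<in> U" using y by blast
        ultimately have "G n = y" using U(3) by (meson inj_onD)
        then show "y \<in> V" using n(2) by (auto simp: V_def N_def)
      qed
      ultimately show "\<exists>T. openin (top_of_set two_sphere) T \<and> v \<in> T \<and> T \<subseteq> V" using op by blast
    qed
    then have opV: "openin (top_of_set (two_sphere - Q)) V"
      by (rule openin_subset_trans[OF _ VW]) blast
    \<comment> \<open>Translates of G are told apart by their values at w0, which lie in a finite
      fibre. So finitely many images of the unit disc make up the range of G, which is therefore
      compact.\<close>
    define Ls where "Ls = (\<lambda>l u. G (u + l)) ` eisenstein"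
    have "inj_on (\<lambda>g. g w0) Ls"
    proof (rule inj_onI)
      fix g1 g2 assume "g1 \<in> Ls" "g2 \<in> Ls" "g1 w0 = g2 w0"
      then show "g1 = g2" using uniq[OF _ _ w0] trans unfolding Ls_def by blast
    qed
    moreover have "(\<lambda>g. g w0) ` Ls \<subseteq> X"
      using GS fG F_orbit_rel[OF orbit_rel_translate, of _ w0] by (auto simp: Ls_def X_def)
    ultimately have finLs: "finite Ls" using X(1) by (meson finite_imageD finite_subset)
    have "range G = (\<Union>g\<in>Ls. g ` cball 0 1)"
    proof (intro equalityI subsetI)
      fix y assume "y \<in> range G"
      then obtain z where z: "y = G z" by blast
      obtain l where l: "l \<in> eisenstein" "norm (z - l) < 1" by (rule nearest_eisenstein)
      then have "y = (\<lambda>u. G (u + l)) (z - l)" "z - l \<in> cball 0 1" using z by simp_all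
      then show "y \<in> (\<Union>g\<in>Ls. g ` cball 0 1)" using l(1) unfolding Ls_def by blast
    qed (auto simp: Ls_def)
    moreover have "compact (\<Union>g\<in>Ls. g ` cball 0 1)"
    proof (rule compact_UN[OF finLs])
      fix g assume "g \<in> Ls"
      then have "continuous_on UNIV g" using trans unfolding Ls_def is_lift_def by blast
      then have "continuous_on (cball 0 1) g" by (rule continuous_on_subset) simp
      then show "compact (g ` cball 0 1)" by (rule compact_continuous_image[OF _ compact_cball])
    qed
    ultimately have "closed (range G)" by (simp add: compact_imp_closed)
    moreover have "V = (two_sphere - Q) \<inter> range G" using VW GQ by (auto simp: V_def)
    ultimately have clV: "closedin (top_of_set (two_sphere - Q)) V"
      by (simp add: closedin_closed_Int)
    have "V = {} \<or> V = two_sphere - Q"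
      using connW opV clV unfolding connected_clopen by (elim allE[of _ V]) (rule mp, assumption, rule conjI)
    moreover have "V \<noteq> {}" using w0 by (auto simp: V_def)
    ultimately have "V = two_sphere - Q" by blast
    moreover have "x \<in> two_sphere - Q" using x w0 P_iff by (simp add: X_def Q_def)
    ultimately show ?thesis by (auto simp: V_def)
  qed
  define I where "I = {l \<in> eisenstein. \<forall>u. G (u + l) = G u}"
  obtain \<alpha> where \<alpha>: "\<alpha> \<in> eisenstein" "I = (*) \<alpha> ` eisenstein"
  proof (rule eisenstein_ideal_principal[of I])
    show "I \<subseteq> eisenstein" "0 \<in> I" by (auto simp: I_def)
    show "a - b \<in> I" if a: "a \<in> I" and b: "b \<in> I" for a b
    proof -
      have Gb: "G (v + b) = G v" for v using b unfolding I_def by blast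
      have "G (u + (a - b)) = G u" for u
      proof -
        have "G (u + (a - b)) = G ((u - b) + a)" by (simp add: algebra_simps)
        also have "\<dots> = G (u - b)" using a unfolding I_def by blast
        also have "\<dots> = G ((u - b) + b)" by (rule Gb[symmetric])
        finally show ?thesis by simp
      qed
      then show ?thesis using a b by (simp add: I_def)
    qed
    \<comment> \<open>Turn the argument by the inverse of \<zeta>, apply the period a, and turn
      back.\<close>
    show "\<zeta> * a \<in> I" if a: "a \<in> I" for a
    proof -
      have "G (u + \<zeta> * a) = G u" for u
      proof -
        have "u = \<zeta> * (u / \<zeta>)" by simp
        then have "u + \<zeta> * a = \<zeta> * (u / \<zeta> + a)" by (simp add: distrib_left)
        then have "G (u + \<zeta> * a) = G (u / \<zeta> + a)" using Gzeta by simp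
        also have "\<dots> = G (u / \<zeta>)" using a unfolding I_def by blast
        also have "\<dots> = G (\<zeta> * (u / \<zeta>))" by (rule Gzeta[symmetric])
        finally show ?thesis by simp
      qed
      then show ?thesis using a by (simp add: I_def)
    qed
  qed blast
  define g where "g l = G (w0 + l)" for l
  have gX: "g ` eisenstein = X"
  proof (intro equalityI subsetI)
    fix x assume "x \<in> g ` eisenstein"
    then obtain l where l: "x = g l" "l \<in> eisenstein" by (rule imageE)
    then show "x \<in> X"
      using GS fG F_orbit_rel[OF orbit_rel_translate[OF l(2)], of w0] by (simp add: g_def X_def)
  next
    fix x assume x: "x \<in> X"
    then obtain z where z: "x = G z" using surj by blast
    then have "F z = F w0" using x fG by (simp add: X_def)
    then have "orbit_rel w0 z" using F_eq_iff orbit_rel_sym by blast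
    then obtain j l where l: "l \<in> eisenstein" "z = \<zeta> ^ j * w0 + l" by (auto simp: orbit_rel_def)
    \<comment> \<open>The rotation relating w0 to z is absorbed by G, leaving a translation by
      m.\<close>
    define m where "m = l / \<zeta> ^ j"
    have lm: "l = \<zeta> ^ j * m" by (simp add: m_def)
    then have m: "m \<in> eisenstein" using l(1) eisenstein_zeta_power_mult_iff by simp
    have "z = \<zeta> ^ j * (w0 + m)" using l(2) lm by (simp add: distrib_left)
    then have "x = g m" using z Gzeta_pow by (simp add: g_def)
    then show "x \<in> g ` eisenstein" using m by blast
  qed
  have g_iff: "g l = g m \<longleftrightarrow> l - m \<in> (*) \<alpha> ` eisenstein" if lm: "l \<in> eisenstein" "m \<in> eisenstein" for l m
    unfolding \<alpha>(2)[symmetric]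
  proof
    assume "g l = g m"
    then have eq: "(\<lambda>u. G (u + l)) = (\<lambda>u. G (u + m))"
      by (intro uniq[OF trans[OF lm(1)] trans[OF lm(2)] w0]) (simp add: g_def)
    have "G (u + (l - m)) = G u" for u
      using fun_cong[OF eq, of "u - m"] by (simp add: algebra_simps)
    then show "l - m \<in> I" using lm by (simp add: I_def)
  next
    assume "l - m \<in> I"
    then have "G ((w0 + m) + (l - m)) = G (w0 + m)" unfolding I_def by blast
    then show "g l = g m" by (simp add: g_def algebra_simps)
  qed
  \<comment> \<open>Without nonzero periods the infinite lattice would embed into a finite
    fibre.\<close>
  have \<alpha>0: "\<alpha> \<noteq> 0"
  proof
    assume "\<alpha> = 0"
    then have "inj_on g eisenstein" using g_iff by (auto intro!: inj_onI)
    then have "finite eisenstein" using gX X(1) finite_imageD by blast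
    then have "finite (range (of_nat :: nat \<Rightarrow> complex))" by (rule finite_subset[rotated]) auto
    then show False using infinite_UNIV_nat by (simp add: finite_image_iff inj_of_nat)
  qed
  have "real d = (norm \<alpha>)\<^sup>2"
    using card_eisenstein_quotient[OF \<alpha>(1) \<alpha>0 gX g_iff] X(2) by simp
  moreover obtain m n where mn: "\<alpha> = of_int m + of_int n * \<zeta>" using \<alpha>(1) unfolding eisenstein_def by blast
  ultimately have "real d = of_int (m\<^sup>2 + m * n + n\<^sup>2)" using norm_sq_eisenstein by simp
  then have "int d = m\<^sup>2 + m * n + n\<^sup>2" by (metis of_int_eq_iff of_int_of_nat_eq)
  moreover obtain x y :: nat where "m\<^sup>2 + m * n + n\<^sup>2 = int (x\<^sup>2 + x * y + y\<^sup>2)" by (rule norm_form_nat)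
  ultimately have "d = x\<^sup>2 + x * y + y\<^sup>2" by (simp only: of_nat_eq_iff)
  then show ?thesis by blast
qed

end

text \<open>The orders 2 and 3 differ, so the points lie in different orbits, and F with an
  arbitrary puncture separates orbits. The inequality allows \<sigma> to be prescribed at both
  values before F is fixed.\<close>

lemma eisenstein_sum_half_ne_third: "eisenstein_sum (1 / 2) \<noteq> eisenstein_sum third_point"
proof -
  define b :: "real^3" where "b = axis 1 1"
  have b: "b \<in> two_sphere" by (simp add: b_def)
  obtain \<sigma> \<sigma>' where hom: "homeomorphism (UNIV :: complex set) (two_sphere - {b}) \<sigma> \<sigma>'"
    using punctured_sphere_homeomorphism[OF b] by blast
  interpret orbifold_map b \<sigma> \<sigma>' by unfold_locales (use b hom in auto)
  have "stab (1 / 2) \<noteq> stab third_point" unfolding stab_half stab_third by simp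
  then have "F (1 / 2) \<noteq> F third_point" unfolding F_eq_iff using stab_orbit_rel by blast
  then show ?thesis
    unfolding F_def using half_notin_eisenstein third_point_notin_eisenstein by metis
qed

text \<open>The lengths 3 * k + 1, 2 * k + 1 and k + 1 add up to d + 2, and 2 - (d + 2) = d * (2 -
  3).\<close>

lemma candidate_2_3_6:
  assumes "k \<ge> 1"
  shows "candidate_surface_branched_cover two_sphere two_sphere (6 * k + 1)
    {# add_mset 1 (replicate_mset (3 * k) 2), add_mset 1 (replicate_mset (2 * k) 3),
       add_mset 1 (replicate_mset k 6) #}"
  unfolding candidate_surface_branched_cover_def
proof (intro conjI)
  show "\<forall>P\<in>#{# add_mset 1 (replicate_mset (3 * k) 2), add_mset 1 (replicate_mset (2 * k) 3),
       add_mset 1 (replicate_mset k 6) #}. partition_of (6 * k + 1) P"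
    by (simp add: partition_of_def)
qed (use assms in \<open>simp_all add: closed_connected_orientable_surface_two_sphere euler_char_two_sphere algebra_simps\<close>)

lemma norm_form_if_realizable:
  assumes k: "k \<ge> 1" and real: "realizable two_sphere two_sphere (6 * k + 1)
    {# add_mset 1 (replicate_mset (3 * k) 2), add_mset 1 (replicate_mset (2 * k) 3),
       add_mset 1 (replicate_mset k 6) #}"
  shows "\<exists>x y :: nat. 6 * k + 1 = x\<^sup>2 + x * y + y\<^sup>2"
proof -
  define P2 P3 P6 where "P2 = add_mset 1 (replicate_mset (3 * k) (2::nat))"
    and "P3 = add_mset 1 (replicate_mset (2 * k) (3::nat))" and "P6 = add_mset 1 (replicate_mset k (6::nat))"
  obtain f where bc: "branched_cover two_sphere two_sphere f"
    and cd: "has_cover_degree two_sphere two_sphere f (6 * k + 1)"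
    and fin: "finite (branching_points two_sphere two_sphere f)"
    and card: "card (branching_points two_sphere two_sphere f) = 3"
    and im: "image_mset (local_degrees_over two_sphere two_sphere f)
      (mset_set (branching_points two_sphere two_sphere f)) = {# P2, P3, P6 #}"
    using real unfolding realizable_def P2_def P3_def P6_def by (auto simp del: One_nat_def)
  define B where "B = branching_points two_sphere two_sphere f"
  define ldo where "ldo = local_degrees_over two_sphere two_sphere f"
  define ld where "ld = local_degree two_sphere two_sphere f"
  have "ldo ` B = {P2, P3, P6}"
    using arg_cong[OF im, of set_mset] fin by (simp add: ldo_def B_def)
  then have "P2 \<in> ldo ` B" "P3 \<in> ldo ` B" "P6 \<in> ldo ` B" by blast+
  then obtain b2 b3 b6 where bs: "b2 \<in> B" "ldo b2 = P2" "b3 \<in> B" "ldo b3 = P3" "b6 \<in> B" "ldo b6 = P6"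
    by (elim imageE) (rule that, simp_all)
  \<comment> \<open>k \<ge> 1 makes the three partitions different, so each belongs to exactly one
    branching point.\<close>
  have sets: "set_mset P2 = {1, 2}" "set_mset P3 = {1, 3}" "set_mset P6 = {1, 6}"
    using k by (auto simp: P2_def P3_def P6_def)
  have "P2 \<noteq> P3" "P2 \<noteq> P6" "P3 \<noteq> P6"
  proof -
    have "2 \<in># P2" "2 \<notin># P3" "2 \<notin># P6" "3 \<in># P3" "3 \<notin># P6" unfolding sets by simp_all
    then show "P2 \<noteq> P3" "P2 \<noteq> P6" "P3 \<noteq> P6" by metis+
  qed
  then have ne: "b2 \<noteq> b3" "b2 \<noteq> b6" "b3 \<noteq> b6" using bs by metis+
  have "{b2, b3, b6} = B"
  proof (rule card_subset_eq)
    show "finite B" "{b2, b3, b6} \<subseteq> B" using fin bs by (auto simp: B_def)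
    show "card {b2, b3, b6} = card B" using ne card by (simp add: B_def)
  qed
  then have B: "B = {b2, b3, b6}" by simp
  have "B \<subseteq> two_sphere" unfolding B_def branching_points_def by blast
  then have bS: "b2 \<in> two_sphere" "b3 \<in> two_sphere" "b6 \<in> two_sphere" using bs by blast+
  \<comment> \<open>\<sigma> is adapted to f: the values of F at the points of order 6, 2 and 3
    become the branching points with partitions P6, P2 and P3.\<close>
  obtain \<sigma> \<sigma>' where hom: "homeomorphism (UNIV :: complex set) (two_sphere - {b6}) \<sigma> \<sigma>'"
    and sigma: "\<sigma> (eisenstein_sum (1 / 2)) = b2" "\<sigma> (eisenstein_sum third_point) = b3"
    using punctured_sphere_homeomorphism_through[OF bS(3) bS(1,2) ne(2)[symmetric] ne(3)[symmetric] ne(1) eisenstein_sum_half_ne_third]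
    by metis
  interpret orbifold_map b6 \<sigma> \<sigma>' by unfold_locales (use bS hom in auto)
  have Fs: "F 0 = b6" "F (1 / 2) = b2" "F third_point = b3"
    unfolding F_def using half_notin_eisenstein third_point_notin_eisenstein sigma by simp_all
  have FB: "B = F ` special_points" unfolding B special_points_def using Fs by auto
  have degs: "k' \<in># ldo y" if x: "x \<in> two_sphere" "f x = y" "has_local_degree two_sphere two_sphere f x k'" for x y k'
  proof -
    have "x \<in># mset_set {x \<in> two_sphere. f x = y}"
      using x(1,2) branched_cover_finite_fibre[OF bc, of y] by simp
    then show ?thesis
      unfolding ldo_def local_degrees_over_def using local_degree_eqI[OF x(3)] by force
  qed
  have branch: "F z \<in> B \<longleftrightarrow> stab z \<noteq> 1" for z
  proof
    assume "F z \<in> B"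
    then obtain p where p: "p \<in> special_points" "F z = F p" unfolding FB by blast
    then have "stab z = stab p" using stab_orbit_rel unfolding F_eq_iff by blast
    then show "stab z \<noteq> 1" using special_stab_ne_1[OF p(1)] by simp
  next
    assume "stab z \<noteq> 1"
    then obtain p where "p \<in> special_points" "orbit_rel p z" by (rule special_orbit_of_stab)
    then show "F z \<in> B" unfolding FB using F_orbit_rel by (metis imageI)
  qed
  have ldo_special: "set_mset (ldo (F p)) = {1, stab p}" if "p \<in> special_points" for p
  proof -
    have "p = 0 \<or> p = 1 / 2 \<or> p = third_point" using that unfolding special_points_def by blast
    then show ?thesis
    proof (elim disjE)
      assume p: "p = 0" show ?thesis unfolding p Fs bs sets stab_0 ..
    next
      assume p: "p = 1 / 2" show ?thesis unfolding p Fs bs sets stab_half ..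
    next
      assume p: "p = third_point" show ?thesis unfolding p Fs bs sets stab_third ..
    qed
  qed
  have dvd: "\<exists>k'. has_local_degree two_sphere two_sphere f x k' \<and> k' dvd stab z"
    if x: "x \<in> two_sphere" "f x = F z" for x z
  proof (cases "stab z = 1")
    case True
    then have "f x \<notin> B" using branch x(2) by simp
    then have "has_local_degree two_sphere two_sphere f x 1"
      unfolding B_def by (rule has_local_degree_1_off_branching[OF bc x(1)])
    then show ?thesis by (intro exI[of _ 1]) simp
  next
    case False
    then obtain p where p: "p \<in> special_points" "orbit_rel p z" by (rule special_orbit_of_stab)
    obtain k' where k': "has_local_degree two_sphere two_sphere f x k'"
      using bc x(1) unfolding branched_cover_def by blast
    have "F z = F p" by (rule F_orbit_rel[OF p(2)])
    then have "k' \<in># ldo (F p)" using degs[OF x k'] by simp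
    then have "k' = 1 \<or> k' = stab p" unfolding ldo_special[OF p(1)] by blast
    then have "k' dvd stab z" using stab_orbit_rel[OF p(2)] by auto
    then show ?thesis using k' by blast
  qed
  \<comment> \<open>The entry 1 of P6 provides the unbranched point over b6.\<close>
  have "1 \<in># ldo b6" unfolding bs sets by simp
  then have "\<exists>x. x \<in># mset_set {x \<in> two_sphere. f x = b6} \<and> ld x = 1"
    unfolding ldo_def local_degrees_over_def ld_def by auto
  then obtain x0 where x0: "x0 \<in># mset_set {x \<in> two_sphere. f x = b6}" "ld x0 = 1" by blast
  have x0': "x0 \<in> two_sphere" "f x0 = b6"
    using x0(1) branched_cover_finite_fibre[OF bc, of b6] by simp_all
  then obtain k' where k': "has_local_degree two_sphere two_sphere f x0 k'"
    using bc unfolding branched_cover_def by blast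
  then have "k' = 1" using local_degree_eqI[OF k'] x0(2) by (simp add: ld_def)
  then have x0_deg: "has_local_degree two_sphere two_sphere f x0 1" using k' by simp
  have cov: "covering_space (two_sphere - f -` B) f (two_sphere - B)"
    and fib: "\<And>y. y \<in> two_sphere - B \<Longrightarrow>
      finite {x \<in> two_sphere. f x = y} \<and> card {x \<in> two_sphere. f x = y} = 6 * k + 1"
    using cd unfolding has_cover_degree_def Let_def B_def by blast+
  have finB: "finite B" using fin by (simp add: B_def)
  have x0F: "f x0 = F 0" using x0'(2) Fs(1) by simp
  interpret orbifold_cover b6 \<sigma> \<sigma>' f B "6 * k + 1" x0
    by unfold_locales (rule bc cov finB branch dvd fib x0'(1) x0F x0_deg | assumption)+
  show ?thesis by (rule degree_norm_form)
qed

theorem theorem0p5: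
  fixes k d :: nat and \<D> :: "nat multiset multiset"
  assumes "k \<ge> 1" and "d = 6 * k + 1"
    and "\<D> = {# add_mset 1 (replicate_mset (3 * k) 2),
                 add_mset 1 (replicate_mset (2 * k) 3),
                 add_mset 1 (replicate_mset k 6) #}"
  shows "candidate_surface_branched_cover two_sphere two_sphere d \<D> \<and>
         (realizable two_sphere two_sphere d \<D> \<longleftrightarrow> (\<exists>x y :: nat. d = x\<^sup>2 + x * y + y\<^sup>2))"
  unfolding assms(2,3)
  using candidate_2_3_6[OF assms(1)] norm_form_if_realizable[OF assms(1)]
    realizable_if_norm_form[OF assms(1)] by blast

end
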